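(* Let $\overline M=M\cup\partial M$ be a smooth manifold with boundary and let $\nabla$ be a special torsion-free linear connection on $TM$ which is projectively pre-compact and has the property that the weighted second fundamental form $\Phi|_{T\partial M\times T\partial M}$ vanishes identically. Then for any local defining function $\rho$ for $\partial M$, the connection $\nabla^\rho$ restricts to give a torsion-free linear connection on $T\partial M\to\partial M$ (over the part of $\partial M$ in the domain of $\rho$), and any other defining function $\hat\rho$ leads to a projectively equivalent connection. Hence the boundary $\partial M$ inherits a projective structure from $\nabla$.
   Context: Setting. $\overline M$ is a smooth manifold with boundary $\partial M$ and interior $M$, $\dim\overline M=n+1$. An object on $U\cap M$ ($U\subset\overline M$ open) is "smooth up to the boundary" if it is the restriction of a smooth object on $U$. A local defining function for $\partial M$ is a smooth $\rho:U\to\mathbb R$, $U\subset\overline M$ open, with $\rho^{-1}(0)=U\cap\partial M$ and $d\rho$ nowhere zero on $U\cap\partial M$. $\mathfrak X_\partial(U)\subset\mathfrak X(U)$ is the space of vector fields tangent to $\partial M$ along $U\cap\partial M$. Connections. A torsion-free linear connection on $TM$ is special if it preserves a (nowhere vanishing) volume density. For a one-form $\Upsilon$, $\nabla+\Upsilon$ denotes the connection $\nabla_\xi\eta+\Upsilon(\xi)\eta+\Upsilon(\eta)\xi$; torsion-free connections are projectively equivalent if they differ in this way by a smooth $\Upsilon$, and a projective structure is an equivalence class. Put $\nabla^\rho:=\nabla+\frac{d\rho}{\rho}$ on $U\cap M$. A special $\nabla$ is projectively pre-compact (of order $1$) if for each $U$ and each local defining function $\rho:U\to\mathbb R$: (i)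 $d\rho(\nabla^\rho_\xi\eta)$ is smooth up to the boundary for all $\xi,\eta\in\mathfrak X(U)$; (ii) $\rho\nabla^\rho_\xi\eta$ is smooth up to the boundary for all $\xi,\eta\in\mathfrak X(U)$; (iii) $\nabla^\rho_\xi\eta$ is smooth up to the boundary if at least one of $\xi,\eta\in\mathfrak X(U)$ lies in $\mathfrak X_\partial(U)$. Second fundamental form. $\mathcal E(1)$ is the line bundle of projective densities of weight $1$, normalized so that $\mathcal E(1)^{-(n+2)}$ is the bundle of volume densities. Fix a nowhere vanishing $\nabla$-parallel $\sigma\in\Gamma(\mathcal E(1)|_M)$. The section $\nabla^\rho\nabla^\rho\sigma$ of $S^2T^*M\otimes\mathcal E(1)$ is smooth up to the boundary and its boundary value, with both entries restricted to $T\partial M$, is independent of $\rho$; this is $\Phi|_{T\partial M\times T\partial M}$. Equivalently, for $\xi,\eta\in\mathfrak X_\partial$, $\Phi(\xi|_{\partial M},\eta|_{\partial M})$ is the boundary value of $-d\rho(\nabla^\rho_\xi\eta)\,\sigma/\rho$, where $\sigma/\rho$ extends to a nowhere vanishing smooth section on $U$. "$\nabla^\rho$ restricts to a connection on $T\partial M$" means: for $\underline\xi,\underline\eta\in\mathfrak X(\partial M)$ with extensions $\xi,\eta\in\mathfrak X_\partial$, the boundary value of $\nabla^\rho_\xi\eta$ is tangent to $\partial M$, depends only on $\underline\xi,\underline\eta$, and defines a linear connection on $T\partial M$. *)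

theory Defs
  imports "HOL-Analysis.Analysis"
begin

primrec Ck_on :: "nat \<Rightarrow> 'a::real_normed_vector set \<Rightarrow> ('a \<Rightarrow> 'b::real_normed_vector) \<Rightarrow> bool" where
  "Ck_on 0 S f \<longleftrightarrow> continuous_on S f"
| "Ck_on (Suc r) S f \<longleftrightarrow>
     (\<forall>x\<in>S. f differentiable (at x)) \<and>
     (\<forall>v. Ck_on r S (\<lambda>x. frechet_derivative f (at x) v))"

text \<open>On a set that need not be open (a relatively open subset of a half-space or of a
  hyperplane), smooth means: locally the restriction of a smooth map on an open set.\<close>

definition smooth_on_set ::
  "'a::real_normed_vector set \<Rightarrow> ('a \<Rightarrow> 'b::real_normed_vector) \<Rightarrow> bool" where
  "smooth_on_set S f \<longleftrightarrow>
     (\<forall>x\<in>S. \<exists>G g. open G \<and> x \<in> G \<and> (\<forall>r. Ck_on r G g) \<and> (\<forall>y\<in>S \<inter> G. g y = f y))"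

text \<open>A manifold is a topology together with an atlas whose charts take values in a fixed
  model subset of \<open>real ^ 'n\<close>.  The model is a half-space for manifolds with
  boundary of dimension \<open>CARD('n)\<close>, and a hyperplane for their boundaries (which
  then have dimension \<open>CARD('n) - 1\<close>, possibly zero).\<close>

record ('m, 'n) mfd =
  mtop :: "'m topology"
  charts :: "('m set \<times> ('m \<Rightarrow> real ^ 'n)) set"
  model :: "(real ^ 'n) set"

definition halfspace :: "'n \<Rightarrow> (real ^ 'n::finite) set" where
  "halfspace k = {x. 0 \<le> x $ k}"

definition hyperplane :: "'n \<Rightarrow> (real ^ 'n::finite) set" where
  "hyperplane k = {x. x $ k = 0}"

definition smooth_manifold :: "('m, 'n::finite) mfd \<Rightarrow> bool" where
  "smooth_manifold M \<longleftrightarrow>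
     Hausdorff_space (mtop M) \<and> second_countable (mtop M) \<and>
     \<Union>(fst ` charts M) = topspace (mtop M) \<and>
     (\<forall>(U, \<phi>)\<in>charts M.
        openin (mtop M) U \<and> openin (top_of_set (model M)) (\<phi> ` U) \<and>
        homeomorphic_map (subtopology (mtop M) U) (top_of_set (\<phi> ` U)) \<phi>) \<and>
     (\<forall>(U, \<phi>)\<in>charts M. \<forall>(V, \<psi>)\<in>charts M.
        smooth_on_set (\<phi> ` (U \<inter> V)) (\<psi> \<circ> inv_into U \<phi>))"

definition manifold_with_boundary :: "'n \<Rightarrow> ('m, 'n::finite) mfd \<Rightarrow> bool" where
  "manifold_with_boundary k M \<longleftrightarrow> model M = halfspace k \<and> smooth_manifold M"

definition bdry :: "'n \<Rightarrow> ('m, 'n::finite) mfd \<Rightarrow> 'm set" where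
  "bdry k M = {p. \<exists>(U, \<phi>)\<in>charts M. p \<in> U \<and> \<phi> p \<in> hyperplane k}"

definition intr :: "'n \<Rightarrow> ('m, 'n::finite) mfd \<Rightarrow> 'm set" where
  "intr k M = topspace (mtop M) - bdry k M"

definition bdry_mfd :: "'n \<Rightarrow> ('m, 'n::finite) mfd \<Rightarrow> ('m, 'n) mfd" where
  "bdry_mfd k M =
     \<lparr>mtop = subtopology (mtop M) (bdry k M),
      charts = (\<lambda>(U, \<phi>). (U \<inter> bdry k M, \<phi>)) ` charts M,
      model = hyperplane k\<rparr>"

text \<open>Functions, fields and sections over an open set \<open>W\<close> are total HOL functions of which
  only the values on \<open>W\<close> matter; so the restriction of an object to a smaller open set is
  that object itself.\<close>

definition smooth_funs :: "('m, 'n::finite) mfd \<Rightarrow> 'm set \<Rightarrow> ('m \<Rightarrow> real) set" where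
  "smooth_funs M W = {f. openin (mtop M) W \<and>
     (\<forall>(U, \<phi>)\<in>charts M. smooth_on_set (\<phi> ` (U \<inter> W)) (f \<circ> inv_into U \<phi>))}"

definition smooth_at :: "('m, 'n::finite) mfd \<Rightarrow> 'm \<Rightarrow> ('m \<Rightarrow> real) \<Rightarrow> bool" where
  "smooth_at M p f \<longleftrightarrow> (\<exists>W. p \<in> W \<and> f \<in> smooth_funs M W)"

type_synonym 'm tvec = "('m \<Rightarrow> real) \<Rightarrow> real"
type_synonym 'm field = "'m \<Rightarrow> 'm tvec"
type_synonym 'm conn = "'m field \<Rightarrow> 'm field \<Rightarrow> 'm field"

text \<open>Tangent vectors at \<open>p\<close> are the derivations of the algebra of germs at \<open>p\<close> of smooth
  functions, normalized to be 0 on functions that are not smooth near \<open>p\<close>.\<close>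

definition tspace :: "('m, 'n::finite) mfd \<Rightarrow> 'm \<Rightarrow> 'm tvec set" where
  "tspace M p = {v. p \<in> topspace (mtop M) \<and>
     (\<forall>f. \<not> smooth_at M p f \<longrightarrow> v f = 0) \<and>
     (\<forall>f g W. openin (mtop M) W \<and> p \<in> W \<and> (\<forall>q\<in>W. f q = g q) \<longrightarrow> v f = v g) \<and>
     (\<forall>f g a b. smooth_at M p f \<and> smooth_at M p g \<longrightarrow>
        v (\<lambda>q. a * f q + b * g q) = a * v f + b * v g) \<and>
     (\<forall>f g. smooth_at M p f \<and> smooth_at M p g \<longrightarrow>
        v (\<lambda>q. f q * g q) = f p * v g + g p * v f)}"

definition vfields :: "('m, 'n::finite) mfd \<Rightarrow> 'm set \<Rightarrow> 'm field set" where
  "vfields M W = {X. openin (mtop M) W \<and> (\<forall>p\<in>W. X p \<in> tspace M p) \<and>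
     (\<forall>V f. V \<subseteq> W \<and> f \<in> smooth_funs M V \<longrightarrow> (\<lambda>p. X p f) \<in> smooth_funs M V)}"

definition lie_bracket :: "('m, 'n::finite) mfd \<Rightarrow> 'm field \<Rightarrow> 'm field \<Rightarrow> 'm field" where
  "lie_bracket M X Y p f =
     (if smooth_at M p f then X p (\<lambda>q. Y q f) - Y p (\<lambda>q. X q f) else 0)"

definition one_forms :: "('m, 'n::finite) mfd \<Rightarrow> 'm set \<Rightarrow> ('m \<Rightarrow> 'm tvec \<Rightarrow> real) set" where
  "one_forms M W = {\<Upsilon>. openin (mtop M) W \<and>
     (\<forall>p\<in>W. \<forall>v\<in>tspace M p. \<forall>w\<in>tspace M p. \<forall>a b.
        \<Upsilon> p (\<lambda>f. a * v f + b * w f) = a * \<Upsilon> p v + b * \<Upsilon> p w) \<and>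
     (\<forall>V X. V \<subseteq> W \<and> X \<in> vfields M V \<longrightarrow> (\<lambda>p. \<Upsilon> p (X p)) \<in> smooth_funs M V)}"

text \<open>The differential at \<open>p\<close> of the inclusion of the boundary.\<close>

definition bdry_incl :: "('m, 'n::finite) mfd \<Rightarrow> 'm \<Rightarrow> 'm tvec \<Rightarrow> 'm tvec" where
  "bdry_incl M p w = (\<lambda>f. if smooth_at M p f then w f else 0)"

definition bdry_tspace :: "'n \<Rightarrow> ('m, 'n::finite) mfd \<Rightarrow> 'm \<Rightarrow> 'm tvec set" where
  "bdry_tspace k M p = bdry_incl M p ` tspace (bdry_mfd k M) p"

definition vfields_tan :: "'n \<Rightarrow> ('m, 'n::finite) mfd \<Rightarrow> 'm set \<Rightarrow> 'm field set" where
  "vfields_tan k M U = {X \<in> vfields M U. \<forall>p\<in>U \<inter> bdry k M. X p \<in> bdry_tspace k M p}"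

definition local_defining :: "'n \<Rightarrow> ('m, 'n::finite) mfd \<Rightarrow> 'm set \<Rightarrow> ('m \<Rightarrow> real) \<Rightarrow> bool" where
  "local_defining k M U \<rho> \<longleftrightarrow> \<rho> \<in> smooth_funs M U \<and>
     (\<forall>p\<in>U. \<rho> p = 0 \<longleftrightarrow> p \<in> bdry k M) \<and>
     (\<forall>p\<in>U \<inter> bdry k M. \<exists>v\<in>tspace M p. v \<rho> \<noteq> 0)"

text \<open>A linear connection over an open set \<open>S\<close>, given as a local operator: it acts on the
  vector fields over every open subset \<open>W\<close> of \<open>S\<close>, compatibly with restriction.\<close>

definition linear_connection :: "('m, 'n::finite) mfd \<Rightarrow> 'm set \<Rightarrow> 'm conn \<Rightarrow> bool" where
  "linear_connection M S D \<longleftrightarrow> openin (mtop M) S \<and>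
     (\<forall>W X Y. W \<subseteq> S \<and> X \<in> vfields M W \<and> Y \<in> vfields M W \<longrightarrow>
        D X Y \<in> vfields M W \<and>
        (\<forall>X'\<in>vfields M W. \<forall>Y'\<in>vfields M W.
           (\<forall>p\<in>W. X' p = X p \<and> Y' p = Y p) \<longrightarrow> (\<forall>p\<in>W. D X' Y' p = D X Y p)) \<and>
        (\<forall>Z\<in>vfields M W. \<forall>p\<in>W. \<forall>f.
           D (\<lambda>q g. X q g + Z q g) Y p f = D X Y p f + D Z Y p f \<and>
           D X (\<lambda>q g. Y q g + Z q g) p f = D X Y p f + D X Z p f) \<and>
        (\<forall>h\<in>smooth_funs M W. \<forall>p\<in>W. \<forall>f.
           D (\<lambda>q g. h q * X q g) Y p f = h p * D X Y p f \<and>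
           D X (\<lambda>q g. h q * Y q g) p f = X p h * Y p f + h p * D X Y p f))"

definition torsion_free :: "('m, 'n::finite) mfd \<Rightarrow> 'm set \<Rightarrow> 'm conn \<Rightarrow> bool" where
  "torsion_free M S D \<longleftrightarrow>
     (\<forall>W X Y. W \<subseteq> S \<and> X \<in> vfields M W \<and> Y \<in> vfields M W \<longrightarrow>
        (\<forall>p\<in>W. \<forall>f. D X Y p f - D Y X p f = lie_bracket M X Y p f))"

definition agree_on :: "('m, 'n::finite) mfd \<Rightarrow> 'm set \<Rightarrow> 'm conn \<Rightarrow> 'm conn \<Rightarrow> bool" where
  "agree_on M S D D' \<longleftrightarrow>
     (\<forall>W X Y. W \<subseteq> S \<and> X \<in> vfields M W \<and> Y \<in> vfields M W \<longrightarrow> (\<forall>p\<in>W. D X Y p = D' X Y p))"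

definition proj_change :: "'m conn \<Rightarrow> ('m \<Rightarrow> 'm tvec \<Rightarrow> real) \<Rightarrow> 'm conn" where
  "proj_change D \<Upsilon> X Y = (\<lambda>p f. D X Y p f + \<Upsilon> p (X p) * Y p f + \<Upsilon> p (Y p) * X p f)"

definition proj_equivalent :: "('m, 'n::finite) mfd \<Rightarrow> 'm set \<Rightarrow> 'm conn \<Rightarrow> 'm conn \<Rightarrow> bool" where
  "proj_equivalent M S D D' \<longleftrightarrow> (\<exists>\<Upsilon>\<in>one_forms M S. agree_on M S D' (proj_change D \<Upsilon>))"

definition projective_structure :: "('m, 'n::finite) mfd \<Rightarrow> 'm set \<Rightarrow> 'm conn set \<Rightarrow> bool" where
  "projective_structure M S P \<longleftrightarrow>
     (\<exists>D. linear_connection M S D \<and> torsion_free M S D \<and>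
        P = {D'. linear_connection M S D' \<and> torsion_free M S D' \<and> proj_equivalent M S D D'})"

text \<open>\<open>\<nabla> + d\<rho>/\<rho>\<close>; note that \<open>d\<rho> (v) = v \<rho>\<close> for derivations \<open>v\<close>.\<close>

definition nabla_rho :: "'m conn \<Rightarrow> ('m \<Rightarrow> real) \<Rightarrow> 'm conn" where
  "nabla_rho D \<rho> = proj_change D (\<lambda>p v. v \<rho> / \<rho> p)"

text \<open>Densities are only used on manifolds modelled on a half-space, where tangent spaces have
  dimension \<open>CARD('n)\<close>, so that frames are indexed by \<open>'n\<close>.\<close>

type_synonym ('m, 'n) dens = "('n \<Rightarrow> 'm tvec) \<Rightarrow> real"

definition frame_at :: "('m, 'n::finite) mfd \<Rightarrow> 'm \<Rightarrow> ('n \<Rightarrow> 'm tvec) \<Rightarrow> bool" where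
  "frame_at M p e \<longleftrightarrow> (\<forall>i. e i \<in> tspace M p) \<and>
     (\<forall>v\<in>tspace M p. \<exists>!c::real ^ 'n. v = (\<lambda>f. \<Sum>i\<in>UNIV. c $ i * e i f))"

definition local_frame :: "('m, 'n::finite) mfd \<Rightarrow> 'm set \<Rightarrow> ('n \<Rightarrow> 'm field) \<Rightarrow> bool" where
  "local_frame M V e \<longleftrightarrow> (\<forall>i. e i \<in> vfields M V) \<and> (\<forall>p\<in>V. frame_at M p (\<lambda>i. e i p))"

text \<open>The fibre at \<open>p\<close> of the \<open>s\<close>-th power of the bundle of volume densities, as
  functions of frames (normalized to be 0 on families that are not frames).\<close>

definition density_at :: "('m, 'n::finite) mfd \<Rightarrow> real \<Rightarrow> 'm \<Rightarrow> ('m, 'n) dens set" where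
  "density_at M s p = {\<delta>. (\<forall>e. \<not> frame_at M p e \<longrightarrow> \<delta> e = 0) \<and>
     (\<forall>e (A::real ^ 'n ^ 'n). frame_at M p e \<and> invertible A \<longrightarrow>
        \<delta> (\<lambda>j f. \<Sum>i\<in>UNIV. A $ i $ j * e i f) = \<bar>det A\<bar> powr s * \<delta> e)}"

definition density_sections ::
  "('m, 'n::finite) mfd \<Rightarrow> real \<Rightarrow> 'm set \<Rightarrow> ('m \<Rightarrow> ('m, 'n) dens) set" where
  "density_sections M s W = {\<tau>. openin (mtop M) W \<and> (\<forall>p\<in>W. \<tau> p \<in> density_at M s p) \<and>
     (\<forall>V e. V \<subseteq> W \<and> openin (mtop M) V \<and> local_frame M V e \<longrightarrow>
        (\<lambda>p. \<tau> p (\<lambda>i. e i p)) \<in> smooth_funs M V)}"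

definition nowhere_vanishing ::
  "('m, 'n::finite) mfd \<Rightarrow> 'm set \<Rightarrow> ('m \<Rightarrow> ('m, 'n) dens) \<Rightarrow> bool" where
  "nowhere_vanishing M W \<tau> \<longleftrightarrow> (\<forall>p\<in>W. \<forall>e. frame_at M p e \<longrightarrow> \<tau> p e \<noteq> 0)"

text \<open>\<open>\<tau>'\<close> is the covariant derivative, over \<open>W\<close>, of the \<open>s\<close>-density \<open>\<tau>\<close> in direction \<open>X\<close> for
  the connection induced by \<open>D\<close>: writing \<open>D X (e j) = (\<Sum>i. c i j * e i)\<close> in a local frame
  \<open>e\<close>, it satisfies \<open>\<tau>'(e) = X (\<tau>(e)) - s * trace c * \<tau>(e)\<close>.\<close>

definition density_deriv ::
  "('m, 'n::finite) mfd \<Rightarrow> 'm conn \<Rightarrow> real \<Rightarrow> 'm set \<Rightarrow> 'm field \<Rightarrow>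
   ('m \<Rightarrow> ('m, 'n) dens) \<Rightarrow> ('m \<Rightarrow> ('m, 'n) dens) \<Rightarrow> bool" where
  "density_deriv M D s W X \<tau> \<tau>' \<longleftrightarrow>
     \<tau>' \<in> density_sections M s W \<and>
     (\<forall>V e p (c::real ^ 'n ^ 'n).
        V \<subseteq> W \<and> openin (mtop M) V \<and> local_frame M V e \<and> p \<in> V \<and>
        (\<forall>j. D X (e j) p = (\<lambda>f. \<Sum>i\<in>UNIV. c $ i $ j * e i p f)) \<longrightarrow>
        \<tau>' p (\<lambda>i. e i p) =
          X p (\<lambda>q. \<tau> q (\<lambda>i. e i q)) - s * trace c * \<tau> p (\<lambda>i. e i p))"

definition parallel_density ::
  "('m, 'n::finite) mfd \<Rightarrow> 'm set \<Rightarrow> 'm conn \<Rightarrow> real \<Rightarrow> ('m \<Rightarrow> ('m, 'n) dens) \<Rightarrow> bool" where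
  "parallel_density M S D s \<tau> \<longleftrightarrow> \<tau> \<in> density_sections M s S \<and>
     (\<forall>W X. W \<subseteq> S \<and> X \<in> vfields M W \<longrightarrow> density_deriv M D s W X \<tau> (\<lambda>_ _. 0))"

definition special_connection :: "('m, 'n::finite) mfd \<Rightarrow> 'm set \<Rightarrow> 'm conn \<Rightarrow> bool" where
  "special_connection M S D \<longleftrightarrow>
     (\<exists>\<mu>. parallel_density M S D 1 \<mu> \<and> nowhere_vanishing M S \<mu>)"

text \<open>With \<open>CARD('n) = n + 1\<close>, sections of \<open>\<E>(1)\<close> are densities of order \<open>- 1 / (n + 2)\<close>.\<close>

definition weight1 :: "'n::finite itself \<Rightarrow> real" where
  "weight1 _ = - 1 / (real CARD('n) + 1)"

definition proj_precompact :: "'n \<Rightarrow> ('m, 'n::finite) mfd \<Rightarrow> 'm conn \<Rightarrow> bool" where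
  "proj_precompact k M D \<longleftrightarrow>
     (\<forall>U \<rho> \<xi> \<eta>. local_defining k M U \<rho> \<and> \<xi> \<in> vfields M U \<and> \<eta> \<in> vfields M U \<longrightarrow>
        (\<exists>h\<in>smooth_funs M U. \<forall>p\<in>U \<inter> intr k M. h p = nabla_rho D \<rho> \<xi> \<eta> p \<rho>) \<and>
        (\<exists>\<zeta>\<in>vfields M U. \<forall>p\<in>U \<inter> intr k M. \<forall>f. \<zeta> p f = \<rho> p * nabla_rho D \<rho> \<xi> \<eta> p f) \<and>
        (\<xi> \<in> vfields_tan k M U \<or> \<eta> \<in> vfields_tan k M U \<longrightarrow>
           (\<exists>\<zeta>\<in>vfields M U. \<forall>p\<in>U \<inter> intr k M. \<zeta> p = nabla_rho D \<rho> \<xi> \<eta> p)))"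

text \<open>The value \<open>H\<close> of the second covariant derivative \<open>DD\<tau>\<close> on \<open>(\<xi>, \<eta>)\<close> over \<open>W\<close>, i.e.
  \<open>D\<^sub>\<xi> D\<^sub>\<eta> \<tau> - D\<^bsub>D\<^sub>\<xi> \<eta>\<^esub> \<tau>\<close>.\<close>

definition density_hessian ::
  "('m, 'n::finite) mfd \<Rightarrow> 'm conn \<Rightarrow> real \<Rightarrow> 'm set \<Rightarrow> 'm field \<Rightarrow> 'm field \<Rightarrow>
   ('m \<Rightarrow> ('m, 'n) dens) \<Rightarrow> ('m \<Rightarrow> ('m, 'n) dens) \<Rightarrow> bool" where
  "density_hessian M D s W \<xi> \<eta> \<tau> H \<longleftrightarrow>
     (\<exists>\<tau>1 \<tau>2 \<tau>3. density_deriv M D s W \<eta> \<tau> \<tau>1 \<and> density_deriv M D s W \<xi> \<tau>1 \<tau>2 \<and>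
        density_deriv M D s W (D \<xi> \<eta>) \<tau> \<tau>3 \<and> (\<forall>p\<in>W. \<forall>e. H p e = \<tau>2 p e - \<tau>3 p e))"

text \<open>The boundary value at \<open>p\<close> of \<open>\<nabla>\<^sup>\<rho>\<nabla>\<^sup>\<rho>\<sigma>\<close>, evaluated on \<open>v, w\<close>: extend \<open>v, w\<close> to vector
  fields \<open>\<xi>, \<eta>\<close> near \<open>p\<close>, and evaluate at \<open>p\<close> a smooth section of \<open>\<E>(1)\<close> that extends
  \<open>(\<nabla>\<^sup>\<rho>\<nabla>\<^sup>\<rho>\<sigma>)(\<xi>, \<eta>)\<close> up to the boundary.\<close>

definition second_fundamental_form ::
  "'n \<Rightarrow> ('m, 'n::finite) mfd \<Rightarrow> 'm conn \<Rightarrow> ('m \<Rightarrow> ('m, 'n) dens) \<Rightarrow> 'm set \<Rightarrow> ('m \<Rightarrow> real) \<Rightarrow>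
   'm \<Rightarrow> 'm tvec \<Rightarrow> 'm tvec \<Rightarrow> ('m, 'n) dens" where
  "second_fundamental_form k M D \<sigma> U \<rho> p v w =
     (THE z. \<exists>V \<xi> \<eta> \<Psi>. V \<subseteq> U \<and> p \<in> V \<and>
        \<xi> \<in> vfields M V \<and> \<eta> \<in> vfields M V \<and> \<xi> p = v \<and> \<eta> p = w \<and>
        \<Psi> \<in> density_sections M (weight1 TYPE('n)) V \<and>
        density_hessian M (nabla_rho D \<rho>) (weight1 TYPE('n)) (V \<inter> intr k M) \<xi> \<eta> \<sigma> \<Psi> \<and>
        z = \<Psi> p)"

definition second_fundamental_form_vanishes ::
  "'n \<Rightarrow> ('m, 'n::finite) mfd \<Rightarrow> 'm conn \<Rightarrow> ('m \<Rightarrow> ('m, 'n) dens) \<Rightarrow> bool" where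
  "second_fundamental_form_vanishes k M D \<sigma> \<longleftrightarrow>
     (\<forall>U \<rho> p v w. local_defining k M U \<rho> \<and> p \<in> U \<inter> bdry k M \<and>
        v \<in> bdry_tspace k M p \<and> w \<in> bdry_tspace k M p \<longrightarrow>
        second_fundamental_form k M D \<sigma> U \<rho> p v w = (\<lambda>_. 0))"

text \<open>The connection \<open>N\<close> on the interior part of \<open>U\<close> restricts to the linear connection \<open>Db\<close> on
  the boundary part of \<open>U\<close>: for all tangential extensions \<open>\<xi>, \<eta>\<close> of boundary fields \<open>\<xi>b, \<eta>b\<close>,
  \<open>N \<xi> \<eta>\<close> is smooth up to the boundary, with boundary value (the image of) \<open>Db \<xi>b \<eta>b\<close>.\<close>

definition restricts_to_boundary ::
  "'n \<Rightarrow> ('m, 'n::finite) mfd \<Rightarrow> 'm set \<Rightarrow> 'm conn \<Rightarrow> 'm conn \<Rightarrow> bool" where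
  "restricts_to_boundary k M U N Db \<longleftrightarrow>
     linear_connection (bdry_mfd k M) (U \<inter> bdry k M) Db \<and>
     (\<forall>V \<xi> \<eta> \<xi>b \<eta>b. V \<subseteq> U \<and> \<xi> \<in> vfields_tan k M V \<and> \<eta> \<in> vfields_tan k M V \<and>
        \<xi>b \<in> vfields (bdry_mfd k M) (V \<inter> bdry k M) \<and>
        \<eta>b \<in> vfields (bdry_mfd k M) (V \<inter> bdry k M) \<and>
        (\<forall>p\<in>V \<inter> bdry k M. \<xi> p = bdry_incl M p (\<xi>b p) \<and> \<eta> p = bdry_incl M p (\<eta>b p)) \<longrightarrow>
        (\<exists>\<zeta>\<in>vfields M V. (\<forall>p\<in>V \<inter> intr k M. \<zeta> p = N \<xi> \<eta> p) \<and>
           (\<forall>p\<in>V \<inter> bdry k M. \<zeta> p = bdry_incl M p (Db \<xi>b \<eta>b p))))"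

end

theory Submission
  imports Defs
begin

text \<open>Let \<open>\<rho>\<close> be a local defining function and \<open>\<nabla>\<^sup>\<rho> = \<nabla> + d\<rho> / \<rho>\<close>.  For fields \<open>\<xi>, \<eta>\<close> that are tangent to
  the boundary, condition (iii) of pre-compactness says that \<open>\<nabla>\<^sup>\<rho>\<^sub>\<xi> \<eta>\<close> is smooth up to the boundary.  For
  these boundary values to define a connection on the boundary they have to be tangent to it, and
  they may depend only on the restrictions of \<open>\<xi>\<close> and \<open>\<eta>\<close>.

  Tangency is what the second fundamental form measures.  The weight of \<open>\<sigma>\<close> is such that
  \<open>\<nabla>\<^sup>\<rho> \<sigma> = (d\<rho> / \<rho>) \<sigma>\<close> (\<open>density_deriv_nabla\<close>), hence \<open>\<nabla>\<^sup>\<rho>\<nabla>\<^sup>\<rho> \<sigma>\<close> evaluated on \<open>\<xi>, \<eta>\<close> is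
  \<open>(\<xi> (\<eta> \<rho>) - d\<rho> (\<nabla>\<^sup>\<rho>\<^sub>\<xi> \<eta>)) \<sigma> / \<rho>\<close> (\<open>density_hessian_iff\<close>).  The first factor is tensorial and smooth up to the
  boundary by condition (i).  The second one is parallel for \<open>\<nabla>\<^sup>\<rho>\<close>; conditions (i) and (iii) make the
  trace of the connection matrix of \<open>\<nabla>\<^sup>\<rho>\<close> smooth up to the boundary in a frame adapted to \<open>\<rho>\<close>, so that
  \<open>\<sigma> / \<rho>\<close> solves a linear ordinary differential equation in the normal direction and extends to the
  boundary without zeros (\<open>sigma_over_rho_extends\<close>).  Thus the form, as a boundary value, is well defined
  (\<open>second_fundamental_form_value\<close>), and if it vanishes then \<open>d\<rho> (\<nabla>\<^sup>\<rho>\<^sub>\<xi> \<eta>)\<close> vanishes on the boundary for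
  tangential fields, because \<open>\<eta> \<rho>\<close> then vanishes there and so does its derivative along \<open>\<xi>\<close>
  (\<open>nabla_boundary_tangent\<close>).

  Independence of the extensions follows by expanding a field that vanishes on the boundary in an
  adapted frame (\<open>nabla_extension_zero\<close>).  The axioms of a connection and the vanishing of the
  torsion pass from the interior to the boundary by continuity (\<open>bdry_conn_connection\<close>).

  Two defining functions differ by a smooth factor \<open>f\<close> without zeros (\<open>defining_quotient\<close>), and the
  corresponding connections by the projective change with the one-form \<open>df / f\<close>, which is smooth up to
  the boundary (\<open>restrictions_proj_equivalent\<close>).  Finally a partition of unity gives a global defining
  function (\<open>global_defining_function\<close>); the class of the connection that it induces is the projective
  structure on the boundary.

  The analysis on manifolds behind this rests on one computation, Hadamard's lemma
  (\<open>hadamard_along\<close>).  It shows that derivations act through first derivatives in a chart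
  (\<open>tspace_chart\<close>), that functions vanishing on the boundary are divisible by a defining function
  (\<open>divide_by_defining\<close>), and hence that the kernel of \<open>d\<rho>\<close> is the tangent space of the boundary
  (\<open>bdry_tspaceI\<close>).\<close>


section \<open>Differential calculus of smooth maps\<close>

lemma Ck_on_cong:
  assumes "open S" "\<And>x. x \<in> S \<Longrightarrow> f x = g x" "Ck_on r S f"
  shows "Ck_on r S g"
  using assms(2,3)
proof (induction r arbitrary: f g)
  case 0
  then show ?case using continuous_on_eq by fastforce
next
  case (Suc r)
  have d: "f differentiable (at x)" if "x \<in> S" for x using Suc.prems that by simp
  have e: "frechet_derivative g (at x) = frechet_derivative f (at x)" if "x \<in> S" for x
    using frechet_derivative_transform_within_open[OF d[OF that] assms(1) that] Suc.prems(1) by simp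
  have d': "g differentiable (at x)" if "x \<in> S" for x
    using d[OF that] has_derivative_transform_within_open[OF _ assms(1) that] Suc.prems(1)
    unfolding differentiable_def by blast
  have "Ck_on r S (\<lambda>x. frechet_derivative g (at x) v)" for v
    by (rule Suc.IH[of "\<lambda>x. frechet_derivative f (at x) v"]) (use e Suc.prems in auto)
  then show ?case using d' by simp
qed

lemma Ck_on_subset: "Ck_on r S f \<Longrightarrow> T \<subseteq> S \<Longrightarrow> Ck_on r T f"
proof (induction r arbitrary: f)
  case 0
  then show ?case using continuous_on_subset by auto
next
  case (Suc r)
  have "Ck_on r T (\<lambda>x. frechet_derivative f (at x) v)" for v
    by (rule Suc.IH) (use Suc.prems in simp_all)
  then show ?case using Suc.prems by auto
qed

lemma Ck_on_local:
  assumes "\<And>x. x \<in> S \<Longrightarrow> \<exists>T. open T \<and> x \<in> T \<and> Ck_on r T f"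
  shows "Ck_on r S f"
  using assms
proof (induction r arbitrary: f)
  case 0
  have "isCont f x" if "x \<in> S" for x
  proof -
    obtain T where "open T" "x \<in> T" "Ck_on 0 T f" using 0 \<open>x \<in> S\<close> by blast
    then have "open T" "x \<in> T" "continuous_on T f" by simp_all
    then show ?thesis using continuous_on_eq_continuous_at by blast
  qed
  then show ?case by (simp add: continuous_at_imp_continuous_on)
next
  case (Suc r)
  have "f differentiable (at x)" if "x \<in> S" for x
  proof -
    obtain T where "open T" "x \<in> T" "Ck_on (Suc r) T f" using Suc.prems \<open>x \<in> S\<close> by blast
    then show ?thesis by simp
  qed
  moreover have "Ck_on r S (\<lambda>x. frechet_derivative f (at x) v)" for v
  proof (rule Suc.IH)
    fix x assume "x \<in> S"
    then obtain T where "open T" "x \<in> T" "Ck_on (Suc r) T f" using Suc.prems by blast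
    then show "\<exists>T. open T \<and> x \<in> T \<and> Ck_on r T (\<lambda>x. frechet_derivative f (at x) v)"
      by (intro exI[of _ T]) simp
  qed
  ultimately show ?case by simp
qed

lemma Ck_on_imp_continuous_on:
  "Ck_on r S f \<Longrightarrow> continuous_on S f"
  by (cases r) (auto intro!: continuous_at_imp_continuous_on differentiable_imp_continuous_within)

lemma Ck_on_SucD: "Ck_on (Suc r) S f \<Longrightarrow> Ck_on r S f"
proof (induction r arbitrary: f)
  case 0
  then show ?case using Ck_on_imp_continuous_on[OF 0] by simp
next
  case (Suc r)
  have "f differentiable (at x)" if "x \<in> S" for x
    using Suc.prems that by simp
  moreover have "Ck_on r S (\<lambda>x. frechet_derivative f (at x) v)" for v
    by (rule Suc.IH) (use Suc.prems in simp)
  ultimately show ?case by simp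
qed

lemma Ck_on_SucI:
  assumes "open S" "\<And>x. x \<in> S \<Longrightarrow> (f has_derivative f' x) (at x)"
    "\<And>v. Ck_on r S (\<lambda>x. f' x v)"
  shows "Ck_on (Suc r) S f"
proof -
  have "f' x = frechet_derivative f (at x)" if "x \<in> S" for x
    using assms(2)[OF that] frechet_derivative_at by blast
  then have "Ck_on r S (\<lambda>x. frechet_derivative f (at x) v)" for v
    using Ck_on_cong[OF assms(1) _ assms(3)[of v]] by simp
  moreover have "f differentiable (at x)" if "x \<in> S" for x
    using assms(2)[OF that] differentiable_def by blast
  ultimately show ?thesis by simp
qed

lemma Ck_on_has_derivative:
  "Ck_on (Suc r) S f \<Longrightarrow> x \<in> S \<Longrightarrow> (f has_derivative frechet_derivative f (at x)) (at x)"
  by (simp add: frechet_derivative_works)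

lemma Ck_on_const: "open S \<Longrightarrow> Ck_on r S (\<lambda>x. c)"
proof (induction r arbitrary: c)
  case (Suc r)
  then show ?case by (intro Ck_on_SucI[where f'="\<lambda>x v. 0"]) auto
qed auto

lemma Ck_on_linear:
  assumes "open S" "bounded_linear f"
  shows "Ck_on r S f"
proof (cases r)
  case 0
  then show ?thesis using assms by (simp add: linear_continuous_on)
next
  case (Suc n)
  then show ?thesis using assms
    by (simp only:) (intro Ck_on_SucI[where f'="\<lambda>x. f"] Ck_on_const bounded_linear_imp_has_derivative)
qed

lemma Ck_on_add:
  assumes "open S" "Ck_on r S f" "Ck_on r S g"
  shows "Ck_on r S (\<lambda>x. f x + g x)"
  using assms(2,3)
proof (induction r arbitrary: f g)
  case 0
  then show ?case by (auto intro: continuous_intros)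
next
  case (Suc r)
  then show ?case
    by (intro Ck_on_SucI[OF assms(1), where f'="\<lambda>x v. frechet_derivative f (at x) v + frechet_derivative g (at x) v"]
          has_derivative_add Ck_on_has_derivative) auto
qed

lemma Ck_on_sum:
  assumes "open S" "\<And>i. i \<in> I \<Longrightarrow> Ck_on r S (f i)"
  shows "Ck_on r S (\<lambda>x. \<Sum>i\<in>I. f i x)"
  using assms(2)
  by (induction I rule: infinite_finite_induct) (auto intro: Ck_on_const Ck_on_add assms(1))

lemma (in bounded_bilinear) Ck_on_prod:
  assumes "open S" "Ck_on r S f" "Ck_on r S g"
  shows "Ck_on r S (\<lambda>x. prod (f x) (g x))"
  using assms(2,3)
proof (induction r arbitrary: f g)
  case 0
  then show ?case by (auto intro: continuous_on)
next
  case (Suc r)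
  have "Ck_on r S (\<lambda>x. prod (f x) (frechet_derivative g (at x) v) + prod (frechet_derivative f (at x) v) (g x))" for v
    by (intro Ck_on_add assms(1) Suc.IH Ck_on_SucD[OF Suc.prems(1)] Ck_on_SucD[OF Suc.prems(2)])
      (use Suc.prems in auto)
  then show ?case using Suc.prems
    by (intro Ck_on_SucI[OF assms(1), where f'="\<lambda>x v. prod (f x) (frechet_derivative g (at x) v) + prod (frechet_derivative f (at x) v) (g x)"]
          FDERIV Ck_on_has_derivative) auto
qed

lemmas Ck_on_mult = bounded_bilinear.Ck_on_prod[OF bounded_bilinear_mult]
lemmas Ck_on_scaleR = bounded_bilinear.Ck_on_prod[OF bounded_bilinear_scaleR]

lemma Ck_on_linear_compose:
  assumes "open S" "bounded_linear h" "Ck_on r S f"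
  shows "Ck_on r S (\<lambda>x. h (f x))"
  using assms(3)
proof (induction r arbitrary: f)
  case 0
  then show ?case using assms(2) bounded_linear.continuous_on by auto
next
  case (Suc r)
  then show ?case
    by (intro Ck_on_SucI[OF assms(1), where f'="\<lambda>x v. h (frechet_derivative f (at x) v)"]
          bounded_linear.has_derivative[OF assms(2)] Ck_on_has_derivative) auto
qed

text \<open>The directional derivatives of \<open>g \<circ> f\<close> are finite sums of products of directional derivatives of
  \<open>f\<close> with compositions of lower order.\<close>

lemma Ck_on_compose:
  fixes f :: "'a::real_normed_vector \<Rightarrow> 'b::euclidean_space" and g :: "'b \<Rightarrow> 'c::real_normed_vector"
  assumes "open S" "open T" "f ` S \<subseteq> T" "Ck_on r S f" "Ck_on r T g"
  shows "Ck_on r S (\<lambda>x. g (f x))"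
  using assms(4,5)
proof (induction r arbitrary: g)
  case 0
  then show ?case using assms(3) continuous_on_compose2 by auto
next
  case (Suc r)
  let ?f' = "\<lambda>x. frechet_derivative f (at x)" and ?g' = "\<lambda>x. frechet_derivative g (at x)"
  have d: "((\<lambda>x. g (f x)) has_derivative (\<lambda>v. \<Sum>b\<in>Basis. (?f' x v \<bullet> b) *\<^sub>R ?g' (f x) b)) (at x)"
    if "x \<in> S" for x
  proof -
    have f: "(f has_derivative ?f' x) (at x)" using Ck_on_has_derivative Suc.prems(1) that by blast
    have g: "(g has_derivative ?g' (f x)) (at (f x))"
      using Ck_on_has_derivative[OF Suc.prems(2)] assms(3) that by blast
    then have l: "linear (?g' (f x))" using has_derivative_linear by blast
    have "?g' (f x) (?f' x v) = (\<Sum>b\<in>Basis. (?f' x v \<bullet> b) *\<^sub>R ?g' (f x) b)" for v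
    proof -
      have "?g' (f x) (?f' x v) = ?g' (f x) (\<Sum>b\<in>Basis. (?f' x v \<bullet> b) *\<^sub>R b)"
        by (simp add: euclidean_representation)
      then show ?thesis by (simp add: linear_sum[OF l] linear_cmul[OF l])
    qed
    then have e: "(\<lambda>v. ?g' (f x) (?f' x v)) = (\<lambda>v. \<Sum>b\<in>Basis. (?f' x v \<bullet> b) *\<^sub>R ?g' (f x) b)"
      by (rule ext)
    show ?thesis using has_derivative_compose[OF f g] unfolding e .
  qed
  have c: "Ck_on r S (\<lambda>x. ?g' (f x) b)" for b
    by (rule Suc.IH[OF Ck_on_SucD[OF Suc.prems(1)]]) (use Suc.prems in simp)
  have "Ck_on r S (\<lambda>x. \<Sum>b\<in>Basis. (?f' x v \<bullet> b) *\<^sub>R ?g' (f x) b)" for v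
    using Suc.prems c
    by (intro Ck_on_sum Ck_on_scaleR assms(1) Ck_on_linear_compose[OF assms(1) bounded_linear_inner_left]) auto
  with d show ?case by (rule Ck_on_SucI[OF assms(1)])
qed

definition Cinf_on :: "'a::real_normed_vector set \<Rightarrow> ('a \<Rightarrow> 'b::real_normed_vector) \<Rightarrow> bool" where
  "Cinf_on S f \<longleftrightarrow> (\<forall>r. Ck_on r S f)"

lemma Cinf_on_cong: "open S \<Longrightarrow> (\<And>x. x \<in> S \<Longrightarrow> f x = g x) \<Longrightarrow> Cinf_on S f \<Longrightarrow> Cinf_on S g"
  unfolding Cinf_on_def using Ck_on_cong by blast

lemma Cinf_on_subset: "Cinf_on S f \<Longrightarrow> T \<subseteq> S \<Longrightarrow> Cinf_on T f"
  unfolding Cinf_on_def using Ck_on_subset by blast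

lemma Cinf_on_local:
  "(\<And>x. x \<in> S \<Longrightarrow> \<exists>T. open T \<and> x \<in> T \<and> Cinf_on T f) \<Longrightarrow> Cinf_on S f"
  unfolding Cinf_on_def by (intro allI Ck_on_local) blast

lemma Cinf_on_const: "open S \<Longrightarrow> Cinf_on S (\<lambda>x. c)"
  unfolding Cinf_on_def using Ck_on_const by blast

lemma Cinf_on_linear: "open S \<Longrightarrow> bounded_linear f \<Longrightarrow> Cinf_on S f"
  unfolding Cinf_on_def using Ck_on_linear by blast

lemma Cinf_on_id: "open S \<Longrightarrow> Cinf_on S (\<lambda>x. x)"
  by (simp add: Cinf_on_linear bounded_linear_ident)

lemma Cinf_on_add: "open S \<Longrightarrow> Cinf_on S f \<Longrightarrow> Cinf_on S g \<Longrightarrow> Cinf_on S (\<lambda>x. f x + g x)"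
  unfolding Cinf_on_def using Ck_on_add by blast

lemma Cinf_on_sum: "open S \<Longrightarrow> (\<And>i. i \<in> I \<Longrightarrow> Cinf_on S (f i)) \<Longrightarrow> Cinf_on S (\<lambda>x. \<Sum>i\<in>I. f i x)"
  unfolding Cinf_on_def by (simp add: Ck_on_sum)

lemma Cinf_on_mult:
  fixes f g :: "_ \<Rightarrow> 'b::real_normed_algebra"
  shows "open S \<Longrightarrow> Cinf_on S f \<Longrightarrow> Cinf_on S g \<Longrightarrow> Cinf_on S (\<lambda>x. f x * g x)"
  unfolding Cinf_on_def by (simp add: Ck_on_mult)

lemma Cinf_on_scaleR: "open S \<Longrightarrow> Cinf_on S f \<Longrightarrow> Cinf_on S g \<Longrightarrow> Cinf_on S (\<lambda>x. f x *\<^sub>R g x)"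
  unfolding Cinf_on_def by (simp add: Ck_on_scaleR)

lemma Cinf_on_linear_compose:
  "open S \<Longrightarrow> bounded_linear h \<Longrightarrow> Cinf_on S f \<Longrightarrow> Cinf_on S (\<lambda>x. h (f x))"
  unfolding Cinf_on_def by (intro allI Ck_on_linear_compose[of S h _ f]) blast+

lemma Cinf_on_compose:
  fixes f :: "'a::real_normed_vector \<Rightarrow> 'b::euclidean_space" and g :: "'b \<Rightarrow> 'c::real_normed_vector"
  shows "open S \<Longrightarrow> open T \<Longrightarrow> f ` S \<subseteq> T \<Longrightarrow> Cinf_on S f \<Longrightarrow> Cinf_on T g \<Longrightarrow> Cinf_on S (\<lambda>x. g (f x))"
  unfolding Cinf_on_def by (intro allI Ck_on_compose[of S T f _ g]) blast+

lemma Cinf_on_nth: "open S \<Longrightarrow> Cinf_on S f \<Longrightarrow> Cinf_on S (\<lambda>x. (f x :: real ^ 'n) $ i)"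
  by (rule Cinf_on_linear_compose[where h="\<lambda>y. y $ i"]) (auto simp: bounded_linear_vec_nth)

lemma Cinf_on_has_derivative:
  "Cinf_on S f \<Longrightarrow> x \<in> S \<Longrightarrow> (f has_derivative frechet_derivative f (at x)) (at x)"
  unfolding Cinf_on_def using Ck_on_has_derivative by blast

lemma Cinf_on_frechet: "Cinf_on S f \<Longrightarrow> Cinf_on S (\<lambda>x. frechet_derivative f (at x) v)"
  unfolding Cinf_on_def using Ck_on.simps(2)[of _ S f] by simp

lemma Cinf_on_imp_continuous_on: "Cinf_on S f \<Longrightarrow> continuous_on S f"
  unfolding Cinf_on_def using Ck_on_imp_continuous_on by blast

lemma Cinf_on_inverse: "Cinf_on {x::real. x \<noteq> 0} inverse"
proof -
  have o: "open {x::real. x \<noteq> 0}" by (simp add: open_Collect_neq)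
  have "Ck_on r {x::real. x \<noteq> 0} inverse" for r
  proof (induction r)
    case 0
    then show ?case by (auto intro!: continuous_on_inverse continuous_intros)
  next
    case (Suc r)
    have "Ck_on r {x::real. x \<noteq> 0} (\<lambda>x. - v * (inverse x * inverse x))" for v
      by (intro Ck_on_mult Suc Ck_on_const o)
    then show ?case
      by (intro Ck_on_SucI[OF o, where f'="\<lambda>x v. - v * (inverse x * inverse x)"])
        (auto intro!: derivative_eq_intros simp: fun_eq_iff algebra_simps)
  qed
  then show ?thesis by (simp add: Cinf_on_def)
qed

lemma Cinf_on_exp: "Cinf_on UNIV (exp :: real \<Rightarrow> real)"
proof -
  have "Ck_on r UNIV (exp :: real \<Rightarrow> real)" for r
  proof (induction r)
    case 0
    then show ?case by (auto intro!: continuous_intros)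
  next
    case (Suc r)
    have "Ck_on r UNIV (\<lambda>x. v * exp (x::real))" for v
      by (intro Ck_on_mult Suc Ck_on_const open_UNIV)
    then show ?case
      by (intro Ck_on_SucI[OF open_UNIV, where f'="\<lambda>x v. v * exp x"])
        (auto intro!: derivative_eq_intros simp: fun_eq_iff algebra_simps)
  qed
  then show ?thesis by (simp add: Cinf_on_def)
qed

lemma Cinf_on_ln: "Cinf_on {0<..} (ln :: real \<Rightarrow> real)"
proof -
  have "Ck_on r {0<..} (ln :: real \<Rightarrow> real)" for r
  proof (cases r)
    case 0
    then show ?thesis by (auto intro!: continuous_intros)
  next
    case (Suc r)
    have "Ck_on r {0<..} (\<lambda>x. v * inverse (x::real))" for v
      using Cinf_on_inverse Ck_on_subset[of r "{x. x \<noteq> 0}" inverse "{0<..}"]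
      by (intro Ck_on_mult Ck_on_const) (auto simp: Cinf_on_def)
    then show ?thesis unfolding Suc
      by (intro Ck_on_SucI[where f'="\<lambda>x v. v * inverse x"])
        (auto intro!: derivative_eq_intros simp: fun_eq_iff field_simps)
  qed
  then show ?thesis by (simp add: Cinf_on_def)
qed

text \<open>Away from 0 the function is \<open>exp (s / 2 * ln (x\<^sup>2))\<close>, which avoids a case distinction on the sign.\<close>

lemma Cinf_on_abs_powr: "Cinf_on {x::real. x \<noteq> 0} (\<lambda>x. \<bar>x\<bar> powr s)"
proof -
  have o: "open {x::real. x \<noteq> 0}" by (simp add: open_Collect_neq)
  have "Cinf_on {x::real. x \<noteq> 0} (\<lambda>x. ln (x * x))"
    by (intro Cinf_on_compose[OF o _ _ _ Cinf_on_ln] Cinf_on_mult o Cinf_on_id) (auto simp: zero_less_mult_iff)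
  then have "Cinf_on {x::real. x \<noteq> 0} (\<lambda>x. exp (s / 2 * ln (x * x)))"
    by (intro Cinf_on_compose[OF o open_UNIV _ _ Cinf_on_exp] Cinf_on_mult o Cinf_on_const) auto
  then show ?thesis
  proof (rule Cinf_on_cong[OF o, rotated])
    fix x :: real assume "x \<in> {x. x \<noteq> 0}"
    then have "ln (\<bar>x\<bar> * \<bar>x\<bar>) = ln \<bar>x\<bar> + ln \<bar>x\<bar>" by (subst ln_mult) auto
    then have "ln (x * x) = 2 * ln \<bar>x\<bar>" by simp
    then show "exp (s / 2 * ln (x * x)) = \<bar>x\<bar> powr s"
      using \<open>x \<in> _\<close> by (simp add: powr_def)
  qed
qed

text \<open>Leibniz's rule: every directional derivative of the integral is again such an integral, of a
  directional derivative of the integrand, so the induction on the order closes.\<close>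

lemma Ck_on_param_integral:
  fixes G :: "'a::euclidean_space \<times> real \<Rightarrow> real"
  assumes "open A" "open \<Omega>" "A \<times> {0..1} \<subseteq> \<Omega>" "Ck_on r \<Omega> G"
  shows "Ck_on r A (\<lambda>x. integral {0..1} (\<lambda>u. G (x, u)))"
  using assms(4)
proof (induction r arbitrary: G)
  case 0
  then have "continuous_on (A \<times> cbox 0 1) (\<lambda>(x, u). G (x, u))"
    using assms(3) continuous_on_subset by auto
  then show ?case using integral_continuous_on_param by fastforce
next
  case (Suc r)
  let ?D = "\<lambda>x u v. frechet_derivative G (at (x, u)) (v, 0)"
  have dG: "((\<lambda>x. G (x, u)) has_derivative ?D x u) (at x)" if "x \<in> A" "u \<in> {0..1}" for x u
  proof -
    have "(G has_derivative frechet_derivative G (at (x, u))) (at (x, u))"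
      using Ck_on_has_derivative[OF Suc.prems] assms(3) that by blast
    moreover have "((\<lambda>x. (x, u)) has_derivative (\<lambda>v. (v, 0))) (at x)"
      by (auto intro!: derivative_eq_intros)
    ultimately show ?thesis using has_derivative_compose by blast
  qed
  have bl: "bounded_linear (?D x u)" if "x \<in> A" "u \<in> {0..1}" for x u
    using dG[OF that] has_derivative_bounded_linear by blast
  have c: "continuous_on \<Omega> G" using Suc.prems Ck_on_imp_continuous_on by blast
  have cD: "continuous_on \<Omega> (\<lambda>z. frechet_derivative G (at z) v)" for v
    by (rule Ck_on_imp_continuous_on[of r]) (use Suc.prems in \<open>simp only: Ck_on.simps\<close>)
  have "((\<lambda>x. integral {0..1} (\<lambda>u. G (x, u))) has_derivative (\<lambda>v. integral {0..1} (\<lambda>u. ?D x0 u v))) (at x0)"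
    if x0: "x0 \<in> A" for x0
  proof -
    obtain e where e: "0 < e" "ball x0 e \<subseteq> A" using assms(1) x0 openE by blast
    let ?B = "ball x0 e"
    have B: "x \<in> A" if "x \<in> ?B" for x using that e by blast
    have cc: "continuous_on (?B \<times> cbox 0 1) (\<lambda>(x, u). Blinfun (?D x u))"
    proof (rule continuous_on_blinfun_componentwise)
      fix i :: 'a
      have "continuous_on (?B \<times> cbox 0 1) (\<lambda>z. frechet_derivative G (at z) (i, 0))"
        by (rule continuous_on_subset[OF cD]) (use assms(3) e(2) in auto)
      then show "continuous_on (?B \<times> cbox 0 1) (\<lambda>z. blinfun_apply (case z of (x, u) \<Rightarrow> Blinfun (?D x u)) i)"
        by (rule continuous_on_eq) (auto simp: bounded_linear_Blinfun_apply bl B)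
    qed
    have int: "(\<lambda>u. G (x, u)) integrable_on cbox 0 1" if "x \<in> ?B" for x
    proof (rule integrable_continuous)
      show "continuous_on (cbox 0 1) (\<lambda>u. G (x, u))"
        by (rule continuous_on_compose2[OF c]) (use B[OF that] assms(3) in \<open>auto intro!: continuous_intros\<close>)
    qed
    have hd: "((\<lambda>x. integral (cbox 0 1) (\<lambda>u. G (x, u))) has_derivative
        integral (cbox 0 1) (\<lambda>u. Blinfun (?D x0 u))) (at x0 within ?B)"
    proof (rule leibniz_rule[OF _ int cc])
      fix x u assume "x \<in> ?B" "u \<in> cbox (0::real) 1"
      then show "((\<lambda>x. G (x, u)) has_derivative blinfun_apply (Blinfun (?D x u))) (at x within ?B)"
        using dG[of x u] B[of x] bl[of x u]
        by (auto simp: bounded_linear_Blinfun_apply intro: has_derivative_at_withinI)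
    qed (use e in auto)
    have "blinfun_apply (integral (cbox 0 1) (\<lambda>u. Blinfun (?D x0 u))) v = integral {0..1} (\<lambda>u. ?D x0 u v)" for v
    proof -
      have "continuous_on (cbox (0::real) 1) (\<lambda>u. Blinfun (?D x0 u))"
        using continuous_on_compose2[OF cc, of "cbox 0 1" "\<lambda>u. (x0, u)"] e(1)
        by (simp add: continuous_on_Pair image_subset_iff)
      then have "(\<lambda>u. Blinfun (?D x0 u)) integrable_on cbox 0 1" by (rule integrable_continuous)
      then have "blinfun_apply (integral (cbox 0 1) (\<lambda>u. Blinfun (?D x0 u))) v
          = integral (cbox 0 1) (\<lambda>u. blinfun_apply (Blinfun (?D x0 u)) v)"
        by (rule blinfun_apply_integral)
      also have "\<dots> = integral {0..1} (\<lambda>u. ?D x0 u v)"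
        by (auto intro!: integral_cong simp: bounded_linear_Blinfun_apply bl x0)
      finally show ?thesis .
    qed
    then have eq: "blinfun_apply (integral (cbox 0 1) (\<lambda>u. Blinfun (?D x0 u)))
        = (\<lambda>v. integral {0..1} (\<lambda>u. ?D x0 u v))"
      by (rule ext)
    have w: "at x0 within ?B = at x0" by (rule at_within_open) (use e(1) in auto)
    show ?thesis using hd[unfolded eq w] by (simp only: cbox_interval)
  qed
  moreover have "Ck_on r A (\<lambda>x. integral {0..1} (\<lambda>u. ?D x u v))" for v
    by (rule Suc.IH[of "\<lambda>z. frechet_derivative G (at z) (v, 0)"]) (use Suc.prems in \<open>simp only: Ck_on.simps\<close>)
  ultimately show ?case by (rule Ck_on_SucI[OF assms(1)])
qed

lemma Cinf_on_param_integral: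
  fixes G :: "'a::euclidean_space \<times> real \<Rightarrow> real"
  assumes "open A" "open \<Omega>" "A \<times> {0..1} \<subseteq> \<Omega>" "Cinf_on \<Omega> G"
  shows "Cinf_on A (\<lambda>x. integral {0..1} (\<lambda>u. G (x, u)))"
  unfolding Cinf_on_def
  by (intro allI Ck_on_param_integral[OF assms(1-3)]) (use assms(4) in \<open>simp add: Cinf_on_def\<close>)

section \<open>Hadamard's lemma, ordinary differential equations and cut-off functions\<close>

definition pd :: "(real ^ 'n \<Rightarrow> real) \<Rightarrow> 'n \<Rightarrow> real ^ 'n \<Rightarrow> real" where
  "pd g i x = frechet_derivative g (at x) (axis i 1)"

lemma Cinf_on_pd: "Cinf_on S g \<Longrightarrow> Cinf_on S (pd g i)"
  unfolding pd_def by (rule Cinf_on_frechet)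

lemma frechet_derivative_eq_pd:
  fixes g :: "real ^ 'n::finite \<Rightarrow> real"
  assumes "Cinf_on S g" "x \<in> S"
  shows "frechet_derivative g (at x) v = (\<Sum>i\<in>UNIV. v $ i * pd g i x)"
proof -
  have l: "linear (frechet_derivative g (at x))"
    using Cinf_on_has_derivative[OF assms] has_derivative_linear by blast
  have "frechet_derivative g (at x) v = frechet_derivative g (at x) (\<Sum>i\<in>UNIV. v $ i *\<^sub>R axis i 1)"
    using basis_expansion[of v] by (simp add: scalar_mult_eq_scaleR)
  then show ?thesis by (simp add: linear_sum[OF l] linear_cmul[OF l] pd_def)
qed

lemma pd_eqI: "(g has_derivative g') (at x) \<Longrightarrow> pd g i x = g' (axis i 1)"
  unfolding pd_def using frechet_derivative_at by metis

lemma Cinf_on_line_has_derivative: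
  fixes g :: "real ^ 'n::finite \<Rightarrow> real"
  assumes "Cinf_on S g" "x + u *\<^sub>R v \<in> S"
  shows "((\<lambda>u. g (x + u *\<^sub>R v)) has_field_derivative (\<Sum>i\<in>UNIV. v $ i * pd g i (x + u *\<^sub>R v))) (at u)"
proof -
  have "((\<lambda>u. x + u *\<^sub>R v) has_derivative (\<lambda>t. t *\<^sub>R v)) (at u)"
    by (auto intro!: derivative_eq_intros)
  from has_derivative_compose[OF this Cinf_on_has_derivative[OF assms]]
  have "((\<lambda>u. g (x + u *\<^sub>R v)) has_derivative
      (\<lambda>t. frechet_derivative g (at (x + u *\<^sub>R v)) (t *\<^sub>R v))) (at u)" .
  moreover have "(\<lambda>t. frechet_derivative g (at (x + u *\<^sub>R v)) (t *\<^sub>R v)) = 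
      (*) (\<Sum>i\<in>UNIV. v $ i * pd g i (x + u *\<^sub>R v))"
    by (rule ext) (simp add: frechet_derivative_eq_pd[OF assms] sum_distrib_left sum_distrib_right mult_ac)
  ultimately show ?thesis by (simp add: has_field_derivative_def)
qed

lemma Cinf_on_line_integral:
  fixes g :: "real ^ 'n::finite \<Rightarrow> real"
  assumes "open A" "open B" "Cinf_on B g" "Cinf_on A d"
    and "\<And>x u. x \<in> A \<Longrightarrow> u \<in> {0..1} \<Longrightarrow> x + u *\<^sub>R d x \<in> B"
  shows "Cinf_on A (\<lambda>x. integral {0..1} (\<lambda>u. g (x + u *\<^sub>R d x)))"
proof -
  let ?m = "\<lambda>z. fst z + snd z *\<^sub>R d (fst z)"
  define \<Omega> where "\<Omega> = (A \<times> UNIV) \<inter> ?m -` B"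
  have oA: "open (A \<times> (UNIV :: real set))" using assms(1) by (simp add: open_Times)
  have d: "Cinf_on (A \<times> (UNIV :: real set)) (\<lambda>z. d (fst z))"
    by (rule Cinf_on_compose[OF oA assms(1) _ Cinf_on_linear[OF oA bounded_linear_fst] assms(4)]) auto
  have m: "Cinf_on (A \<times> UNIV) ?m"
    by (intro Cinf_on_add Cinf_on_scaleR oA d Cinf_on_linear bounded_linear_fst bounded_linear_snd)
  have o: "open \<Omega>" unfolding \<Omega>_def
    by (rule continuous_open_preimage[OF Cinf_on_imp_continuous_on[OF m] oA assms(2)])
  have "Cinf_on \<Omega> (\<lambda>z. g (?m z))"
    by (rule Cinf_on_compose[OF o assms(2) _ _ assms(3)])
      (auto simp: \<Omega>_def intro: Cinf_on_subset[OF m])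
  moreover have "A \<times> {0..1} \<subseteq> \<Omega>" using assms(5) by (auto simp: \<Omega>_def)
  ultimately show ?thesis using Cinf_on_param_integral[OF assms(1) o] by fastforce
qed

text \<open>Integrating the derivative of \<open>F\<close> along the segments from \<open>x\<close> to \<open>x + d x\<close> writes the
  increment as a combination of the components of \<open>d x\<close> with smooth coefficients.\<close>

lemma hadamard_along:
  fixes F :: "real ^ 'n::finite \<Rightarrow> real"
  assumes "open A" "open B" "Cinf_on B F" "Cinf_on A d"
    and seg: "\<And>x u. x \<in> A \<Longrightarrow> u \<in> {0..1} \<Longrightarrow> x + u *\<^sub>R d x \<in> B"
  obtains h where "\<And>i. Cinf_on A (h i)"
    "\<And>x. x \<in> A \<Longrightarrow> F (x + d x) = F x + (\<Sum>i\<in>UNIV. d x $ i * h i x)"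
    "\<And>i x. x \<in> A \<Longrightarrow> d x = 0 \<Longrightarrow> h i x = pd F i x"
proof
  let ?h = "\<lambda>i x. integral {0..1} (\<lambda>u. pd F i (x + u *\<^sub>R d x))"
  show "Cinf_on A (?h i)" for i
    using assms by (intro Cinf_on_line_integral[of A B]) (auto intro: Cinf_on_pd)
  show "?h i x = pd F i x" if "d x = 0" for i x using that by simp
  fix x assume x: "x \<in> A"
  have c: "continuous_on {0..1} (\<lambda>u. pd F i (x + u *\<^sub>R d x))" for i
    by (rule continuous_on_compose2[OF Cinf_on_imp_continuous_on[OF Cinf_on_pd[OF assms(3)]]])
      (use seg[OF x] in \<open>auto intro!: continuous_intros\<close>)
  have "((\<lambda>u. \<Sum>i\<in>UNIV. d x $ i * pd F i (x + u *\<^sub>R d x)) has_integral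
      F (x + 1 *\<^sub>R d x) - F (x + 0 *\<^sub>R d x)) {0..1}"
  proof (rule fundamental_theorem_of_calculus)
    fix u :: real assume "u \<in> {0..1}"
    then show "((\<lambda>u. F (x + u *\<^sub>R d x)) has_vector_derivative
        (\<Sum>i\<in>UNIV. d x $ i * pd F i (x + u *\<^sub>R d x))) (at u within {0..1})"
      using Cinf_on_line_has_derivative[OF assms(3) seg[OF x]]
      by (simp add: has_real_derivative_iff_has_vector_derivative has_vector_derivative_at_within)
  qed simp
  then have "F (x + d x) - F x = integral {0..1} (\<lambda>u. \<Sum>i\<in>UNIV. d x $ i * pd F i (x + u *\<^sub>R d x))"
    by (simp add: integral_unique)
  also have "\<dots> = (\<Sum>i\<in>UNIV. integral {0..1} (\<lambda>u. d x $ i * pd F i (x + u *\<^sub>R d x)))"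
    by (intro integral_sum integrable_continuous_interval continuous_intros c) auto
  finally show "F (x + d x) = F x + (\<Sum>i\<in>UNIV. d x $ i * ?h i x)" by simp
qed

text \<open>The values of \<open>f\<close> at height \<open>r\<close> are transported back along the \<open>k\<close>-th axis by the
  integrating factor.  Its exponent is an integral of \<open>g\<close> over a segment, and therefore it is smooth on
  both sides of the hyperplane.\<close>

lemma linear_ode_extend:
  fixes f g :: "real ^ 'n::finite \<Rightarrow> real"
  assumes "x0 $ k = 0" "0 < r"
    and f: "Cinf_on (ball x0 (3 * r) \<inter> {x. 0 < x $ k}) f"
    and g: "Cinf_on (ball x0 (3 * r)) g"
    and ode: "\<And>x. x \<in> ball x0 (3 * r) \<Longrightarrow> 0 < x $ k \<Longrightarrow> pd f k x = g x * f x"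
  obtains F where "Cinf_on (ball x0 r) F"
    "\<And>x. x \<in> ball x0 r \<Longrightarrow> 0 < x $ k \<Longrightarrow> F x = f x"
    "(\<And>x. x \<in> ball x0 (3 * r) \<Longrightarrow> 0 < x $ k \<Longrightarrow> f x \<noteq> 0) \<Longrightarrow> (\<And>x. x \<in> ball x0 r \<Longrightarrow> F x \<noteq> 0)"
proof
  let ?A = "ball x0 r" and ?B = "ball x0 (3 * r)"
  define d :: "real ^ 'n \<Rightarrow> real ^ 'n" where "d x = (r - x $ k) *\<^sub>R axis k 1" for x
  define F where "F x = f (x + d x) * exp (- ((r - x $ k) * integral {0..1} (\<lambda>u. g (x + u *\<^sub>R d x))))" for x
  have k: "\<bar>x $ k\<bar> < r" if "x \<in> ?A" for x
  proof -
    have "\<bar>(x - x0) $ k\<bar> \<le> norm (x - x0)" by (rule component_le_norm_cart)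
    then show ?thesis using that assms(1) by (simp add: dist_norm norm_minus_commute)
  qed
  have seg: "x + u *\<^sub>R d x \<in> ?B" if "x \<in> ?A" "u \<in> {0..1}" for x u
  proof -
    have "norm (u *\<^sub>R d x) = \<bar>u\<bar> * \<bar>r - x $ k\<bar>" by (simp add: d_def abs_mult)
    also have "\<dots> \<le> 1 * \<bar>r - x $ k\<bar>" by (rule mult_right_mono) (use that in auto)
    also have "\<dots> < 2 * r" using k[OF that(1)] by (auto simp: abs_less_iff)
    finally have "norm (u *\<^sub>R d x) < 2 * r" .
    moreover have "norm (x - x0) < r" using that by (simp add: dist_norm norm_minus_commute)
    moreover have "norm (x + u *\<^sub>R d x - x0) \<le> norm (x - x0) + norm (u *\<^sub>R d x)"
      by (metis add_diff_eq add.commute norm_triangle_ineq diff_add_eq)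
    ultimately have "norm (x + u *\<^sub>R d x - x0) < 3 * r" by linarith
    then show ?thesis by (simp add: dist_norm norm_minus_commute)
  qed
  have dk: "(x + u *\<^sub>R d x) $ k = x $ k + u * (r - x $ k)" for x u by (simp add: d_def axis_def)
  have oP: "open (?B \<inter> {x. 0 < x $ k})"
    by (intro open_Int open_ball open_Collect_less continuous_intros)
  have cd: "Cinf_on ?A (\<lambda>x. r - x $ k)"
  proof -
    have "Cinf_on ?A (\<lambda>x. r + - (x $ k))"
      by (intro Cinf_on_add Cinf_on_const Cinf_on_linear_compose[where h=uminus and f="\<lambda>x. x $ k"]
          Cinf_on_nth Cinf_on_id bounded_linear_minus bounded_linear_ident open_ball)
    then show ?thesis by simp
  qed
  have d: "Cinf_on ?A d" unfolding d_def by (intro Cinf_on_scaleR open_ball cd Cinf_on_const)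
  have I: "Cinf_on ?A (\<lambda>x. integral {0..1} (\<lambda>u. g (x + u *\<^sub>R d x)))"
    by (rule Cinf_on_line_integral[OF open_ball open_ball g d seg])
  have e: "Cinf_on ?A (\<lambda>x. exp (- ((r - x $ k) * integral {0..1} (\<lambda>u. g (x + u *\<^sub>R d x)))))"
    by (intro Cinf_on_compose[OF open_ball open_UNIV _ _ Cinf_on_exp]
        Cinf_on_linear_compose[where h=uminus] bounded_linear_minus bounded_linear_ident
        Cinf_on_mult cd I open_ball) auto
  have seg1: "x + d x \<in> ?B \<inter> {x. 0 < x $ k}" if "x \<in> ?A" for x
    using seg[OF that, of 1] dk[of x 1] \<open>0 < r\<close> by simp
  have fd: "Cinf_on ?A (\<lambda>x. f (x + d x))"
    by (rule Cinf_on_compose[OF open_ball oP _ _ f])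
      (use seg1 in \<open>auto intro!: Cinf_on_add d Cinf_on_id\<close>)
  show "Cinf_on ?A F" unfolding F_def by (intro Cinf_on_mult open_ball fd e)
  show "F x \<noteq> 0" if "\<And>x. x \<in> ?B \<Longrightarrow> 0 < x $ k \<Longrightarrow> f x \<noteq> 0" "x \<in> ?A" for x
    using seg1[OF that(2)] that(1) by (simp add: F_def)
  show "F x = f x" if x: "x \<in> ?A" "0 < x $ k" for x
  proof -
    let ?\<gamma> = "\<lambda>u. x + u *\<^sub>R d x"
    have pos: "0 < ?\<gamma> u $ k" if "u \<in> {0..1}" for u
      using x k[OF x(1)] that unfolding dk
      by (smt (verit) atLeastAtMost_iff mult_nonneg_nonneg)
    have c: "continuous_on {0..1} (\<lambda>u. g (?\<gamma> u))"
      by (rule continuous_on_compose2[OF Cinf_on_imp_continuous_on[OF g]])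
        (use seg[OF x(1)] in \<open>auto intro!: continuous_intros\<close>)
    \<comment> \<open>\<open>f\<close> times the inverse integrating factor is constant along the segment from \<open>x\<close> to \<open>x + d x\<close>.\<close>
    define \<psi> where "\<psi> u = f (?\<gamma> u) * exp (- ((r - x $ k) * integral {0..u} (\<lambda>u. g (?\<gamma> u))))" for u
    have "(\<psi> has_field_derivative 0) (at u within {0..1})" if u: "u \<in> {0..1}" for u
    proof -
      have "((\<lambda>u. f (?\<gamma> u)) has_field_derivative (\<Sum>i\<in>UNIV. d x $ i * pd f i (?\<gamma> u))) (at u within {0..1})"
        by (rule has_field_derivative_at_within[OF Cinf_on_line_has_derivative[OF f]])
          (use seg[OF x(1) u] pos[OF u] in auto)
      moreover have "(\<Sum>i\<in>UNIV. d x $ i * pd f i (?\<gamma> u)) = (r - x $ k) * pd f k (?\<gamma> u)"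
      proof -
        have "(\<Sum>i\<in>UNIV. d x $ i * pd f i (?\<gamma> u)) = (\<Sum>i\<in>UNIV. if i = k then (r - x $ k) * pd f k (?\<gamma> u) else 0)"
          by (intro sum.cong) (auto simp: d_def axis_def)
        then show ?thesis by simp
      qed
      ultimately have 1: "((\<lambda>u. f (?\<gamma> u)) has_field_derivative (r - x $ k) * (g (?\<gamma> u) * f (?\<gamma> u))) (at u within {0..1})"
        using ode[OF seg[OF x(1) u] pos[OF u]] by simp
      have 2: "((\<lambda>u. integral {0..u} (\<lambda>u. g (?\<gamma> u))) has_field_derivative g (?\<gamma> u)) (at u within {0..1})"
        by (rule integral_has_real_derivative[OF c u])
      have 3: "((\<lambda>u. exp (- ((r - x $ k) * integral {0..u} (\<lambda>u. g (?\<gamma> u))))) has_field_derivative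
        exp (- ((r - x $ k) * integral {0..u} (\<lambda>u. g (?\<gamma> u)))) * (- ((r - x $ k) * g (?\<gamma> u)))) (at u within {0..1})"
        by (rule DERIV_chain2[OF DERIV_exp DERIV_minus[OF DERIV_cmult[OF 2]]])
      show ?thesis using DERIV_mult[OF 1 3] unfolding \<psi>_def by (simp add: algebra_simps)
    qed
    then obtain c where "\<forall>u\<in>{0..1}. \<psi> u = c"
      using has_field_derivative_zero_constant[of "{0..1::real}" \<psi>] by auto
    then have "\<psi> 1 = \<psi> 0" by simp
    then show ?thesis by (simp add: \<psi>_def F_def)
  qed
qed

text \<open>The difference quotients of \<open>g1 - g2\<close> along the line vanish at points tending to \<open>x\<close>.
  Local representatives of a function on a half-space agree only on the half-space; this is what
  makes their derivatives at boundary points agree.\<close>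

lemma derivative_agree_along:
  fixes g1 g2 :: "'a::real_normed_vector \<Rightarrow> real"
  assumes "(g1 has_derivative D1) (at x)" "(g2 has_derivative D2) (at x)" "g1 x = g2 x"
    and ex: "\<And>e. 0 < e \<Longrightarrow> \<exists>t. 0 < \<bar>t\<bar> \<and> \<bar>t\<bar> < e \<and> g1 (x + t *\<^sub>R v) = g2 (x + t *\<^sub>R v)"
  shows "D1 v = D2 v"
proof (rule ccontr)
  assume ne: "D1 v \<noteq> D2 v"
  define h where "h t = g1 (x + t *\<^sub>R v) - g2 (x + t *\<^sub>R v)" for t
  have l: "((\<lambda>t. x + t *\<^sub>R v) has_derivative (\<lambda>t. t *\<^sub>R v)) (at 0)" by (auto intro!: derivative_eq_intros)
  have "(h has_derivative (\<lambda>t. D1 (t *\<^sub>R v) - D2 (t *\<^sub>R v))) (at 0)" unfolding h_def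
    by (intro has_derivative_diff has_derivative_compose[OF l]) (use assms in auto)
  moreover have "(\<lambda>t. D1 (t *\<^sub>R v) - D2 (t *\<^sub>R v)) = (*) (D1 v - D2 v)"
    using has_derivative_linear[OF assms(1)] has_derivative_linear[OF assms(2)]
    by (simp add: fun_eq_iff linear_cmul algebra_simps)
  ultimately have "(h has_field_derivative (D1 v - D2 v)) (at 0)" by (simp add: has_field_derivative_def)
  then have "((\<lambda>t. (h t - h 0) / t) \<longlongrightarrow> D1 v - D2 v) (at 0)" by (simp add: has_field_derivative_iff)
  then have "\<forall>\<^sub>F t in at 0. (h t - h 0) / t \<noteq> 0"
    by (rule tendsto_imp_eventually_ne) (use ne in simp)
  then obtain e where "e > 0" "\<And>t. t \<noteq> 0 \<Longrightarrow> \<bar>t\<bar> < e \<Longrightarrow> (h t - h 0) / t \<noteq> 0"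
    unfolding eventually_at by (auto simp: dist_real_def)
  moreover have "h 0 = 0" using assms(3) by (simp add: h_def)
  ultimately show False using ex[of e] by (auto simp: h_def)
qed

lemma derivative_nonneg_along:
  fixes g :: "'a::real_normed_vector \<Rightarrow> real"
  assumes "(g has_derivative D) (at x)" "g x = 0" "0 < e"
    and nn: "\<And>t. 0 < t \<Longrightarrow> t < e \<Longrightarrow> 0 \<le> g (x + t *\<^sub>R v)"
  shows "0 \<le> D v"
proof (rule ccontr)
  assume ne: "\<not> 0 \<le> D v"
  define h where "h t = g (x + t *\<^sub>R v)" for t
  have l: "((\<lambda>t. x + t *\<^sub>R v) has_derivative (\<lambda>t. t *\<^sub>R v)) (at 0)" by (auto intro!: derivative_eq_intros)
  have "(h has_derivative (\<lambda>t. D (t *\<^sub>R v))) (at 0)" unfolding h_def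
    by (intro has_derivative_compose[OF l]) (use assms in auto)
  moreover have "(\<lambda>t. D (t *\<^sub>R v)) = (*) (D v)"
    using has_derivative_linear[OF assms(1)] by (simp add: fun_eq_iff linear_cmul)
  ultimately have "(h has_field_derivative D v) (at 0)" by (simp add: has_field_derivative_def)
  then have "((\<lambda>t. (h t - h 0) / t) \<longlongrightarrow> D v) (at 0)" by (simp add: has_field_derivative_iff)
  then have "\<forall>\<^sub>F t in at 0. (h t - h 0) / t < 0"
    using ne order_tendstoD(2) by (metis not_le)
  then obtain a where a: "a > 0" "\<And>t. t \<noteq> 0 \<Longrightarrow> \<bar>t\<bar> < a \<Longrightarrow> (h t - h 0) / t < 0"
    unfolding eventually_at by (auto simp: dist_real_def)
  define t where "t = min a e / 2"
  have t: "0 < t" "t < a" "t < e" using a(1) assms(3) by (auto simp: t_def)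
  have "h 0 = 0" using assms(2) by (simp add: h_def)
  then have "h t < 0" using a(2)[of t] t by (simp add: divide_less_0_iff)
  then show False using nn[OF t(1,3)] by (simp add: h_def)
qed

text \<open>The derivatives of \<open>exp (- 1 / x)\<close>, extended by 0 to the left, are linear combinations of
  these functions, and so are the derivatives of these functions themselves.\<close>

definition flat_exp :: "nat \<Rightarrow> real \<Rightarrow> real" where
  "flat_exp n x = (if 0 < x then inverse x ^ n * exp (- inverse x) else 0)"

lemma flat_exp_tendsto: "(flat_exp n \<longlongrightarrow> 0) (at 0)"
proof -
  have "((\<lambda>x::real. inverse x ^ n / exp (inverse x)) \<longlongrightarrow> 0) (at_right 0)"
    using filterlim_compose[OF tendsto_power_div_exp_0 filterlim_inverse_at_top_right] by simp
  then have r: "(flat_exp n \<longlongrightarrow> 0) (at_right 0)"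
    by (rule Lim_transform_eventually)
      (auto simp: eventually_at_filter flat_exp_def exp_minus field_simps)
  have "((\<lambda>x::real. 0::real) \<longlongrightarrow> 0) (at_left 0)" by simp
  then have "(flat_exp n \<longlongrightarrow> 0) (at_left 0)"
    by (rule Lim_transform_eventually) (auto simp: eventually_at_filter flat_exp_def)
  then show ?thesis using r by (simp add: filterlim_at_split)
qed

lemma flat_exp_deriv:
  "(flat_exp n has_field_derivative (flat_exp (n + 2) x - real n * flat_exp (n + 1) x)) (at x)"
proof -
  consider "x < 0" | "x = 0" | "0 < x" by linarith
  then show ?thesis
  proof cases
    case 1
    have "((\<lambda>x::real. 0::real) has_field_derivative 0) (at x)" by simp
    then have "(flat_exp n has_field_derivative 0) (at x)"
      by (rule has_field_derivative_transform_within_open[where S="{..<0}"]) (use 1 in \<open>auto simp: flat_exp_def\<close>)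
    then show ?thesis using 1 by (simp add: flat_exp_def)
  next
    case 2
    have "(flat_exp n y - flat_exp n 0) / (y - 0) = flat_exp (Suc n) y" for y
      by (simp add: flat_exp_def field_simps)
    then have "((\<lambda>y. (flat_exp n y - flat_exp n 0) / (y - 0)) \<longlongrightarrow> 0) (at 0)"
      using flat_exp_tendsto[of "Suc n"] by presburger
    then have "(flat_exp n has_field_derivative 0) (at 0)"
      by (simp add: has_field_derivative_iff)
    then show ?thesis using 2 by (simp add: flat_exp_def)
  next
    case 3
    have "((\<lambda>x. inverse x ^ n * exp (- inverse x)) has_field_derivative
        (flat_exp (n + 2) x - real n * flat_exp (n + 1) x)) (at x)"
    proof (cases n)
      case (Suc m)
      then show ?thesis using 3
        by (auto intro!: derivative_eq_intros simp: flat_exp_def algebra_simps power2_eq_square)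
          (metis One_nat_def power_eq_if)
    qed (use 3 in \<open>auto intro!: derivative_eq_intros simp: flat_exp_def algebra_simps power2_eq_square\<close>)
    then show ?thesis
      by (rule has_field_derivative_transform_within_open[where S="{0<..}"]) (use 3 in \<open>auto simp: flat_exp_def\<close>)
  qed
qed

lemma Cinf_on_flat_exp: "Cinf_on UNIV (flat_exp n)"
proof -
  have "Ck_on r UNIV (flat_exp n)" for r
  proof (induction r arbitrary: n)
    case 0
    show ?case using DERIV_isCont[OF flat_exp_deriv[of n]] by (simp add: continuous_at_imp_continuous_on)
  next
    case (Suc r)
    have "Ck_on r UNIV (\<lambda>x. v * (flat_exp (n + 2) x + (- real n) * flat_exp (n + 1) x))" for v
      by (intro Ck_on_mult Ck_on_add Ck_on_const open_UNIV Suc)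
    then show ?case
      using flat_exp_deriv[of n]
      by (intro Ck_on_SucI[OF open_UNIV, where f'="\<lambda>x v. v * (flat_exp (n + 2) x + (- real n) * flat_exp (n + 1) x)"])
       (auto simp: has_field_derivative_def mult.commute[of _ "_ - _"])
  qed
  then show ?thesis by (simp add: Cinf_on_def)
qed

lemma smooth_bump_exists:
  fixes x0 :: "real ^ 'n::finite"
  assumes "0 < r"
  obtains b where "Cinf_on UNIV b" "\<And>x. 0 \<le> b x \<and> b x \<le> (1::real)"
    "\<And>x. x \<in> ball x0 r \<Longrightarrow> b x = 1" "\<And>x. x \<notin> ball x0 (2 * r) \<Longrightarrow> b x = 0"
proof
  define N where "N x = (\<Sum>i\<in>UNIV. (x $ i + - x0 $ i) * (x $ i + - x0 $ i))" for x
  have N: "N x = (dist x0 x)\<^sup>2" for x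
    by (simp add: N_def dist_norm power2_norm_eq_inner inner_vec_def algebra_simps)
  \<comment> \<open>\<open>N\<close> is the squared distance to \<open>x0\<close>, written as a sum so that its smoothness is evident.\<close>
  define b where "b x = flat_exp 0 (4 * r\<^sup>2 + - N x) *
     inverse (flat_exp 0 (4 * r\<^sup>2 + - N x) + flat_exp 0 (N x + - r\<^sup>2))" for x
  have cN: "Cinf_on UNIV N" unfolding N_def
    by (intro Cinf_on_sum Cinf_on_mult Cinf_on_add Cinf_on_nth Cinf_on_id Cinf_on_const open_UNIV)
  have c1: "Cinf_on UNIV (\<lambda>x. flat_exp 0 (4 * r\<^sup>2 + - N x))"
    by (intro Cinf_on_compose[OF open_UNIV open_UNIV _ _ Cinf_on_flat_exp]
        Cinf_on_linear_compose[where h=uminus] bounded_linear_minus bounded_linear_ident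
        Cinf_on_add cN Cinf_on_const open_UNIV) auto
  have c2: "Cinf_on UNIV (\<lambda>x. flat_exp 0 (N x + - r\<^sup>2))"
    by (intro Cinf_on_compose[OF open_UNIV open_UNIV _ _ Cinf_on_flat_exp]
        Cinf_on_add cN Cinf_on_const open_UNIV) auto
  have nn: "0 \<le> flat_exp 0 y" "0 < flat_exp 0 y \<longleftrightarrow> 0 < y" for y by (auto simp: flat_exp_def)
  have r2: "0 < r\<^sup>2" using assms by simp
  have pos: "0 < flat_exp 0 (4 * r\<^sup>2 + - N x) + flat_exp 0 (N x + - r\<^sup>2)" for x
  proof (cases "N x < 4 * r\<^sup>2")
    case True
    then show ?thesis using nn by (simp add: add_pos_nonneg)
  next
    case False
    then have "0 < N x + - r\<^sup>2" using r2 by linarith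
    then show ?thesis using nn by (simp add: add_nonneg_pos)
  qed
  have o: "open {x::real. x \<noteq> 0}" by (simp add: open_Collect_neq)
  have "Cinf_on UNIV (\<lambda>x. inverse (flat_exp 0 (4 * r\<^sup>2 + - N x) + flat_exp 0 (N x + - r\<^sup>2)))"
    using pos by (intro Cinf_on_compose[OF open_UNIV o _ _ Cinf_on_inverse] Cinf_on_add c1 c2 open_UNIV)
      (auto simp: less_imp_neq[symmetric] less_imp_neq)
  then show "Cinf_on UNIV b" unfolding b_def by (intro Cinf_on_mult c1 open_UNIV)
  show "0 \<le> b x \<and> b x \<le> 1" for x
    using pos[of x] nn(1)[of "4 * r\<^sup>2 + - N x"] nn(1)[of "N x + - r\<^sup>2"] by (simp add: b_def field_simps)
  show "b x = 1" if "x \<in> ball x0 r" for x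
  proof -
    have "N x < r\<^sup>2" unfolding N using that assms by (simp add: power_strict_mono)
    then have "flat_exp 0 (N x + - r\<^sup>2) = 0" by (simp add: flat_exp_def)
    then show ?thesis using pos[of x] by (simp add: b_def)
  qed
  show "b x = 0" if "x \<notin> ball x0 (2 * r)" for x
  proof -
    have "(2 * r)\<^sup>2 \<le> N x" unfolding N using that assms by (intro power_mono) auto
    then have "flat_exp 0 (4 * r\<^sup>2 + - N x) = 0" by (simp add: flat_exp_def power_mult_distrib)
    then show ?thesis by (simp add: b_def)
  qed
qed

lemma smooth_on_set_iff:
  "smooth_on_set S f \<longleftrightarrow>
    (\<forall>x\<in>S. \<exists>G g. open G \<and> x \<in> G \<and> Cinf_on G g \<and> (\<forall>y\<in>S \<inter> G. g y = f y))"
  unfolding smooth_on_set_def Cinf_on_def ..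

lemma smooth_on_setE:
  assumes "smooth_on_set S f" "x \<in> S"
  obtains G g where "open G" "x \<in> G" "Cinf_on G g" "\<And>y. y \<in> S \<Longrightarrow> y \<in> G \<Longrightarrow> g y = f y"
  using assms unfolding smooth_on_set_iff by (meson IntI)

lemma smooth_on_set_imp_Cinf_on:
  assumes "open S" "smooth_on_set S f"
  shows "Cinf_on S f"
proof (rule Cinf_on_local)
  fix x assume "x \<in> S"
  then obtain G g where G: "open G" "x \<in> G" "Cinf_on G g" "\<And>y. y \<in> S \<Longrightarrow> y \<in> G \<Longrightarrow> g y = f y"
    using smooth_on_setE[OF assms(2)] by blast
  have "Cinf_on (S \<inter> G) f"
    by (rule Cinf_on_cong[OF _ _ Cinf_on_subset[OF G(3)]]) (use G assms in auto)
  then show "\<exists>T. open T \<and> x \<in> T \<and> Cinf_on T f" using G assms \<open>x \<in> S\<close> by (intro exI[of _ "S \<inter> G"]) auto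
qed

section \<open>Functions, derivations and vector fields on smooth manifolds\<close>

lemma smooth_on_set_cong:
  assumes "smooth_on_set S f" "T \<subseteq> S" "\<And>x. x \<in> T \<Longrightarrow> f x = g x"
  shows "smooth_on_set T g"
  unfolding smooth_on_set_iff
proof
  fix x assume "x \<in> T"
  then obtain G h where "open G" "x \<in> G" "Cinf_on G h" "\<And>y. y \<in> S \<Longrightarrow> y \<in> G \<Longrightarrow> h y = f y"
    using smooth_on_setE[OF assms(1), of x] assms(2) by blast
  then show "\<exists>G h. open G \<and> x \<in> G \<and> Cinf_on G h \<and> (\<forall>y\<in>T \<inter> G. h y = g y)"
    using assms(2,3) by (intro exI[of _ G] exI[of _ h]) auto
qed

locale smooth_mfd =
  fixes M :: "('m, 'n::finite) mfd"
  assumes M: "smooth_manifold M"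
begin

lemma chart_open: "(U, \<phi>) \<in> charts M \<Longrightarrow> openin (mtop M) U"
  using M unfolding smooth_manifold_def by blast

lemma chart_homeo:
  "(U, \<phi>) \<in> charts M \<Longrightarrow> homeomorphic_map (subtopology (mtop M) U) (top_of_set (\<phi> ` U)) \<phi>"
  using M unfolding smooth_manifold_def by blast

lemma chart_topspace: "(U, \<phi>) \<in> charts M \<Longrightarrow> topspace (subtopology (mtop M) U) = U"
  using openin_subset[OF chart_open] by (simp add: inf.absorb2)

lemma chart_inj: "(U, \<phi>) \<in> charts M \<Longrightarrow> inj_on \<phi> U"
  using homeomorphic_imp_injective_map[OF chart_homeo] chart_topspace by metis

lemma chart_inv: "(U, \<phi>) \<in> charts M \<Longrightarrow> q \<in> U \<Longrightarrow> inv_into U \<phi> (\<phi> q) = q"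
  using chart_inj by simp

lemma chart_preimage_open:
  assumes "(U, \<phi>) \<in> charts M" "open G"
  shows "openin (mtop M) {q \<in> U. \<phi> q \<in> G}"
proof -
  have "continuous_map (subtopology (mtop M) U) (top_of_set (\<phi> ` U)) \<phi>"
    using chart_homeo[OF assms(1)] homeomorphic_imp_continuous_map by blast
  then have "openin (subtopology (mtop M) U) {q \<in> topspace (subtopology (mtop M) U). \<phi> q \<in> \<phi> ` U \<inter> G}"
    by (rule openin_continuous_map_preimage) (use assms(2) in \<open>simp add: openin_open_Int\<close>)
  also have "{q \<in> topspace (subtopology (mtop M) U). \<phi> q \<in> \<phi> ` U \<inter> G} = {q \<in> U. \<phi> q \<in> G}"
    using chart_topspace[OF assms(1)] by auto
  finally show ?thesis using chart_open[OF assms(1)] openin_trans_full by blast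
qed

text \<open>This is used in the form: a point of the model that is close to \<open>\<phi> p\<close> is the image of a point of
  any prescribed neighbourhood of \<open>p\<close>.\<close>

lemma chart_image_open:
  assumes "(U, \<phi>) \<in> charts M" "openin (mtop M) W"
  obtains Q where "open Q" "\<phi> ` (U \<inter> W) = model M \<inter> Q"
proof -
  have "openin (subtopology (mtop M) U) (U \<inter> W)"
    using assms(2) by (simp add: openin_subtopology_Int2)
  then have "openin (top_of_set (\<phi> ` U)) (\<phi> ` (U \<inter> W))"
    using homeomorphic_imp_open_map[OF chart_homeo[OF assms(1)]] unfolding open_map_def by blast
  moreover have "openin (top_of_set (model M)) (\<phi> ` U)"
    using M assms(1) unfolding smooth_manifold_def by blast
  ultimately have "openin (top_of_set (model M)) (\<phi> ` (U \<inter> W))" using openin_trans by blast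
  then show ?thesis using that by (auto simp: openin_open)
qed

lemma chart_model: "(U, \<phi>) \<in> charts M \<Longrightarrow> q \<in> U \<Longrightarrow> \<phi> q \<in> model M"
  using chart_image_open[of U \<phi> U] chart_open by (metis Int_absorb Int_iff imageI)

lemma chart_cover:
  assumes "p \<in> topspace (mtop M)"
  obtains U \<phi> where "(U, \<phi>) \<in> charts M" "p \<in> U"
proof -
  have "p \<in> \<Union>(fst ` charts M)" using assms M unfolding smooth_manifold_def by simp
  then show ?thesis using that by force
qed

text \<open>The definition asks for a smooth extension in every chart; compatibility of the atlas reduces this
  to one chart around each point.\<close>

lemma smooth_funsI:
  assumes "openin (mtop M) W"
    and loc: "\<And>p. p \<in> W \<Longrightarrow> \<exists>U \<phi> G g. (U, \<phi>) \<in> charts M \<and> p \<in> U \<and> open G \<and> \<phi> p \<in> G \<and> Cinf_on G g \<and>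
      (\<forall>q\<in>U \<inter> W. \<phi> q \<in> G \<longrightarrow> f q = g (\<phi> q))"
  shows "f \<in> smooth_funs M W"
proof -
  have "smooth_on_set (\<psi> ` (V \<inter> W)) (f \<circ> inv_into V \<psi>)" if V: "(V, \<psi>) \<in> charts M" for V \<psi>
    unfolding smooth_on_set_iff
  proof
    fix y assume "y \<in> \<psi> ` (V \<inter> W)"
    then obtain p where p: "p \<in> V" "p \<in> W" "y = \<psi> p" by auto
    obtain U \<phi> G g where U: "(U, \<phi>) \<in> charts M" "p \<in> U" and G: "open G" "\<phi> p \<in> G" "Cinf_on G g"
      and fg: "\<And>q. q \<in> U \<inter> W \<Longrightarrow> \<phi> q \<in> G \<Longrightarrow> f q = g (\<phi> q)"
      using loc[OF p(2)] by blast
    have "smooth_on_set (\<psi> ` (V \<inter> U)) (\<phi> \<circ> inv_into V \<psi>)"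
      using M V U(1) unfolding smooth_manifold_def by blast
    then obtain H t where H: "open H" "y \<in> H" "Cinf_on H t"
      and t: "\<And>z. z \<in> \<psi> ` (V \<inter> U) \<Longrightarrow> z \<in> H \<Longrightarrow> t z = (\<phi> \<circ> inv_into V \<psi>) z"
      using smooth_on_setE[of _ _ y] p U(2) by blast
    have t: "t (\<psi> q) = \<phi> q" if "q \<in> V" "q \<in> U" "\<psi> q \<in> H" for q
      using t[of "\<psi> q"] that chart_inv[OF V] by auto
    obtain Q where Q: "open Q" "\<psi> ` (V \<inter> U) = model M \<inter> Q"
      using chart_image_open[OF V chart_open[OF U(1)]] .
    define G' where "G' = (H \<inter> t -` G) \<inter> Q"
    have oG: "open G'" unfolding G'_def
      by (intro open_Int Q continuous_open_preimage[OF Cinf_on_imp_continuous_on[OF H(3)]] H(1) G(1))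
    have y: "y \<in> G'" using H(2) t[OF p(1) U(2)] p G(2) Q U(2) by (auto simp: G'_def)
    have c: "Cinf_on G' (\<lambda>x. g (t x))"
      by (rule Cinf_on_compose[OF oG G(1) _ _ G(3)]) (auto simp: G'_def intro: Cinf_on_subset[OF H(3)])
    have "g (t z) = (f \<circ> inv_into V \<psi>) z" if z: "z \<in> \<psi> ` (V \<inter> W)" "z \<in> G'" for z
    proof -
      obtain q where q: "q \<in> V" "q \<in> W" "z = \<psi> q" using z(1) by auto
      have "z \<in> \<psi> ` (V \<inter> U)" using Q(2) z(2) chart_model[OF V q(1)] q(3) by (auto simp: G'_def)
      then obtain q' where "q' \<in> V" "q' \<in> U" "\<psi> q' = \<psi> q" using q(3) by auto
      then have qU: "q \<in> U" using inj_onD[OF chart_inj[OF V]] q(1) by metis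
      have "t z = \<phi> q" using t[OF q(1) qU] z(2) q(3) by (auto simp: G'_def)
      then show ?thesis using fg[of q] q qU z(2) chart_inv[OF V q(1)] by (auto simp: G'_def)
    qed
    then show "\<exists>G g. open G \<and> y \<in> G \<and> Cinf_on G g \<and> (\<forall>z\<in>\<psi> ` (V \<inter> W) \<inter> G. g z = (f \<circ> inv_into V \<psi>) z)"
      using oG y c by (intro exI[of _ G'] exI[of _ "\<lambda>x. g (t x)"]) auto
  qed
  then show ?thesis using assms(1) unfolding smooth_funs_def by auto
qed

lemma smooth_funsE:
  assumes "f \<in> smooth_funs M W" "(U, \<phi>) \<in> charts M" "p \<in> U" "p \<in> W"
  obtains G g where "open G" "\<phi> p \<in> G" "Cinf_on G g"
    "\<And>q. q \<in> U \<Longrightarrow> q \<in> W \<Longrightarrow> \<phi> q \<in> G \<Longrightarrow> f q = g (\<phi> q)"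
proof -
  have "smooth_on_set (\<phi> ` (U \<inter> W)) (f \<circ> inv_into U \<phi>)"
    using assms(1,2) unfolding smooth_funs_def by blast
  then obtain G g where G: "open G" "\<phi> p \<in> G" "Cinf_on G g"
    and g: "\<And>y. y \<in> \<phi> ` (U \<inter> W) \<Longrightarrow> y \<in> G \<Longrightarrow> g y = (f \<circ> inv_into U \<phi>) y"
    using smooth_on_setE[of _ _ "\<phi> p"] assms by blast
  have "f q = g (\<phi> q)" if "q \<in> U" "q \<in> W" "\<phi> q \<in> G" for q
    using g[of "\<phi> q"] that chart_inv[OF assms(2)] by auto
  then show ?thesis using that G by blast
qed

lemma smooth_funs_openin: "f \<in> smooth_funs M W \<Longrightarrow> openin (mtop M) W"
  unfolding smooth_funs_def by blast

lemma smooth_funs_topspace: "f \<in> smooth_funs M W \<Longrightarrow> p \<in> W \<Longrightarrow> p \<in> topspace (mtop M)"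
  using smooth_funs_openin openin_subset by blast

lemma smooth_funs_local:
  assumes "\<And>p. p \<in> W \<Longrightarrow> \<exists>V. p \<in> V \<and> V \<subseteq> W \<and> f \<in> smooth_funs M V"
  shows "f \<in> smooth_funs M W"
proof (rule smooth_funsI)
  show "openin (mtop M) W"
    by (subst openin_subopen) (meson assms smooth_funs_openin)
  fix p assume "p \<in> W"
  then obtain V where V: "p \<in> V" "V \<subseteq> W" "f \<in> smooth_funs M V" using assms by blast
  obtain U \<phi> where U: "(U, \<phi>) \<in> charts M" "p \<in> U" using chart_cover smooth_funs_topspace[OF V(3,1)] by blast
  obtain G g where G: "open G" "\<phi> p \<in> G" "Cinf_on G g"
    "\<And>q. q \<in> U \<Longrightarrow> q \<in> V \<Longrightarrow> \<phi> q \<in> G \<Longrightarrow> f q = g (\<phi> q)"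
    using smooth_funsE[OF V(3) U V(1)] by blast
  obtain Q where Q: "open Q" "\<phi> ` (U \<inter> V) = model M \<inter> Q"
    using chart_image_open[OF U(1) smooth_funs_openin[OF V(3)]] .
  have inV: "q \<in> V" if "q \<in> U" "\<phi> q \<in> Q" for q
  proof -
    have "\<phi> q \<in> \<phi> ` (U \<inter> V)" using that Q(2) chart_model[OF U(1)] by simp
    then show ?thesis using inj_onD[OF chart_inj[OF U(1)]] that(1) by (metis Int_iff imageE)
  qed
  have "\<phi> p \<in> Q" using Q(2) U(2) V(1) by blast
  then show "\<exists>U \<phi> G g. (U, \<phi>) \<in> charts M \<and> p \<in> U \<and> open G \<and> \<phi> p \<in> G \<and> Cinf_on G g \<and>
      (\<forall>q\<in>U \<inter> W. \<phi> q \<in> G \<longrightarrow> f q = g (\<phi> q))"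
    using U G(1,2,4) inV Q(1) Cinf_on_subset[OF G(3)]
    by (intro exI[of _ U] exI[of _ \<phi>] exI[of _ "G \<inter> Q"] exI[of _ g]) auto
qed

lemma smooth_funs_subset:
  assumes "f \<in> smooth_funs M W" "openin (mtop M) V" "V \<subseteq> W"
  shows "f \<in> smooth_funs M V"
proof -
  have "smooth_on_set (\<phi> ` (U \<inter> V)) (f \<circ> inv_into U \<phi>)" if "(U, \<phi>) \<in> charts M" for U \<phi>
    by (rule smooth_on_set_cong[where S="\<phi> ` (U \<inter> W)" and f="f \<circ> inv_into U \<phi>"])
      (use assms that in \<open>auto simp: smooth_funs_def\<close>)
  then show ?thesis using assms(2) by (auto simp: smooth_funs_def)
qed

lemma smooth_funs_Int:
  "f \<in> smooth_funs M W \<Longrightarrow> openin (mtop M) V \<Longrightarrow> f \<in> smooth_funs M (V \<inter> W)"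
  by (rule smooth_funs_subset) (auto intro: smooth_funs_openin)

lemma smooth_funs_cong:
  assumes "f \<in> smooth_funs M W" "\<And>p. p \<in> W \<Longrightarrow> f p = g p"
  shows "g \<in> smooth_funs M W"
proof (rule smooth_funsI[OF smooth_funs_openin[OF assms(1)]])
  fix p assume p: "p \<in> W"
  obtain U \<phi> where U: "(U, \<phi>) \<in> charts M" "p \<in> U" using chart_cover smooth_funs_topspace[OF assms(1) p] by blast
  obtain G h where "open G" "\<phi> p \<in> G" "Cinf_on G h"
    "\<And>q. q \<in> U \<Longrightarrow> q \<in> W \<Longrightarrow> \<phi> q \<in> G \<Longrightarrow> f q = h (\<phi> q)"
    using smooth_funsE[OF assms(1) U p] by blast
  then show "\<exists>U \<phi> G h. (U, \<phi>) \<in> charts M \<and> p \<in> U \<and> open G \<and> \<phi> p \<in> G \<and> Cinf_on G h \<and>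
      (\<forall>q\<in>U \<inter> W. \<phi> q \<in> G \<longrightarrow> g q = h (\<phi> q))"
    using U assms(2) by (intro exI[of _ U] exI[of _ \<phi>] exI[of _ G] exI[of _ h]) auto
qed

lemma smooth_funs_chart_compose:
  assumes "(U, \<phi>) \<in> charts M" "open G" "Cinf_on G g"
  shows "(\<lambda>q. g (\<phi> q)) \<in> smooth_funs M {q \<in> U. \<phi> q \<in> G}"
  by (rule smooth_funsI[OF chart_preimage_open[OF assms(1,2)]]) (use assms in blast)

lemma smooth_funs_coord:
  assumes "(U, \<phi>) \<in> charts M"
  shows "(\<lambda>q. \<phi> q $ i) \<in> smooth_funs M U"
  using smooth_funs_chart_compose[OF assms open_UNIV Cinf_on_nth[OF open_UNIV Cinf_on_id[OF open_UNIV]]]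
  by simp

lemma smooth_funs_const: "openin (mtop M) W \<Longrightarrow> (\<lambda>_. c) \<in> smooth_funs M W"
proof (rule smooth_funsI)
  fix p assume "openin (mtop M) W" "p \<in> W"
  then have "p \<in> topspace (mtop M)" using openin_subset by blast
  then obtain U \<phi> where "(U, \<phi>) \<in> charts M" "p \<in> U" using chart_cover by blast
  then show "\<exists>U \<phi> G g. (U, \<phi>) \<in> charts M \<and> p \<in> U \<and> open G \<and> \<phi> p \<in> G \<and> Cinf_on G g \<and>
      (\<forall>q\<in>U \<inter> W. \<phi> q \<in> G \<longrightarrow> c = g (\<phi> q))"
    by (intro exI[of _ U] exI[of _ \<phi>] exI[of _ UNIV] exI[of _ "\<lambda>_. c"]) (auto intro: Cinf_on_const)
qed

lemma smooth_funs_lift2: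
  assumes f: "f1 \<in> smooth_funs M W" "f2 \<in> smooth_funs M W"
    and F: "\<And>G (g1 :: real ^ 'n \<Rightarrow> real) g2. open G \<Longrightarrow> Cinf_on G g1 \<Longrightarrow> Cinf_on G g2 \<Longrightarrow> Cinf_on G (\<lambda>x. F (g1 x) (g2 x))"
  shows "(\<lambda>p. F (f1 p) (f2 p)) \<in> smooth_funs M W"
proof (rule smooth_funsI[OF smooth_funs_openin[OF f(1)]])
  fix p assume p: "p \<in> W"
  obtain U \<phi> where U: "(U, \<phi>) \<in> charts M" "p \<in> U" using chart_cover smooth_funs_topspace[OF f(1) p] by blast
  obtain G1 g1 where 1: "open G1" "\<phi> p \<in> G1" "Cinf_on G1 g1"
    "\<And>q. q \<in> U \<Longrightarrow> q \<in> W \<Longrightarrow> \<phi> q \<in> G1 \<Longrightarrow> f1 q = g1 (\<phi> q)"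
    using smooth_funsE[OF f(1) U p] by blast
  obtain G2 g2 where 2: "open G2" "\<phi> p \<in> G2" "Cinf_on G2 g2"
    "\<And>q. q \<in> U \<Longrightarrow> q \<in> W \<Longrightarrow> \<phi> q \<in> G2 \<Longrightarrow> f2 q = g2 (\<phi> q)"
    using smooth_funsE[OF f(2) U p] by blast
  have "Cinf_on (G1 \<inter> G2) (\<lambda>x. F (g1 x) (g2 x))"
    by (rule F) (use 1(1) 2(1) in \<open>auto intro: Cinf_on_subset[OF 1(3)] Cinf_on_subset[OF 2(3)]\<close>)
  then show "\<exists>U \<phi> G g. (U, \<phi>) \<in> charts M \<and> p \<in> U \<and> open G \<and> \<phi> p \<in> G \<and> Cinf_on G g \<and>
      (\<forall>q\<in>U \<inter> W. \<phi> q \<in> G \<longrightarrow> F (f1 q) (f2 q) = g (\<phi> q))"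
    using U 1(1,2,4) 2(1,2,4)
    by (intro exI[of _ U] exI[of _ \<phi>] exI[of _ "G1 \<inter> G2"] exI[of _ "\<lambda>x. F (g1 x) (g2 x)"]) auto
qed

lemma smooth_funs_add:
  "f \<in> smooth_funs M W \<Longrightarrow> g \<in> smooth_funs M W \<Longrightarrow> (\<lambda>p. f p + g p) \<in> smooth_funs M W"
  by (rule smooth_funs_lift2) (auto intro: Cinf_on_add)

lemma smooth_funs_mult:
  "f \<in> smooth_funs M W \<Longrightarrow> g \<in> smooth_funs M W \<Longrightarrow> (\<lambda>p. f p * g p) \<in> smooth_funs M W"
  by (rule smooth_funs_lift2) (auto intro: Cinf_on_mult)

lemma smooth_funs_cmult: "f \<in> smooth_funs M W \<Longrightarrow> (\<lambda>p. c * f p) \<in> smooth_funs M W"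
  by (intro smooth_funs_mult smooth_funs_const smooth_funs_openin[of f])

lemma smooth_funs_uminus: "f \<in> smooth_funs M W \<Longrightarrow> (\<lambda>p. - f p) \<in> smooth_funs M W"
  using smooth_funs_cmult[of f W "-1"] by simp

lemma smooth_funs_diff:
  "f \<in> smooth_funs M W \<Longrightarrow> g \<in> smooth_funs M W \<Longrightarrow> (\<lambda>p. f p - g p) \<in> smooth_funs M W"
  using smooth_funs_add[OF _ smooth_funs_uminus, of f W g] by simp

lemma smooth_funs_sum:
  "openin (mtop M) W \<Longrightarrow> (\<And>i. i \<in> I \<Longrightarrow> f i \<in> smooth_funs M W) \<Longrightarrow> (\<lambda>p. \<Sum>i\<in>I. f i p) \<in> smooth_funs M W"
  by (induction I rule: infinite_finite_induct) (simp_all add: smooth_funs_const smooth_funs_add)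

lemma smooth_funs_prod:
  "openin (mtop M) W \<Longrightarrow> (\<And>i. i \<in> I \<Longrightarrow> f i \<in> smooth_funs M W) \<Longrightarrow> (\<lambda>p. \<Prod>i\<in>I. f i p) \<in> smooth_funs M W"
  by (induction I rule: infinite_finite_induct) (simp_all add: smooth_funs_const smooth_funs_mult)

lemma smooth_funs_compose:
  assumes f: "f \<in> smooth_funs M W" and H: "open H" "Cinf_on H h" "\<And>p. p \<in> W \<Longrightarrow> f p \<in> H"
  shows "(\<lambda>p. (h (f p) :: real)) \<in> smooth_funs M W"
proof (rule smooth_funsI[OF smooth_funs_openin[OF f]])
  fix p assume p: "p \<in> W"
  obtain U \<phi> where U: "(U, \<phi>) \<in> charts M" "p \<in> U" using chart_cover smooth_funs_topspace[OF f p] by blast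
  obtain G g where G: "open G" "\<phi> p \<in> G" "Cinf_on G g"
    "\<And>q. q \<in> U \<Longrightarrow> q \<in> W \<Longrightarrow> \<phi> q \<in> G \<Longrightarrow> f q = g (\<phi> q)"
    using smooth_funsE[OF f U p] by blast
  have o: "open (G \<inter> g -` H)"
    by (rule continuous_open_preimage[OF Cinf_on_imp_continuous_on[OF G(3)] G(1) H(1)])
  have "Cinf_on (G \<inter> g -` H) (\<lambda>x. h (g x))"
    by (rule Cinf_on_compose[OF o H(1) _ _ H(2)]) (auto intro: Cinf_on_subset[OF G(3)])
  then show "\<exists>U \<phi> G g. (U, \<phi>) \<in> charts M \<and> p \<in> U \<and> open G \<and> \<phi> p \<in> G \<and> Cinf_on G g \<and>
      (\<forall>q\<in>U \<inter> W. \<phi> q \<in> G \<longrightarrow> h (f q) = g (\<phi> q))"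
    using U G(2) o H(3)[OF p] G(4)[OF U(2) p] G(4)
    by (intro exI[of _ U] exI[of _ \<phi>] exI[of _ "G \<inter> g -` H"] exI[of _ "\<lambda>x. h (g x)"]) auto
qed

lemma smooth_funs_inverse:
  assumes "f \<in> smooth_funs M W" "\<And>p. p \<in> W \<Longrightarrow> f p \<noteq> 0"
  shows "(\<lambda>p. inverse (f p)) \<in> smooth_funs M W"
  by (rule smooth_funs_compose[OF assms(1) _ Cinf_on_inverse]) (use assms in \<open>auto simp: open_Collect_neq\<close>)

lemma smooth_funs_divide:
  assumes "f \<in> smooth_funs M W" "g \<in> smooth_funs M W" "\<And>p. p \<in> W \<Longrightarrow> g p \<noteq> 0"
  shows "(\<lambda>p. f p / g p) \<in> smooth_funs M W"
  using smooth_funs_mult[OF assms(1) smooth_funs_inverse[OF assms(2,3)]] by (simp add: divide_inverse)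

lemma smooth_funs_preimage_open:
  assumes f: "f \<in> smooth_funs M W" and "open H"
  shows "openin (mtop M) {q \<in> W. f q \<in> H}"
proof (subst openin_subopen, intro ballI)
  fix p assume p: "p \<in> {q \<in> W. f q \<in> H}"
  then have pW: "p \<in> W" by simp
  obtain U \<phi> where U: "(U, \<phi>) \<in> charts M" "p \<in> U" using chart_cover smooth_funs_topspace[OF f pW] by blast
  obtain G g where G: "open G" "\<phi> p \<in> G" "Cinf_on G g"
    "\<And>q. q \<in> U \<Longrightarrow> q \<in> W \<Longrightarrow> \<phi> q \<in> G \<Longrightarrow> f q = g (\<phi> q)"
    using smooth_funsE[OF f U pW] by blast
  have o: "open (G \<inter> g -` H)"
    by (rule continuous_open_preimage[OF Cinf_on_imp_continuous_on[OF G(3)] G(1) assms(2)])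
  then have "openin (mtop M) (W \<inter> {q \<in> U. \<phi> q \<in> G \<inter> g -` H})"
    using chart_preimage_open[OF U(1)] smooth_funs_openin[OF f] by blast
  then show "\<exists>T. openin (mtop M) T \<and> p \<in> T \<and> T \<subseteq> {q \<in> W. f q \<in> H}"
    using p U(2) G(2) G(4)[of p] G(4)
    by (intro exI[of _ "W \<inter> {q \<in> U. \<phi> q \<in> G \<inter> g -` H}"]) auto
qed

lemma smooth_funs_nonzero_open: "f \<in> smooth_funs M W \<Longrightarrow> openin (mtop M) {q \<in> W. f q \<noteq> 0}"
  using smooth_funs_preimage_open[of f W "- {0}"] by (simp add: open_Compl)

lemma smooth_funs_det:
  fixes A :: "'m \<Rightarrow> real ^ 'k ^ 'k::finite"
  assumes "openin (mtop M) W" "\<And>i j. (\<lambda>p. A p $ i $ j) \<in> smooth_funs M W"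
  shows "(\<lambda>p. det (A p)) \<in> smooth_funs M W"
  unfolding det_def
  by (intro smooth_funs_sum smooth_funs_mult smooth_funs_const smooth_funs_prod assms)

lemma smooth_atI: "f \<in> smooth_funs M W \<Longrightarrow> p \<in> W \<Longrightarrow> smooth_at M p f"
  unfolding smooth_at_def by blast

lemma smooth_at2E:
  assumes "smooth_at M p f" "smooth_at M p g"
  obtains W where "p \<in> W" "f \<in> smooth_funs M W" "g \<in> smooth_funs M W"
proof -
  obtain V W where "p \<in> V" "f \<in> smooth_funs M V" "p \<in> W" "g \<in> smooth_funs M W"
    using assms unfolding smooth_at_def by blast
  then show ?thesis
    using that[of "V \<inter> W"] smooth_funs_Int[of g W V] smooth_funs_Int[of f V W] smooth_funs_openin
    by (metis Int_commute Int_iff)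
qed

lemma smooth_at_cong:
  assumes "smooth_at M p f" "openin (mtop M) V" "p \<in> V" "\<And>q. q \<in> V \<Longrightarrow> f q = g q"
  shows "smooth_at M p g"
proof -
  obtain W where W: "p \<in> W" "f \<in> smooth_funs M W" using assms(1) unfolding smooth_at_def by blast
  have "g \<in> smooth_funs M (V \<inter> W)"
    by (rule smooth_funs_cong[OF smooth_funs_Int[OF W(2) assms(2)]]) (use assms(4) in auto)
  then show ?thesis using smooth_atI W(1) assms(3) by blast
qed

lemma smooth_at_add: "smooth_at M p f \<Longrightarrow> smooth_at M p g \<Longrightarrow> smooth_at M p (\<lambda>q. f q + g q)"
  by (erule (1) smooth_at2E) (auto intro: smooth_atI smooth_funs_add)

lemma smooth_at_mult: "smooth_at M p f \<Longrightarrow> smooth_at M p g \<Longrightarrow> smooth_at M p (\<lambda>q. f q * g q)"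
  by (erule (1) smooth_at2E) (auto intro: smooth_atI smooth_funs_mult)

lemma smooth_at_const: "p \<in> topspace (mtop M) \<Longrightarrow> smooth_at M p (\<lambda>q. c)"
  by (rule smooth_atI[OF smooth_funs_const[OF openin_topspace]])

lemma smooth_at_lin:
  "smooth_at M p f \<Longrightarrow> smooth_at M p g \<Longrightarrow> smooth_at M p (\<lambda>q. a * f q + b * g q)"
  by (erule (1) smooth_at2E) (auto intro!: smooth_atI smooth_funs_add smooth_funs_cmult)

lemma tspace_topspace: "v \<in> tspace M p \<Longrightarrow> p \<in> topspace (mtop M)"
  unfolding tspace_def by blast

lemma tspace_nonsmooth: "v \<in> tspace M p \<Longrightarrow> \<not> smooth_at M p f \<Longrightarrow> v f = 0"
  unfolding tspace_def by blast

lemma tspace_cong: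
  "v \<in> tspace M p \<Longrightarrow> openin (mtop M) W \<Longrightarrow> p \<in> W \<Longrightarrow> (\<And>q. q \<in> W \<Longrightarrow> f q = g q) \<Longrightarrow> v f = v g"
  unfolding tspace_def by blast

lemma tspace_lin:
  "v \<in> tspace M p \<Longrightarrow> smooth_at M p f \<Longrightarrow> smooth_at M p g \<Longrightarrow>
    v (\<lambda>q. a * f q + b * g q) = a * v f + b * v g"
  unfolding tspace_def by blast

lemma tspace_mult:
  "v \<in> tspace M p \<Longrightarrow> smooth_at M p f \<Longrightarrow> smooth_at M p g \<Longrightarrow>
    v (\<lambda>q. f q * g q) = f p * v g + g p * v f"
  unfolding tspace_def by blast

lemma tspace_add:
  "v \<in> tspace M p \<Longrightarrow> smooth_at M p f \<Longrightarrow> smooth_at M p g \<Longrightarrow> v (\<lambda>q. f q + g q) = v f + v g"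
  using tspace_lin[of v p f g 1 1] by simp

lemma tspace_diff:
  "v \<in> tspace M p \<Longrightarrow> smooth_at M p f \<Longrightarrow> smooth_at M p g \<Longrightarrow> v (\<lambda>q. f q - g q) = v f - v g"
  using tspace_lin[of v p f g 1 "-1"] by simp

lemma tspace_const: "v \<in> tspace M p \<Longrightarrow> v (\<lambda>q. c) = 0"
proof -
  assume v: "v \<in> tspace M p"
  have s: "smooth_at M p (\<lambda>q. c)" for c using smooth_at_const tspace_topspace[OF v] by blast
  have "v (\<lambda>q. 1 * 1) = 1 * v (\<lambda>q. 1) + 1 * v (\<lambda>q. 1)" by (rule tspace_mult[OF v s s])
  then have 1: "v (\<lambda>q. 1) = 0" by simp
  have "v (\<lambda>q. c * 1 + 0 * 1) = c * v (\<lambda>q. 1) + 0 * v (\<lambda>q. 1)" by (rule tspace_lin[OF v s s])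
  then show ?thesis using 1 by simp
qed

lemma smooth_at_sum:
  "p \<in> topspace (mtop M) \<Longrightarrow> (\<And>i. i \<in> I \<Longrightarrow> smooth_at M p (f i)) \<Longrightarrow> smooth_at M p (\<lambda>q. \<Sum>i\<in>I. f i q)"
  by (induction I rule: infinite_finite_induct) (auto intro: smooth_at_const smooth_at_add)

lemma tspace_sum:
  assumes v: "v \<in> tspace M p" and "\<And>i. i \<in> I \<Longrightarrow> smooth_at M p (f i)"
  shows "v (\<lambda>q. \<Sum>i\<in>I. f i q) = (\<Sum>i\<in>I. v (f i))"
  using assms(2)
proof (induction I rule: infinite_finite_induct)
  case (insert i I)
  have "v (\<lambda>q. f i q + (\<Sum>i\<in>I. f i q)) = v (f i) + v (\<lambda>q. \<Sum>i\<in>I. f i q)"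
    by (intro tspace_add[OF v] smooth_at_sum tspace_topspace[OF v] insert.prems) auto
  then show ?case using insert by simp
qed (simp_all add: tspace_const[OF v])

text \<open>Hadamard's lemma writes \<open>g x\<close> as \<open>g (\<phi> p) + (\<Sum>i. (x $ i - \<phi> p $ i) * h i x)\<close>, where \<open>h i\<close> has
  the value \<open>pd g i (\<phi> p)\<close> at \<open>\<phi> p\<close>; by the Leibniz rule \<open>v\<close> sees nothing else of \<open>h i\<close>.\<close>

lemma tspace_chart:
  assumes v: "v \<in> tspace M p" and U: "(U, \<phi>) \<in> charts M" "p \<in> U"
    and G: "open G" "\<phi> p \<in> G" "Cinf_on G g"
    and W: "openin (mtop M) W" "p \<in> W" "\<And>q. q \<in> U \<Longrightarrow> q \<in> W \<Longrightarrow> \<phi> q \<in> G \<Longrightarrow> f q = g (\<phi> q)"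
  shows "v f = (\<Sum>i\<in>UNIV. v (\<lambda>q. \<phi> q $ i) * pd g i (\<phi> p))"
proof -
  let ?x = "\<phi> p"
  obtain e where e: "0 < e" "ball ?x e \<subseteq> G" using openE[OF G(1,2)] by blast
  let ?B = "ball ?x e"
  have d: "Cinf_on ?B (\<lambda>x. ?x + - 1 *\<^sub>R x)"
    by (intro Cinf_on_add Cinf_on_scaleR Cinf_on_const Cinf_on_id open_ball)
  have seg: "x + u *\<^sub>R (?x + - 1 *\<^sub>R x) \<in> ?B" if "x \<in> ?B" "u \<in> {0..1}" for x u
  proof -
    have "x + u *\<^sub>R (?x + - 1 *\<^sub>R x) = (1 - u) *\<^sub>R x + u *\<^sub>R ?x" by (simp add: algebra_simps)
    then show ?thesis using convexD_alt[OF convex_ball that(1), of ?x u] e(1) that(2) by simp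
  qed
  obtain h where h: "\<And>i. Cinf_on ?B (h i)"
    "\<And>x. x \<in> ?B \<Longrightarrow> g (x + (?x + - 1 *\<^sub>R x)) = g x + (\<Sum>i\<in>UNIV. (?x + - 1 *\<^sub>R x) $ i * h i x)"
    "\<And>i x. x \<in> ?B \<Longrightarrow> ?x + - 1 *\<^sub>R x = 0 \<Longrightarrow> h i x = pd g i x"
    using hadamard_along[OF open_ball open_ball Cinf_on_subset[OF G(3) e(2)] d seg] by blast
  have h2: "g x = g ?x + (\<Sum>i\<in>UNIV. (x $ i + - ?x $ i) * h i x)" if "x \<in> ?B" for x
  proof -
    have "(\<Sum>i\<in>UNIV. (?x + - 1 *\<^sub>R x) $ i * h i x) = - (\<Sum>i\<in>UNIV. (x $ i + - ?x $ i) * h i x)"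
      unfolding sum_negf[symmetric] by (intro sum.cong) (simp_all add: algebra_simps)
    then show ?thesis using h(2)[OF that] by simp
  qed
  let ?W = "W \<inter> {q \<in> U. \<phi> q \<in> ?B}"
  have oW: "openin (mtop M) ?W" using W(1) chart_preimage_open[OF U(1) open_ball] by blast
  have pW: "p \<in> ?W" using W(2) U(2) e(1) by simp
  have sh: "smooth_at M p (\<lambda>q. h i (\<phi> q))" for i
    by (rule smooth_atI[OF smooth_funs_chart_compose[OF U(1) open_ball h(1)]]) (use pW in auto)
  have sc: "smooth_at M p (\<lambda>q. \<phi> q $ i)" for i by (rule smooth_atI[OF smooth_funs_coord[OF U(1)] U(2)])
  have s1: "smooth_at M p (\<lambda>q. c)" for c using smooth_at_const tspace_topspace[OF v] by blast
  have "v f = v (\<lambda>q. g ?x + (\<Sum>i\<in>UNIV. (\<phi> q $ i + - ?x $ i) * h i (\<phi> q)))"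
  proof (rule tspace_cong[OF v oW pW])
    fix q assume q: "q \<in> ?W"
    then have "f q = g (\<phi> q)" using W(3) e(2) by auto
    then show "f q = g ?x + (\<Sum>i\<in>UNIV. (\<phi> q $ i + - ?x $ i) * h i (\<phi> q))" using h2[of "\<phi> q"] q by auto
  qed
  also have "\<dots> = v (\<lambda>q. g ?x) + v (\<lambda>q. \<Sum>i\<in>UNIV. (\<phi> q $ i + - ?x $ i) * h i (\<phi> q))"
    by (intro tspace_add[OF v] s1 smooth_at_sum smooth_at_mult smooth_at_add sc sh tspace_topspace[OF v])
  also have "\<dots> = (\<Sum>i\<in>UNIV. v (\<lambda>q. (\<phi> q $ i + - ?x $ i) * h i (\<phi> q)))"
    by (simp only: tspace_const[OF v] add_0)
      (intro tspace_sum[OF v] s1 smooth_at_mult smooth_at_add sc sh)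
  also have "\<dots> = (\<Sum>i\<in>UNIV. v (\<lambda>q. \<phi> q $ i) * pd g i ?x)"
  proof (rule sum.cong)
    fix i
    have "v (\<lambda>q. (\<phi> q $ i + - ?x $ i) * h i (\<phi> q)) = h i ?x * v (\<lambda>q. \<phi> q $ i + - ?x $ i)"
      by (subst tspace_mult[OF v smooth_at_add[OF sc s1] sh]) simp
    also have "v (\<lambda>q. \<phi> q $ i + - ?x $ i) = v (\<lambda>q. \<phi> q $ i)"
      by (subst tspace_add[OF v sc s1]) (simp add: tspace_const[OF v])
    also have "h i ?x = pd g i ?x" using h(3)[of ?x i] e(1) by simp
    finally show "v (\<lambda>q. (\<phi> q $ i + - ?x $ i) * h i (\<phi> q)) = v (\<lambda>q. \<phi> q $ i) * pd g i ?x" by simp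
  qed simp
  finally show ?thesis .
qed

lemma tspace_lincomb:
  assumes "v \<in> tspace M p" "w \<in> tspace M p"
  shows "(\<lambda>f. a * v f + b * w f) \<in> tspace M p"
proof -
  have "a * v (\<lambda>q. f q * g q) + b * w (\<lambda>q. f q * g q) = f p * (a * v g + b * w g) + g p * (a * v f + b * w f)"
    if "smooth_at M p f" "smooth_at M p g" for f g
    by (simp add: tspace_mult[OF assms(1) that] tspace_mult[OF assms(2) that] algebra_simps)
  moreover have "a * v (\<lambda>q. c * f q + d * g q) + b * w (\<lambda>q. c * f q + d * g q)
     = c * (a * v f + b * w f) + d * (a * v g + b * w g)"
    if "smooth_at M p f" "smooth_at M p g" for f g c d
    by (simp add: tspace_lin[OF assms(1) that] tspace_lin[OF assms(2) that] algebra_simps)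
  moreover have "a * v f + b * w f = a * v g + b * w g" if "openin (mtop M) W" "p \<in> W" "\<forall>q\<in>W. f q = g q" for f g W
    using tspace_cong[OF assms(1) that(1,2), of f g] tspace_cong[OF assms(2) that(1,2), of f g] that(3) by simp
  ultimately show ?thesis
    unfolding tspace_def using tspace_topspace[OF assms(1)] tspace_nonsmooth[OF assms(1)] tspace_nonsmooth[OF assms(2)]
    by (auto simp only: mem_Collect_eq mult_zero_right add_0 simp_thms)
qed

lemma tspace_zero: "p \<in> topspace (mtop M) \<Longrightarrow> (\<lambda>f. 0) \<in> tspace M p"
  unfolding tspace_def by simp

lemma tspace_sum_mem:
  assumes "p \<in> topspace (mtop M)" "\<And>i. i \<in> I \<Longrightarrow> v i \<in> tspace M p"
  shows "(\<lambda>f. \<Sum>i\<in>I. a i * v i f) \<in> tspace M p"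
  using assms(2)
proof (induction I rule: infinite_finite_induct)
  case (insert i I)
  have "(\<lambda>f. a i * v i f + 1 * (\<Sum>i\<in>I. a i * v i f)) \<in> tspace M p"
    by (rule tspace_lincomb) (use insert in auto)
  then show ?case using insert by simp
qed (simp_all add: tspace_zero assms(1))

lemma vfields_openin: "X \<in> vfields M W \<Longrightarrow> openin (mtop M) W"
  unfolding vfields_def by blast

lemma vfields_tspace: "X \<in> vfields M W \<Longrightarrow> p \<in> W \<Longrightarrow> X p \<in> tspace M p"
  unfolding vfields_def by blast

lemma vfields_smooth: "X \<in> vfields M W \<Longrightarrow> V \<subseteq> W \<Longrightarrow> f \<in> smooth_funs M V \<Longrightarrow> (\<lambda>p. X p f) \<in> smooth_funs M V"
  unfolding vfields_def by blast

lemma vfieldsI: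
  assumes "openin (mtop M) W" "\<And>p. p \<in> W \<Longrightarrow> X p \<in> tspace M p"
    "\<And>V f. V \<subseteq> W \<Longrightarrow> f \<in> smooth_funs M V \<Longrightarrow> (\<lambda>p. X p f) \<in> smooth_funs M V"
  shows "X \<in> vfields M W"
  using assms unfolding vfields_def by blast

lemma vfields_subset: "X \<in> vfields M W \<Longrightarrow> openin (mtop M) V \<Longrightarrow> V \<subseteq> W \<Longrightarrow> X \<in> vfields M V"
  unfolding vfields_def by (auto dest: subset_trans)

lemma vfields_lincomb:
  assumes X: "X \<in> vfields M W" and Y: "Y \<in> vfields M W" and ab: "a \<in> smooth_funs M W" "b \<in> smooth_funs M W"
  shows "(\<lambda>p f. a p * X p f + b p * Y p f) \<in> vfields M W"
proof (rule vfieldsI[OF vfields_openin[OF X]])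
  show "(\<lambda>f. a p * X p f + b p * Y p f) \<in> tspace M p" if "p \<in> W" for p
    using tspace_lincomb vfields_tspace X Y that by blast
  show "(\<lambda>p. a p * X p f + b p * Y p f) \<in> smooth_funs M V" if V: "V \<subseteq> W" "f \<in> smooth_funs M V" for V f
    by (intro smooth_funs_add smooth_funs_mult vfields_smooth[OF X V] vfields_smooth[OF Y V]
        smooth_funs_subset[OF _ smooth_funs_openin[OF V(2)] V(1)] ab)
qed

lemma vfields_add:
  assumes "X \<in> vfields M W" "Y \<in> vfields M W"
  shows "(\<lambda>p f. X p f + Y p f) \<in> vfields M W"
  using vfields_lincomb[OF assms smooth_funs_const smooth_funs_const, of 1 1] vfields_openin[OF assms(1)] by simp

lemma vfields_scale:
  assumes "X \<in> vfields M W" "a \<in> smooth_funs M W"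
  shows "(\<lambda>p f. a p * X p f) \<in> vfields M W"
  using vfields_lincomb[OF assms(1,1,2) smooth_funs_const, of 0] vfields_openin[OF assms(1)] by simp

lemma vfields_zero: "openin (mtop M) W \<Longrightarrow> (\<lambda>p f. 0) \<in> vfields M W"
  by (rule vfieldsI) (auto intro: tspace_zero smooth_funs_const smooth_funs_openin dest: openin_subset)

lemma vfields_sum:
  assumes "openin (mtop M) W" "\<And>i. i \<in> I \<Longrightarrow> X i \<in> vfields M W" "\<And>i. i \<in> I \<Longrightarrow> a i \<in> smooth_funs M W"
  shows "(\<lambda>p f. \<Sum>i\<in>I. a i p * X i p f) \<in> vfields M W"
  using assms(2,3)
  by (induction I rule: infinite_finite_induct) (simp_all add: vfields_zero assms(1) vfields_add vfields_scale)

end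

section \<open>The boundary as a manifold\<close>

locale bdry_manifold =
  fixes M :: "('m, 'n::finite) mfd" and k :: 'n
  assumes B: "manifold_with_boundary k M"

sublocale bdry_manifold \<subseteq> smooth_mfd M
  using B by unfold_locales (simp add: manifold_with_boundary_def)

context bdry_manifold
begin

lemma model_M: "model M = halfspace k"
  using B by (simp add: manifold_with_boundary_def)

lemma chart_nonneg: "(U, \<phi>) \<in> charts M \<Longrightarrow> q \<in> U \<Longrightarrow> 0 \<le> \<phi> q $ k"
  using chart_model[of U \<phi> q] by (simp add: model_M halfspace_def)

text \<open>By invariance of domain, a transition map cannot send an interior point of the half-space
  to its boundary: whether a point lies on the boundary can be read off in any chart.\<close>

lemma bdry_iff:
  assumes U: "(U, \<phi>) \<in> charts M" "p \<in> U"
  shows "p \<in> bdry k M \<longleftrightarrow> \<phi> p $ k = 0"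
proof
  assume "\<phi> p $ k = 0"
  then show "p \<in> bdry k M" using U by (auto simp: bdry_def hyperplane_def)
next
  assume "p \<in> bdry k M"
  then obtain V \<psi> where V: "(V, \<psi>) \<in> charts M" "p \<in> V" "\<psi> p $ k = 0"
    by (auto simp: bdry_def hyperplane_def)
  show "\<phi> p $ k = 0"
  proof (rule ccontr)
    assume "\<phi> p $ k \<noteq> 0"
    then have pos: "0 < \<phi> p $ k" using chart_nonneg[OF U] by simp
    obtain Q where Q: "open Q" "\<phi> ` (U \<inter> V) = halfspace k \<inter> Q"
      using chart_image_open[OF U(1) chart_open[OF V(1)]] model_M by metis
    define A where "A = Q \<inter> {x. 0 < x $ k}"
    have oA: "open A" unfolding A_def by (intro open_Int Q open_Collect_less continuous_intros)
    have sub: "A \<subseteq> \<phi> ` (U \<inter> V)" unfolding Q(2) by (auto simp: A_def halfspace_def)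
    let ?t = "\<psi> \<circ> inv_into U \<phi>"
    have t: "?t (\<phi> q) = \<psi> q" if "q \<in> U" for q using chart_inv[OF U(1) that] by simp
    have "smooth_on_set (\<phi> ` (U \<inter> V)) ?t"
      using M U(1) V(1) unfolding smooth_manifold_def by blast
    then have "smooth_on_set A ?t" by (rule smooth_on_set_cong) (use sub in auto)
    then have c: "continuous_on A ?t"
      using smooth_on_set_imp_Cinf_on[OF oA] Cinf_on_imp_continuous_on by blast
    have inj: "inj_on ?t A"
    proof (rule inj_onI)
      fix x y assume "x \<in> A" "y \<in> A" and e: "?t x = ?t y"
      then obtain q q' where q: "q \<in> U" "q \<in> V" "x = \<phi> q" "q' \<in> U" "q' \<in> V" "y = \<phi> q'" using sub by blast
      then have "\<psi> q = \<psi> q'" using e t by metis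
      then show "x = y" using q inj_onD[OF chart_inj[OF V(1)]] by blast
    qed
    have "open (?t ` A)" by (rule invariance_of_domain[OF c oA inj])
    moreover have "\<psi> p \<in> ?t ` A"
    proof -
      have "\<phi> p \<in> Q" using U(2) V(2) Q(2) by blast
      then show ?thesis using t[OF U(2)] pos by (auto simp: A_def intro!: image_eqI[of _ _ "\<phi> p"])
    qed
    ultimately obtain e where e: "0 < e" "ball (\<psi> p) e \<subseteq> ?t ` A" by (meson openE)
    let ?z = "\<psi> p + (- (e / 2)) *\<^sub>R axis k 1"
    have "?z \<in> ball (\<psi> p) e" using e(1) by (simp add: dist_norm)
    then obtain x where x: "x \<in> A" "?z = ?t x" using e(2) by blast
    then obtain q where q: "q \<in> U" "q \<in> V" "x = \<phi> q" using sub by blast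
    then have "?z = \<psi> q" using x(2) t[OF q(1)] by simp
    then have "0 \<le> ?z $ k" using chart_nonneg[OF V(1) q(2)] by simp
    then show False using V(3) e(1) by (simp add: axis_def)
  qed
qed

lemma intr_iff: "(U, \<phi>) \<in> charts M \<Longrightarrow> p \<in> U \<Longrightarrow> p \<in> intr k M \<longleftrightarrow> 0 < \<phi> p $ k"
  using bdry_iff[of U \<phi> p] chart_nonneg[of U \<phi> p] openin_subset[OF chart_open, of U \<phi>]
  by (auto simp: intr_def)

lemma bdry_topspace: "bdry k M \<subseteq> topspace (mtop M)"
  unfolding bdry_def using openin_subset[OF chart_open] by auto

lemma intr_cases: "p \<in> topspace (mtop M) \<Longrightarrow> p \<in> intr k M \<or> p \<in> bdry k M"
  by (auto simp: intr_def)

lemma openin_intr: "openin (mtop M) (intr k M)"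
proof (subst openin_subopen, intro ballI)
  fix p assume p: "p \<in> intr k M"
  then obtain U \<phi> where U: "(U, \<phi>) \<in> charts M" "p \<in> U" using chart_cover[of p] by (auto simp: intr_def)
  have o: "open {x :: real ^ 'n. 0 < x $ k}" by (intro open_Collect_less continuous_intros)
  show "\<exists>T. openin (mtop M) T \<and> p \<in> T \<and> T \<subseteq> intr k M"
    using chart_preimage_open[OF U(1) o] intr_iff[OF U(1)] p U(2)
    by (intro exI[of _ "{q \<in> U. \<phi> q \<in> {x. 0 < x $ k}}"]) auto
qed

lemma chart_interior_point:
  assumes "openin (mtop M) V" "p \<in> V"
  shows "V \<inter> intr k M \<noteq> {}"
proof -
  obtain U \<phi> where U: "(U, \<phi>) \<in> charts M" "p \<in> U" using chart_cover openin_subset[OF assms(1)] assms(2) by blast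
  obtain Q where Q: "open Q" "\<phi> ` (U \<inter> V) = halfspace k \<inter> Q"
    using chart_image_open[OF U(1) assms(1)] model_M by metis
  have "\<phi> p \<in> Q" using Q(2) U(2) assms(2) by blast
  then obtain e where e: "0 < e" "ball (\<phi> p) e \<subseteq> Q" using Q(1) openE by blast
  let ?z = "\<phi> p + (e / 2) *\<^sub>R axis k 1"
  have k: "0 < ?z $ k" using chart_nonneg[OF U] e(1) by (simp add: axis_def)
  have "?z \<in> ball (\<phi> p) e" using e(1) by (simp add: dist_norm)
  then have "?z \<in> \<phi> ` (U \<inter> V)" using e(2) k Q(2) by (auto simp: halfspace_def)
  then obtain q where "q \<in> U" "q \<in> V" "\<phi> q = ?z" by auto
  then show ?thesis using intr_iff[OF U(1), of q] k by auto
qed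

text \<open>The interior is dense, so smooth functions and vector fields up to the boundary are
  determined by their restrictions to it.\<close>

lemma smooth_funs_eq_of_intr:
  assumes "f \<in> smooth_funs M V" "g \<in> smooth_funs M V"
    and eq: "\<And>p. p \<in> V \<Longrightarrow> p \<in> intr k M \<Longrightarrow> f p = g p" and p: "p \<in> V"
  shows "f p = g p"
proof (rule ccontr)
  assume ne: "f p \<noteq> g p"
  have "openin (mtop M) {q \<in> V. f q - g q \<noteq> 0}"
    by (rule smooth_funs_nonzero_open[OF smooth_funs_diff[OF assms(1,2)]])
  from chart_interior_point[OF this, of p] show False using ne eq p by auto
qed

lemma vfields_eq_of_intr:
  assumes X: "X \<in> vfields M V" and Y: "Y \<in> vfields M V"
    and eq: "\<And>p f. p \<in> V \<Longrightarrow> p \<in> intr k M \<Longrightarrow> X p f = Y p f" and p: "p \<in> V"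
  shows "X p = Y p"
proof
  fix f
  show "X p f = Y p f"
  proof (cases "smooth_at M p f")
    case True
    then obtain W where W: "p \<in> W" "f \<in> smooth_funs M W" unfolding smooth_at_def by blast
    have f: "f \<in> smooth_funs M (V \<inter> W)" by (rule smooth_funs_Int[OF W(2) vfields_openin[OF X]])
    show ?thesis
      by (rule smooth_funs_eq_of_intr[OF vfields_smooth[OF X _ f] vfields_smooth[OF Y _ f]])
        (use eq p W(1) in auto)
  next
    case False
    then show ?thesis using tspace_nonsmooth vfields_tspace[OF X p] vfields_tspace[OF Y p] by metis
  qed
qed

lemma bdry_mfd_simps [simp]:
  "mtop (bdry_mfd k M) = subtopology (mtop M) (bdry k M)"
  "charts (bdry_mfd k M) = (\<lambda>(U, \<phi>). (U \<inter> bdry k M, \<phi>)) ` charts M"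
  "model (bdry_mfd k M) = hyperplane k"
  by (simp_all add: bdry_mfd_def)

lemma smooth_manifold_bdry: "smooth_manifold (bdry_mfd k M)"
proof -
  let ?b = "bdry k M"
  have M': "Hausdorff_space (mtop M)" "second_countable (mtop M)" "\<Union>(fst ` charts M) = topspace (mtop M)"
    using M unfolding smooth_manifold_def by blast+
  have img: "\<phi> ` (U \<inter> ?b \<inter> S) = \<phi> ` (U \<inter> S) \<inter> hyperplane k" if "(U, \<phi>) \<in> charts M" for U \<phi> S
    using bdry_iff[OF that] by (auto simp: hyperplane_def)
  have 1: "openin (subtopology (mtop M) ?b) (U \<inter> ?b) \<and> openin (top_of_set (hyperplane k)) (\<phi> ` (U \<inter> ?b)) \<and>
      homeomorphic_map (subtopology (subtopology (mtop M) ?b) (U \<inter> ?b)) (top_of_set (\<phi> ` (U \<inter> ?b))) \<phi>"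
    if U: "(U, \<phi>) \<in> charts M" for U \<phi>
  proof (intro conjI)
    show "openin (subtopology (mtop M) ?b) (U \<inter> ?b)"
      using chart_open[OF U] openin_subtopology by blast
    obtain Q where Q: "open Q" "\<phi> ` (U \<inter> U) = halfspace k \<inter> Q"
      using chart_image_open[OF U chart_open[OF U]] model_M by metis
    have "\<phi> ` (U \<inter> ?b) = hyperplane k \<inter> Q"
      using img[OF U, of U] Q(2) by (auto simp: Int_absorb Int_assoc Int_left_commute hyperplane_def halfspace_def)
    then show "openin (top_of_set (hyperplane k)) (\<phi> ` (U \<inter> ?b))"
      using Q(1) by (auto simp: openin_open)
    have "homeomorphic_map (subtopology (subtopology (mtop M) U) ?b) (subtopology (top_of_set (\<phi> ` U)) (hyperplane k)) \<phi>"
      by (rule homeomorphic_map_subtopologies[OF chart_homeo[OF U]])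
        (use chart_topspace[OF U] bdry_iff[OF U] in \<open>auto simp: hyperplane_def\<close>)
    moreover have "subtopology (subtopology (mtop M) U) ?b = subtopology (subtopology (mtop M) ?b) (U \<inter> ?b)"
      by (simp add: subtopology_subtopology Int_ac)
    moreover have "subtopology (top_of_set (\<phi> ` U)) (hyperplane k) = top_of_set (\<phi> ` (U \<inter> ?b))"
      using img[OF U, of UNIV] by (simp add: subtopology_subtopology)
    ultimately show "homeomorphic_map (subtopology (subtopology (mtop M) ?b) (U \<inter> ?b)) (top_of_set (\<phi> ` (U \<inter> ?b))) \<phi>"
      by simp
  qed
  have 2: "smooth_on_set (\<phi> ` (U \<inter> ?b \<inter> (V \<inter> ?b))) (\<psi> \<circ> inv_into (U \<inter> ?b) \<phi>)"
    if U: "(U, \<phi>) \<in> charts M" and V: "(V, \<psi>) \<in> charts M" for U \<phi> V \<psi>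
  proof (rule smooth_on_set_cong)
    show "smooth_on_set (\<phi> ` (U \<inter> V)) (\<psi> \<circ> inv_into U \<phi>)"
      using M U V unfolding smooth_manifold_def by blast
    fix x assume "x \<in> \<phi> ` (U \<inter> ?b \<inter> (V \<inter> ?b))"
    then obtain q where q: "q \<in> U" "q \<in> ?b" "x = \<phi> q" by auto
    have "inj_on \<phi> (U \<inter> ?b)" using chart_inj[OF U] inj_on_subset by blast
    then show "(\<psi> \<circ> inv_into U \<phi>) x = (\<psi> \<circ> inv_into (U \<inter> ?b) \<phi>) x"
      using chart_inv[OF U q(1)] inv_into_f_f[of \<phi> "U \<inter> ?b" q] q by simp
  qed auto
  show ?thesis
    unfolding smooth_manifold_def bdry_mfd_simps
  proof (intro conjI)
    show "Hausdorff_space (subtopology (mtop M) ?b)" by (rule Hausdorff_space_subtopology[OF M'(1)])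
    show "second_countable (subtopology (mtop M) ?b)" by (rule second_countable_subtopology[OF M'(2)])
    show "\<Union>(fst ` (\<lambda>(U, \<phi>). (U \<inter> ?b, \<phi>)) ` charts M) = topspace (subtopology (mtop M) ?b)"
      using M'(3) by (force simp: image_image)
  qed (use 1 2 in \<open>auto simp only: image_iff split: prod.splits\<close>)
qed

end

sublocale bdry_manifold \<subseteq> bdry: smooth_mfd "bdry_mfd k M"
  by unfold_locales (rule smooth_manifold_bdry)

context bdry_manifold
begin

lemma openin_bdryI: "openin (mtop M) V \<Longrightarrow> openin (mtop (bdry_mfd k M)) (V \<inter> bdry k M)"
  by (auto simp: openin_subtopology)

lemma openin_bdryE:
  assumes "openin (mtop (bdry_mfd k M)) W"
  obtains V where "openin (mtop M) V" "W = V \<inter> bdry k M"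
  using assms by (auto simp: openin_subtopology)

lemma smooth_funs_restrict:
  assumes f: "f \<in> smooth_funs M V"
  shows "f \<in> smooth_funs (bdry_mfd k M) (V \<inter> bdry k M)"
proof (rule bdry.smooth_funsI[OF openin_bdryI[OF smooth_funs_openin[OF f]]])
  fix p assume p: "p \<in> V \<inter> bdry k M"
  then obtain U \<phi> where U: "(U, \<phi>) \<in> charts M" "p \<in> U" using chart_cover smooth_funs_topspace[OF f] by blast
  obtain G g where "open G" "\<phi> p \<in> G" "Cinf_on G g"
    "\<And>q. q \<in> U \<Longrightarrow> q \<in> V \<Longrightarrow> \<phi> q \<in> G \<Longrightarrow> f q = g (\<phi> q)"
    using smooth_funsE[OF f U] p by blast
  then show "\<exists>U \<phi> G g. (U, \<phi>) \<in> charts (bdry_mfd k M) \<and> p \<in> U \<and> open G \<and> \<phi> p \<in> G \<and> Cinf_on G g \<and>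
      (\<forall>q\<in>U \<inter> (V \<inter> bdry k M). \<phi> q \<in> G \<longrightarrow> f q = g (\<phi> q))"
    using U p by (intro exI[of _ "U \<inter> bdry k M"] exI[of _ \<phi>] exI[of _ G] exI[of _ g]) auto
qed

text \<open>Smoothness on the boundary is defined through local extensions in a chart, and composing such an
  extension with the chart gives a smooth function on the ambient manifold.\<close>

lemma smooth_funs_extend:
  assumes f: "f \<in> smooth_funs (bdry_mfd k M) W" and p: "p \<in> W"
  obtains V f' where "p \<in> V" "V \<inter> bdry k M \<subseteq> W" "f' \<in> smooth_funs M V"
    "\<And>q. q \<in> V \<Longrightarrow> q \<in> bdry k M \<Longrightarrow> f' q = f q"
proof -
  obtain W' where W': "openin (mtop M) W'" "W = W' \<inter> bdry k M"
    using openin_bdryE[OF bdry.smooth_funs_openin[OF f]] .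
  obtain U \<phi> where U: "(U, \<phi>) \<in> charts M" "p \<in> U"
    using chart_cover openin_subset[OF W'(1)] W'(2) p by blast
  have "(U \<inter> bdry k M, \<phi>) \<in> charts (bdry_mfd k M)" using U(1) by force
  then obtain G g where G: "open G" "\<phi> p \<in> G" "Cinf_on G g"
    "\<And>q. q \<in> U \<inter> bdry k M \<Longrightarrow> q \<in> W \<Longrightarrow> \<phi> q \<in> G \<Longrightarrow> f q = g (\<phi> q)"
    using bdry.smooth_funsE[OF f, of "U \<inter> bdry k M" \<phi> p] U(2) p W'(2) by blast
  show ?thesis
    by (rule that[of "W' \<inter> {q \<in> U. \<phi> q \<in> G}" "\<lambda>q. g (\<phi> q)"])
      (use p U(2) G(2,4) W' smooth_funs_Int[OF smooth_funs_chart_compose[OF U(1) G(1,3)]] in auto)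
qed

lemma smooth_at_restrict: "smooth_at M p f \<Longrightarrow> p \<in> bdry k M \<Longrightarrow> smooth_at (bdry_mfd k M) p f"
  unfolding smooth_at_def using smooth_funs_restrict by blast

lemma bdry_tspace_bdry: "w \<in> tspace (bdry_mfd k M) p \<Longrightarrow> p \<in> bdry k M"
  using bdry.tspace_topspace[of w p] by simp

lemma bdry_incl_tspace:
  assumes w: "w \<in> tspace (bdry_mfd k M) p"
  shows "bdry_incl M p w \<in> tspace M p"
proof -
  have p: "p \<in> bdry k M" "p \<in> topspace (mtop M)" using bdry_tspace_bdry[OF w] bdry_topspace by auto
  note r = smooth_at_restrict[OF _ p(1)]
  have "w f = w g" if "openin (mtop M) W" "p \<in> W" "\<forall>q\<in>W. f q = g q" for f g W
    using bdry.tspace_cong[OF w openin_bdryI[OF that(1)], of f g] that p by auto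
  moreover have "smooth_at M p f = smooth_at M p g" if "openin (mtop M) W" "p \<in> W" "\<forall>q\<in>W. f q = g q" for f g W
    using that smooth_at_cong by metis
  ultimately show ?thesis
    unfolding tspace_def bdry_incl_def
    using p(2) smooth_at_lin smooth_at_mult bdry.tspace_lin[OF w r r] bdry.tspace_mult[OF w r r]
    by (simp; blast)
qed

lemma bdry_incl_apply: "smooth_at M p f \<Longrightarrow> bdry_incl M p w f = w f"
  by (simp add: bdry_incl_def)

lemma bdry_incl_extend:
  assumes w: "w \<in> tspace (bdry_mfd k M) p" and f: "f' \<in> smooth_funs M V" "p \<in> V"
    "\<And>q. q \<in> V \<Longrightarrow> q \<in> bdry k M \<Longrightarrow> f' q = f q"
  shows "w f = bdry_incl M p w f'"
proof -
  have "w f = w f'"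
    by (rule bdry.tspace_cong[OF w openin_bdryI[OF smooth_funs_openin[OF f(1)]]])
      (use f bdry_tspace_bdry[OF w] in auto)
  then show ?thesis using bdry_incl_apply[OF smooth_atI[OF f(1,2)]] by simp
qed

text \<open>Every smooth function on the boundary has a local extension, so a tangent vector of the boundary
  can be recovered from its image.\<close>

lemma bdry_incl_inj:
  assumes w: "w \<in> tspace (bdry_mfd k M) p" "w' \<in> tspace (bdry_mfd k M) p"
    and eq: "bdry_incl M p w = bdry_incl M p w'"
  shows "w = w'"
proof
  fix f
  show "w f = w' f"
  proof (cases "smooth_at (bdry_mfd k M) p f")
    case True
    then obtain W where "p \<in> W" "f \<in> smooth_funs (bdry_mfd k M) W" unfolding smooth_at_def by blast
    then obtain V f' where "p \<in> V" "f' \<in> smooth_funs M V" "\<And>q. q \<in> V \<Longrightarrow> q \<in> bdry k M \<Longrightarrow> f' q = f q"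
      using smooth_funs_extend by metis
    then show ?thesis using bdry_incl_extend w eq by metis
  next
    case False
    then show ?thesis using bdry.tspace_nonsmooth w by metis
  qed
qed

lemma bdry_tspace_vanish:
  assumes v: "v \<in> bdry_tspace k M p" and f: "f \<in> smooth_funs M V" "p \<in> V"
    "\<And>q. q \<in> V \<Longrightarrow> q \<in> bdry k M \<Longrightarrow> f q = 0"
  shows "v f = 0"
proof -
  obtain w where w: "w \<in> tspace (bdry_mfd k M) p" "v = bdry_incl M p w"
    using v unfolding bdry_tspace_def by blast
  have "w (\<lambda>q. 0) = v f" unfolding w(2) by (rule bdry_incl_extend[OF w(1) f(1,2)]) (use f(3) in auto)
  then show ?thesis using bdry.tspace_const[OF w(1)] by simp
qed

text \<open>A derivation on the boundary is obtained by applying \<open>v\<close> to extensions; the choice of the extension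
  does not matter because two extensions differ by a function vanishing on the boundary.\<close>

lemma bdry_tspaceI_vanish:
  assumes v: "v \<in> tspace M p" and p: "p \<in> bdry k M"
    and van: "\<And>f V. f \<in> smooth_funs M V \<Longrightarrow> p \<in> V \<Longrightarrow> (\<And>q. q \<in> V \<Longrightarrow> q \<in> bdry k M \<Longrightarrow> f q = 0) \<Longrightarrow> v f = 0"
  shows "v \<in> bdry_tspace k M p"
proof -
  let ?N = "bdry_mfd k M"
  define ext where "ext f f' \<longleftrightarrow> (\<exists>V. p \<in> V \<and> f' \<in> smooth_funs M V \<and> (\<forall>q\<in>V \<inter> bdry k M. f' q = f q))" for f f'
  define w where "w f = (if smooth_at ?N p f then v (SOME f'. ext f f') else 0)" for f
  have ext_ex: "\<exists>f'. ext f f'" if f: "smooth_at ?N p f" for f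
  proof -
    obtain W where W: "p \<in> W" "f \<in> smooth_funs ?N W" using f unfolding smooth_at_def by blast
    obtain V f' where "p \<in> V" "V \<inter> bdry k M \<subseteq> W" "f' \<in> smooth_funs M V"
      "\<And>q. q \<in> V \<Longrightarrow> q \<in> bdry k M \<Longrightarrow> f' q = f q"
      using smooth_funs_extend[OF W(2,1)] by metis
    then show ?thesis unfolding ext_def by blast
  qed
  have ext_at: "smooth_at M p f'" "smooth_at ?N p f" "f' p = f p" if e: "ext f f'" for f f'
  proof -
    obtain V where V: "p \<in> V" "f' \<in> smooth_funs M V" "\<forall>q\<in>V \<inter> bdry k M. f' q = f q"
      using e unfolding ext_def by blast
    show "smooth_at M p f'" using smooth_atI V by blast
    show "f' p = f p" using V p by blast
    have "f \<in> smooth_funs ?N (V \<inter> bdry k M)"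
      by (rule bdry.smooth_funs_cong[OF smooth_funs_restrict[OF V(2)]]) (use V(3) in auto)
    then show "smooth_at ?N p f" by (rule bdry.smooth_atI) (use V(1) p in auto)
  qed
  have ext2: "\<exists>V. p \<in> V \<and> f' \<in> smooth_funs M V \<and> g' \<in> smooth_funs M V \<and>
      (\<forall>q\<in>V \<inter> bdry k M. f' q = f q \<and> g' q = g q)" if e: "ext f f'" "ext g g'" for f f' g g'
  proof -
    obtain V where V: "p \<in> V" "f' \<in> smooth_funs M V" "\<forall>q\<in>V \<inter> bdry k M. f' q = f q"
      using e(1) unfolding ext_def by blast
    obtain W where W: "p \<in> W" "g' \<in> smooth_funs M W" "\<forall>q\<in>W \<inter> bdry k M. g' q = g q"
      using e(2) unfolding ext_def by blast
    have "g' \<in> smooth_funs M (V \<inter> W)" by (rule smooth_funs_Int[OF W(2) smooth_funs_openin[OF V(2)]])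
    moreover have "f' \<in> smooth_funs M (W \<inter> V)" by (rule smooth_funs_Int[OF V(2) smooth_funs_openin[OF W(2)]])
    then have "f' \<in> smooth_funs M (V \<inter> W)" by (simp only: Int_commute)
    ultimately show ?thesis using V(1,3) W(1,3) by blast
  qed
  have ext_unique: "v f1 = v f2" if e: "ext f f1" "ext f f2" for f f1 f2
  proof -
    obtain V where V: "p \<in> V" "f1 \<in> smooth_funs M V" "f2 \<in> smooth_funs M V"
      "\<forall>q\<in>V \<inter> bdry k M. f1 q = f q \<and> f2 q = f q" using ext2[OF e] by blast
    have "v (\<lambda>q. f1 q - f2 q) = 0"
      by (rule van[OF smooth_funs_diff[OF V(2,3)] V(1)]) (use V(4) in auto)
    then show ?thesis using tspace_diff[OF v ext_at(1)[OF e(1)] ext_at(1)[OF e(2)]] by simp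
  qed
  have w_eq: "w f = v f'" if e: "ext f f'" for f f'
    using ext_unique[OF someI[of "ext f", OF e] e] ext_at(2)[OF e] by (simp add: w_def)
  have lin: "ext (\<lambda>q. a * f q + b * g q) (\<lambda>q. a * f' q + b * g' q)"
    and mul: "ext (\<lambda>q. f q * g q) (\<lambda>q. f' q * g' q)" if e: "ext f f'" "ext g g'" for f f' g g' a b
  proof -
    obtain V where V: "p \<in> V" "f' \<in> smooth_funs M V" "g' \<in> smooth_funs M V"
      "\<forall>q\<in>V \<inter> bdry k M. f' q = f q \<and> g' q = g q" using ext2[OF e] by blast
    show "ext (\<lambda>q. a * f q + b * g q) (\<lambda>q. a * f' q + b * g' q)" unfolding ext_def
      using V smooth_funs_add[OF smooth_funs_cmult[OF V(2)] smooth_funs_cmult[OF V(3)]]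
      by (intro exI[of _ V]) auto
    show "ext (\<lambda>q. f q * g q) (\<lambda>q. f' q * g' q)" unfolding ext_def
      using V smooth_funs_mult[OF V(2,3)] by (intro exI[of _ V]) auto
  qed
  have "w \<in> tspace ?N p" unfolding tspace_def
  proof (safe)
    show "p \<in> topspace (mtop ?N)" using p bdry_topspace by auto
    show "w f = 0" if "\<not> smooth_at ?N p f" for f using that by (simp add: w_def)
    show "w f = w g" if W: "openin (mtop ?N) W" "p \<in> W" "\<forall>q\<in>W. f q = g q" for f g W
    proof (cases "smooth_at ?N p f")
      case True
      then obtain f' where e: "ext f f'" using ext_ex by blast
      obtain W' where W': "openin (mtop M) W'" "W = W' \<inter> bdry k M" using openin_bdryE[OF W(1)] .
      obtain V where V: "p \<in> V" "f' \<in> smooth_funs M V" "\<forall>q\<in>V \<inter> bdry k M. f' q = f q"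
        using e unfolding ext_def by blast
      have "ext g f'" unfolding ext_def
        using V W' W smooth_funs_Int[OF V(2) W'(1)] by (intro exI[of _ "W' \<inter> V"]) auto
      then show ?thesis using w_eq e by metis
    next
      case False
      moreover have "\<not> smooth_at ?N p g"
      proof
        assume "smooth_at ?N p g"
        then have "smooth_at ?N p f" by (rule bdry.smooth_at_cong[OF _ W(1,2)]) (use W(3) in simp)
        then show False using False by simp
      qed
      ultimately show ?thesis by (simp add: w_def)
    qed
    fix f g assume fg: "smooth_at ?N p f" "smooth_at ?N p g"
    obtain f' g' where e: "ext f f'" "ext g g'" using fg ext_ex by blast
    show "w (\<lambda>q. a * f q + b * g q) = a * w f + b * w g" for a b
      using w_eq[OF lin[OF e]] w_eq[OF e(1)] w_eq[OF e(2)] tspace_lin[OF v ext_at(1)[OF e(1)] ext_at(1)[OF e(2)]] by simp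
    show "w (\<lambda>q. f q * g q) = f p * w g + g p * w f"
      using w_eq[OF mul[OF e]] w_eq[OF e(1)] w_eq[OF e(2)] tspace_mult[OF v ext_at(1)[OF e(1)] ext_at(1)[OF e(2)]]
        ext_at(3)[OF e(1)] ext_at(3)[OF e(2)] by simp
  qed
  moreover have "bdry_incl M p w = v"
  proof
    fix f
    show "bdry_incl M p w f = v f"
    proof (cases "smooth_at M p f")
      case True
      then have "ext f f" unfolding ext_def smooth_at_def by blast
      then show ?thesis using bdry_incl_apply[OF True] w_eq by simp
    next
      case False
      then show ?thesis using tspace_nonsmooth[OF v] by (simp add: bdry_incl_def)
    qed
  qed
  ultimately show ?thesis unfolding bdry_tspace_def by blast
qed

end

section \<open>Coordinate frames and division by defining functions\<close>

text \<open>Only the differentials of the functions \<open>y i\<close> have to be dual to \<open>E\<close>.  This lets a defining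
  function take the place of a coordinate without passing to a new chart, and it expresses the
  components of a tangent vector \<open>v\<close> as \<open>v (y i)\<close>.\<close>

definition coord_frame ::
  "('m, 'n::finite) mfd \<Rightarrow> 'm set \<Rightarrow> ('n \<Rightarrow> 'm \<Rightarrow> real) \<Rightarrow> ('n \<Rightarrow> 'm field) \<Rightarrow> bool" where
  "coord_frame M V y E \<longleftrightarrow> openin (mtop M) V \<and> (\<forall>i. y i \<in> smooth_funs M V) \<and> (\<forall>i. E i \<in> vfields M V) \<and>
     (\<forall>p\<in>V. \<forall>i j. E i p (y j) = (if i = j then 1 else 0)) \<and>
     (\<forall>p\<in>V. \<forall>v\<in>tspace M p. \<forall>f. v f = (\<Sum>i\<in>UNIV. v (y i) * E i p f))"

lemma coord_frameD:
  assumes "coord_frame M V y E"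
  shows "openin (mtop M) V" "y i \<in> smooth_funs M V" "E i \<in> vfields M V"
    "p \<in> V \<Longrightarrow> E i p (y j) = (if i = j then 1 else 0)"
    "p \<in> V \<Longrightarrow> v \<in> tspace M p \<Longrightarrow> v f = (\<Sum>i\<in>UNIV. v (y i) * E i p f)"
  using assms unfolding coord_frame_def by blast+

lemma (in smooth_mfd) coord_frame_subset:
  assumes "coord_frame M V y E" "openin (mtop M) V'" "V' \<subseteq> V"
  shows "coord_frame M V' y E"
  using assms smooth_funs_subset vfields_subset unfolding coord_frame_def by (simp add: subset_eq) blast

context bdry_manifold
begin

definition chart_rep :: "'m set \<Rightarrow> ('m \<Rightarrow> real ^ 'n) \<Rightarrow> 'm \<Rightarrow> ('m \<Rightarrow> real) \<Rightarrow> (real ^ 'n \<Rightarrow> real) \<Rightarrow> bool" where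
  "chart_rep U \<phi> p f g \<longleftrightarrow> (\<exists>G W. open G \<and> \<phi> p \<in> G \<and> Cinf_on G g \<and> openin (mtop M) W \<and> p \<in> W \<and>
     (\<forall>q\<in>U \<inter> W. \<phi> q \<in> G \<longrightarrow> f q = g (\<phi> q)))"

text \<open>The coordinate vector fields.  The choice of \<open>g\<close> does not matter, not even at boundary points where
  \<open>g\<close> is determined by \<open>f\<close> on one side only; see \<open>chart_rep_pd_unique\<close>.\<close>

definition chart_vf :: "'m set \<Rightarrow> ('m \<Rightarrow> real ^ 'n) \<Rightarrow> 'n \<Rightarrow> 'm field" where
  "chart_vf U \<phi> i p f = (if smooth_at M p f then pd (SOME g. chart_rep U \<phi> p f g) i (\<phi> p) else 0)"

lemma chart_repE:
  assumes "chart_rep U \<phi> p f g"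
  obtains G W where "open G" "\<phi> p \<in> G" "Cinf_on G g" "openin (mtop M) W" "p \<in> W"
    "\<And>q. q \<in> U \<Longrightarrow> q \<in> W \<Longrightarrow> \<phi> q \<in> G \<Longrightarrow> f q = g (\<phi> q)"
  using assms unfolding chart_rep_def by blast

lemma chart_repI:
  "open G \<Longrightarrow> \<phi> p \<in> G \<Longrightarrow> Cinf_on G g \<Longrightarrow> openin (mtop M) W \<Longrightarrow> p \<in> W \<Longrightarrow>
    (\<And>q. q \<in> U \<Longrightarrow> q \<in> W \<Longrightarrow> \<phi> q \<in> G \<Longrightarrow> f q = g (\<phi> q)) \<Longrightarrow> chart_rep U \<phi> p f g"
  unfolding chart_rep_def by blast

lemma chart_rep_smooth_at:
  assumes "(U, \<phi>) \<in> charts M" "p \<in> U" "chart_rep U \<phi> p f g"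
  shows "smooth_at M p f"
proof -
  obtain G W where G: "open G" "\<phi> p \<in> G" "Cinf_on G g" "openin (mtop M) W" "p \<in> W"
    "\<And>q. q \<in> U \<Longrightarrow> q \<in> W \<Longrightarrow> \<phi> q \<in> G \<Longrightarrow> f q = g (\<phi> q)" using chart_repE[OF assms(3)] by blast
  have "(\<lambda>q. g (\<phi> q)) \<in> smooth_funs M (W \<inter> {q \<in> U. \<phi> q \<in> G})"
    by (rule smooth_funs_Int[OF smooth_funs_chart_compose[OF assms(1) G(1,3)] G(4)])
  then have "f \<in> smooth_funs M (W \<inter> {q \<in> U. \<phi> q \<in> G})"
    by (rule smooth_funs_cong) (use G(6) in auto)
  then show ?thesis by (rule smooth_atI) (use assms(2) G in auto)
qed

lemma smooth_at_chart_rep: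
  assumes "(U, \<phi>) \<in> charts M" "p \<in> U" "smooth_at M p f"
  shows "\<exists>g. chart_rep U \<phi> p f g"
proof -
  obtain W where W: "p \<in> W" "f \<in> smooth_funs M W" using assms(3) unfolding smooth_at_def by blast
  obtain G g where "open G" "\<phi> p \<in> G" "Cinf_on G g"
    "\<And>q. q \<in> U \<Longrightarrow> q \<in> W \<Longrightarrow> \<phi> q \<in> G \<Longrightarrow> f q = g (\<phi> q)"
    using smooth_funsE[OF W(2) assms(1,2) W(1)] by blast
  then show ?thesis using chart_repI[of G \<phi> p g W U f] W smooth_funs_openin by blast
qed

text \<open>The half-space contains a short segment in each positive coordinate direction, so the
  first derivatives of a representative are determined by its values on the half-space.\<close>

lemma chart_rep_pd_unique:
  assumes U: "(U, \<phi>) \<in> charts M" "p \<in> U" and r: "chart_rep U \<phi> p f g1" "chart_rep U \<phi> p f g2"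
  shows "pd g1 i (\<phi> p) = pd g2 i (\<phi> p)"
proof -
  obtain G1 W1 where 1: "open G1" "\<phi> p \<in> G1" "Cinf_on G1 g1" "openin (mtop M) W1" "p \<in> W1"
    "\<And>q. q \<in> U \<Longrightarrow> q \<in> W1 \<Longrightarrow> \<phi> q \<in> G1 \<Longrightarrow> f q = g1 (\<phi> q)" using chart_repE[OF r(1)] by blast
  obtain G2 W2 where 2: "open G2" "\<phi> p \<in> G2" "Cinf_on G2 g2" "openin (mtop M) W2" "p \<in> W2"
    "\<And>q. q \<in> U \<Longrightarrow> q \<in> W2 \<Longrightarrow> \<phi> q \<in> G2 \<Longrightarrow> f q = g2 (\<phi> q)" using chart_repE[OF r(2)] by blast
  obtain Q where Q: "open Q" "\<phi> ` (U \<inter> (W1 \<inter> W2)) = halfspace k \<inter> Q"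
    using chart_image_open[OF U(1) openin_Int[OF 1(4) 2(4)]] model_M by metis
  have pQ: "\<phi> p \<in> Q" using Q(2) U(2) 1(5) 2(5) by blast
  have "open (G1 \<inter> G2 \<inter> Q)" using 1(1) 2(1) Q(1) by (intro open_Int)
  then obtain d where d: "0 < d" "ball (\<phi> p) d \<subseteq> G1 \<inter> G2 \<inter> Q"
    using openE[of "G1 \<inter> G2 \<inter> Q" "\<phi> p"] pQ 1(2) 2(2) by blast
  show ?thesis unfolding pd_def
  proof (rule derivative_agree_along[OF Cinf_on_has_derivative[OF 1(3,2)] Cinf_on_has_derivative[OF 2(3,2)]])
    show "g1 (\<phi> p) = g2 (\<phi> p)" using 1(6)[OF U(2) 1(5,2)] 2(6)[OF U(2) 2(5,2)] by simp
    fix e :: real assume "0 < e"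
    define t where "t = min d e / 2"
    have t: "0 < t" "t < d" "t < e" using d(1) \<open>0 < e\<close> by (auto simp: t_def)
    let ?z = "\<phi> p + t *\<^sub>R axis i 1"
    have "?z \<in> ball (\<phi> p) d" using t by (simp add: dist_norm)
    then have z: "?z \<in> G1" "?z \<in> G2" "?z \<in> Q" using d(2) by blast+
    have "?z \<in> halfspace k" using chart_nonneg[OF U] t(1) by (simp add: halfspace_def axis_def)
    then have "?z \<in> \<phi> ` (U \<inter> (W1 \<inter> W2))" unfolding Q(2) using z(3) by blast
    then obtain q where q: "q \<in> U" "q \<in> W1" "q \<in> W2" "\<phi> q = ?z" by (elim imageE) auto
    have "g1 ?z = g2 ?z" using 1(6)[OF q(1,2)] 2(6)[OF q(1,3)] z(1,2) q(4) by simp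
    then show "\<exists>t. 0 < \<bar>t\<bar> \<and> \<bar>t\<bar> < e \<and> g1 (\<phi> p + t *\<^sub>R axis i 1) = g2 (\<phi> p + t *\<^sub>R axis i 1)"
      using t by (intro exI[of _ t]) simp
  qed
qed

lemma chart_vf_eq:
  assumes "(U, \<phi>) \<in> charts M" "p \<in> U" "chart_rep U \<phi> p f g"
  shows "chart_vf U \<phi> i p f = pd g i (\<phi> p)"
proof -
  have "chart_rep U \<phi> p f (SOME g. chart_rep U \<phi> p f g)"
    using someI[of "chart_rep U \<phi> p f", OF assms(3)] .
  then show ?thesis
    using chart_rep_pd_unique[OF assms(1,2) _ assms(3)] chart_rep_smooth_at[OF assms] by (simp add: chart_vf_def)
qed

lemma chart_vf_tspace:
  assumes U: "(U, \<phi>) \<in> charts M" "p \<in> U"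
  shows "chart_vf U \<phi> i p \<in> tspace M p"
proof -
  have p: "p \<in> topspace (mtop M)" using openin_subset[OF chart_open[OF U(1)]] U(2) by blast
  have cong: "chart_vf U \<phi> i p f = chart_vf U \<phi> i p g" if W: "openin (mtop M) W" "p \<in> W" "\<forall>q\<in>W. f q = g q" for f g W
  proof (cases "smooth_at M p f")
    case True
    then obtain h where h: "chart_rep U \<phi> p f h" using smooth_at_chart_rep[OF U] by blast
    obtain G W' where G: "open G" "\<phi> p \<in> G" "Cinf_on G h" "openin (mtop M) W'" "p \<in> W'"
      "\<And>q. q \<in> U \<Longrightarrow> q \<in> W' \<Longrightarrow> \<phi> q \<in> G \<Longrightarrow> f q = h (\<phi> q)" using chart_repE[OF h] by blast
    have "chart_rep U \<phi> p g h"
      by (rule chart_repI[where G=G and W="W' \<inter> W"]) (use G W in auto)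
    then show ?thesis using chart_vf_eq[OF U] h by metis
  next
    case False
    moreover have "\<not> smooth_at M p g" using False smooth_at_cong[OF _ W(1,2), of g f] W(3) by auto
    ultimately show ?thesis by (simp add: chart_vf_def)
  qed
  have lin: "chart_vf U \<phi> i p (\<lambda>q. a * f q + b * g q) = a * chart_vf U \<phi> i p f + b * chart_vf U \<phi> i p g"
    and mul: "chart_vf U \<phi> i p (\<lambda>q. f q * g q) = f p * chart_vf U \<phi> i p g + g p * chart_vf U \<phi> i p f"
    if fg: "smooth_at M p f" "smooth_at M p g" for f g a b
  proof -
    obtain f' where f': "chart_rep U \<phi> p f f'" using smooth_at_chart_rep[OF U fg(1)] by blast
    obtain g' where g': "chart_rep U \<phi> p g g'" using smooth_at_chart_rep[OF U fg(2)] by blast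
    obtain G1 W1 where 1: "open G1" "\<phi> p \<in> G1" "Cinf_on G1 f'" "openin (mtop M) W1" "p \<in> W1"
      "\<And>q. q \<in> U \<Longrightarrow> q \<in> W1 \<Longrightarrow> \<phi> q \<in> G1 \<Longrightarrow> f q = f' (\<phi> q)" using chart_repE[OF f'] by blast
    obtain G2 W2 where 2: "open G2" "\<phi> p \<in> G2" "Cinf_on G2 g'" "openin (mtop M) W2" "p \<in> W2"
      "\<And>q. q \<in> U \<Longrightarrow> q \<in> W2 \<Longrightarrow> \<phi> q \<in> G2 \<Longrightarrow> g q = g' (\<phi> q)" using chart_repE[OF g'] by blast
    have o: "open (G1 \<inter> G2)" "\<phi> p \<in> G1 \<inter> G2" using 1 2 by auto
    have c: "Cinf_on (G1 \<inter> G2) f'" "Cinf_on (G1 \<inter> G2) g'"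
      using Cinf_on_subset[OF 1(3)] Cinf_on_subset[OF 2(3)] by auto
    note d = Cinf_on_has_derivative[OF c(1) o(2)] Cinf_on_has_derivative[OF c(2) o(2)]
    have "chart_rep U \<phi> p (\<lambda>q. a * f q + b * g q) (\<lambda>x. a * f' x + b * g' x)"
    proof (rule chart_repI[where G="G1 \<inter> G2" and W="W1 \<inter> W2"])
      show "Cinf_on (G1 \<inter> G2) (\<lambda>x. a * f' x + b * g' x)"
        by (rule Cinf_on_add[OF o(1) Cinf_on_mult[OF o(1) Cinf_on_const[OF o(1)] c(1)] Cinf_on_mult[OF o(1) Cinf_on_const[OF o(1)] c(2)]])
    qed (use o 1(4-6) 2(4-6) in auto)
    moreover have "pd (\<lambda>x. a * f' x + b * g' x) i (\<phi> p) = a * pd f' i (\<phi> p) + b * pd g' i (\<phi> p)"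
      unfolding pd_def[of f'] pd_def[of g']
      by (rule pd_eqI, intro has_derivative_add has_derivative_mult_right d)
    ultimately show "chart_vf U \<phi> i p (\<lambda>q. a * f q + b * g q) = a * chart_vf U \<phi> i p f + b * chart_vf U \<phi> i p g"
      by (simp add: chart_vf_eq[OF U] chart_vf_eq[OF U f'] chart_vf_eq[OF U g'])
    have "chart_rep U \<phi> p (\<lambda>q. f q * g q) (\<lambda>x. f' x * g' x)"
    proof (rule chart_repI[where G="G1 \<inter> G2" and W="W1 \<inter> W2"])
      show "Cinf_on (G1 \<inter> G2) (\<lambda>x. f' x * g' x)" by (rule Cinf_on_mult[OF o(1) c])
    qed (use o 1(4-6) 2(4-6) in auto)
    moreover have "pd (\<lambda>x. f' x * g' x) i (\<phi> p) = f' (\<phi> p) * pd g' i (\<phi> p) + pd f' i (\<phi> p) * g' (\<phi> p)"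
      unfolding pd_def[of f'] pd_def[of g']
      by (rule pd_eqI, rule has_derivative_mult[OF d])
    moreover have "f p = f' (\<phi> p)" "g p = g' (\<phi> p)" using 1(2,5,6) 2(2,5,6) U(2) by auto
    ultimately show "chart_vf U \<phi> i p (\<lambda>q. f q * g q) = f p * chart_vf U \<phi> i p g + g p * chart_vf U \<phi> i p f"
      by (simp add: chart_vf_eq[OF U] chart_vf_eq[OF U f'] chart_vf_eq[OF U g'])
  qed
  show ?thesis unfolding tspace_def
  proof (safe)
    show "chart_vf U \<phi> i p f = 0" if "\<not> smooth_at M p f" for f using that by (simp add: chart_vf_def)
  qed (rule p, erule (2) cong, erule (1) lin, erule (1) mul)
qed

lemma chart_vf_vfields:
  assumes U: "(U, \<phi>) \<in> charts M"
  shows "chart_vf U \<phi> i \<in> vfields M U"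
proof (rule vfieldsI[OF chart_open[OF U] chart_vf_tspace[OF U]])
  fix V f assume V: "V \<subseteq> U" "f \<in> smooth_funs M V"
  show "(\<lambda>p. chart_vf U \<phi> i p f) \<in> smooth_funs M V"
  proof (rule smooth_funsI[OF smooth_funs_openin[OF V(2)]])
    fix p assume p: "p \<in> V"
    then have pU: "p \<in> U" using V(1) by blast
    obtain G g where G: "open G" "\<phi> p \<in> G" "Cinf_on G g"
      "\<And>q. q \<in> U \<Longrightarrow> q \<in> V \<Longrightarrow> \<phi> q \<in> G \<Longrightarrow> f q = g (\<phi> q)"
      using smooth_funsE[OF V(2) U pU p] by blast
    have "chart_vf U \<phi> i q f = pd g i (\<phi> q)" if "q \<in> U" "q \<in> V" "\<phi> q \<in> G" for q
      by (rule chart_vf_eq[OF U that(1)], rule chart_repI[where G=G and W=V])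
        (use G(1,3,4) that smooth_funs_openin[OF V(2)] in auto)
    then show "\<exists>U' \<psi> G g. (U', \<psi>) \<in> charts M \<and> p \<in> U' \<and> open G \<and> \<psi> p \<in> G \<and> Cinf_on G g \<and>
        (\<forall>q\<in>U' \<inter> V. \<psi> q \<in> G \<longrightarrow> chart_vf U \<phi> i q f = g (\<psi> q))"
      using U pU G(1,2) Cinf_on_pd[OF G(3)]
      by (intro exI[of _ U] exI[of _ \<phi>] exI[of _ G] exI[of _ "pd g i"]) auto
  qed
qed

lemma chart_vf_coord:
  assumes U: "(U, \<phi>) \<in> charts M" "p \<in> U"
  shows "chart_vf U \<phi> i p (\<lambda>q. \<phi> q $ j) = (if i = j then 1 else 0)"
proof -
  have "chart_rep U \<phi> p (\<lambda>q. \<phi> q $ j) (\<lambda>x. x $ j)"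
    by (rule chart_repI[where G=UNIV and W="topspace (mtop M)"])
      (use openin_subset[OF chart_open[OF U(1)]] U(2) Cinf_on_nth[OF open_UNIV Cinf_on_id[OF open_UNIV]] in auto)
  moreover have "pd (\<lambda>x. x $ j) i (\<phi> p) = axis i 1 $ j"
    by (rule pd_eqI[OF bounded_linear_imp_has_derivative[OF bounded_linear_vec_nth]])
  ultimately show ?thesis using chart_vf_eq[OF U] by (simp add: axis_def)
qed

lemma chart_vf_expand:
  assumes U: "(U, \<phi>) \<in> charts M" "p \<in> U" and v: "v \<in> tspace M p"
  shows "v f = (\<Sum>i\<in>UNIV. v (\<lambda>q. \<phi> q $ i) * chart_vf U \<phi> i p f)"
proof (cases "smooth_at M p f")
  case True
  then obtain g where g: "chart_rep U \<phi> p f g" using smooth_at_chart_rep[OF U] by blast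
  obtain G W where G: "open G" "\<phi> p \<in> G" "Cinf_on G g" "openin (mtop M) W" "p \<in> W"
    "\<And>q. q \<in> U \<Longrightarrow> q \<in> W \<Longrightarrow> \<phi> q \<in> G \<Longrightarrow> f q = g (\<phi> q)" using chart_repE[OF g] by blast
  show ?thesis using tspace_chart[OF v U G] chart_vf_eq[OF U g] by simp
next
  case False
  then show ?thesis using tspace_nonsmooth[OF v] by (simp add: chart_vf_def)
qed

lemma coord_frame_chart:
  "(U, \<phi>) \<in> charts M \<Longrightarrow> coord_frame M U (\<lambda>i q. \<phi> q $ i) (chart_vf U \<phi>)"
  unfolding coord_frame_def
  using chart_open smooth_funs_coord chart_vf_vfields chart_vf_coord chart_vf_expand by blast

text \<open>Integrate the normal derivative of \<open>f\<close> along the segment from the hyperplane to the point.\<close>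

lemma divide_by_coord:
  assumes U: "(U, \<phi>) \<in> charts M" "p \<in> U" and p: "p \<in> bdry k M" "p \<in> V" and f: "f \<in> smooth_funs M V"
    and van: "\<And>q. q \<in> V \<Longrightarrow> q \<in> bdry k M \<Longrightarrow> f q = 0"
  obtains W h where "p \<in> W" "W \<subseteq> U" "W \<subseteq> V" "h \<in> smooth_funs M W" "\<And>q. q \<in> W \<Longrightarrow> f q = \<phi> q $ k * h q"
proof -
  let ?x = "\<phi> p"
  have k0: "?x $ k = 0" using bdry_iff[OF U] p(1) by simp
  obtain G g where G: "open G" "?x \<in> G" "Cinf_on G g"
    "\<And>q. q \<in> U \<Longrightarrow> q \<in> V \<Longrightarrow> \<phi> q \<in> G \<Longrightarrow> f q = g (\<phi> q)"
    using smooth_funsE[OF f U p(2)] by blast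
  obtain Q where Q: "open Q" "\<phi> ` (U \<inter> V) = halfspace k \<inter> Q"
    using chart_image_open[OF U(1) smooth_funs_openin[OF f]] model_M by metis
  have pQ: "?x \<in> G \<inter> Q" using Q(2) U(2) p(2) G(2) by blast
  have "open (G \<inter> Q)" using G(1) Q(1) by (rule open_Int)
  then obtain e where e: "0 < e" "ball ?x e \<subseteq> G \<inter> Q"
    using openE[OF _ pQ] by blast
  let ?B = "ball ?x e"
  define d :: "real ^ 'n \<Rightarrow> real ^ 'n" where "d x = (- 1 * x $ k) *\<^sub>R axis k 1" for x
  have cd: "Cinf_on ?B d" unfolding d_def
    by (intro Cinf_on_scaleR Cinf_on_mult Cinf_on_const Cinf_on_nth Cinf_on_id open_ball)
  have seg: "x + u *\<^sub>R d x \<in> ?B" if "x \<in> ?B" "u \<in> {0..1}" for x u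
  proof -
    have "norm (x + u *\<^sub>R d x - ?x) \<le> norm (x - ?x)"
    proof (rule norm_le_componentwise_cart)
      fix i
      have "\<bar>(1 - u) * x $ k\<bar> \<le> 1 * \<bar>x $ k\<bar>"
        unfolding abs_mult by (rule mult_right_mono) (use that(2) in auto)
      then show "norm ((x + u *\<^sub>R d x - ?x) $ i) \<le> norm ((x - ?x) $ i)"
        by (cases "i = k") (auto simp: d_def axis_def k0 algebra_simps)
    qed
    then show ?thesis using that(1) by (simp add: dist_norm norm_minus_commute)
  qed
  have GB: "Cinf_on ?B g" using Cinf_on_subset[OF G(3)] e(2) by blast
  obtain h where h: "\<And>i. Cinf_on ?B (h i)"
    "\<And>x. x \<in> ?B \<Longrightarrow> g (x + d x) = g x + (\<Sum>i\<in>UNIV. d x $ i * h i x)"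
    using hadamard_along[OF open_ball open_ball GB cd seg] by metis
  have g: "g x = x $ k * h k x" if x: "x \<in> ?B" for x
  proof -
    have xd: "x + d x \<in> ?B" using seg[OF x, of 1] by simp
    have "(x + d x) $ k = 0" by (simp add: d_def axis_def)
    then have "x + d x \<in> halfspace k \<inter> Q" using subsetD[OF e(2) xd] by (simp add: halfspace_def)
    then have "x + d x \<in> \<phi> ` (U \<inter> V)" unfolding Q(2) .
    then obtain q where q: "q \<in> U" "q \<in> V" "x + d x = \<phi> q" by blast
    have "q \<in> bdry k M" using bdry_iff[OF U(1) q(1)] q(3) \<open>(x + d x) $ k = 0\<close> by simp
    then have "g (x + d x) = 0" using G(4)[OF q(1,2)] van[OF q(2)] q(3) xd e(2) by auto
    moreover have "(\<Sum>i\<in>UNIV. d x $ i * h i x) = (\<Sum>i\<in>UNIV. if i = k then - (x $ k * h k x) else 0)"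
      by (intro sum.cong) (auto simp: d_def axis_def)
    ultimately show ?thesis using h(2)[OF x] by simp
  qed
  let ?W = "V \<inter> {q \<in> U. \<phi> q \<in> ?B}"
  show ?thesis
  proof (rule that[of ?W "\<lambda>q. h k (\<phi> q)"])
    show "(\<lambda>q. h k (\<phi> q)) \<in> smooth_funs M ?W"
      by (rule smooth_funs_Int[OF smooth_funs_chart_compose[OF U(1) open_ball h(1)] smooth_funs_openin[OF f]])
    show "f q = \<phi> q $ k * h k (\<phi> q)" if "q \<in> ?W" for q
      using G(4)[of q] g[of "\<phi> q"] e(2) that by auto
  qed (use U(2) p(2) e(1) in auto)
qed

lemma local_defining_smooth: "local_defining k M U \<rho> \<Longrightarrow> \<rho> \<in> smooth_funs M U"
  unfolding local_defining_def by blast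

lemma local_defining_zero: "local_defining k M U \<rho> \<Longrightarrow> p \<in> U \<Longrightarrow> \<rho> p = 0 \<longleftrightarrow> p \<in> bdry k M"
  unfolding local_defining_def by blast

lemma local_defining_intr: "local_defining k M U \<rho> \<Longrightarrow> p \<in> U \<Longrightarrow> p \<in> intr k M \<Longrightarrow> \<rho> p \<noteq> 0"
  using local_defining_zero by (auto simp: intr_def)

lemma local_defining_openin: "local_defining k M U \<rho> \<Longrightarrow> openin (mtop M) U"
  using local_defining_smooth smooth_funs_openin by blast

lemma local_defining_subset:
  assumes "local_defining k M U \<rho>" "openin (mtop M) V" "V \<subseteq> U"
  shows "local_defining k M V \<rho>"
  using assms smooth_funs_subset[of \<rho> U V] unfolding local_defining_def by blast

text \<open>The quotient of \<open>\<rho>\<close> by the normal coordinate has no zero at \<open>p\<close>, since otherwise \<open>d\<rho>\<close> would vanish there.\<close>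

lemma local_defining_coord:
  assumes \<rho>: "local_defining k M U' \<rho>" and U: "(U, \<phi>) \<in> charts M" "p \<in> U" and p: "p \<in> bdry k M" "p \<in> U'"
  obtains W r where "p \<in> W" "W \<subseteq> U" "W \<subseteq> U'" "r \<in> smooth_funs M W" "\<And>q. q \<in> W \<Longrightarrow> \<rho> q = \<phi> q $ k * r q"
    "\<And>q. q \<in> W \<Longrightarrow> r q \<noteq> 0"
proof -
  obtain W r where W: "p \<in> W" "W \<subseteq> U" "W \<subseteq> U'" "r \<in> smooth_funs M W" "\<And>q. q \<in> W \<Longrightarrow> \<rho> q = \<phi> q $ k * r q"
    using divide_by_coord[OF U p local_defining_smooth[OF \<rho>]] local_defining_zero[OF \<rho>] by metis
  obtain v where v: "v \<in> tspace M p" "v \<rho> \<noteq> 0" using \<rho> p unfolding local_defining_def by blast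
  have c: "smooth_at M p (\<lambda>q. \<phi> q $ k)" by (rule smooth_atI[OF smooth_funs_coord[OF U(1)] U(2)])
  have "v \<rho> = v (\<lambda>q. \<phi> q $ k * r q)"
    by (rule tspace_cong[OF v(1) smooth_funs_openin[OF W(4)] W(1,5)])
  also have "\<dots> = r p * v (\<lambda>q. \<phi> q $ k)"
    using tspace_mult[OF v(1) c smooth_atI[OF W(4,1)]] bdry_iff[OF U] p(1) by simp
  finally have "r p \<noteq> 0" using v(2) by auto
  then show ?thesis
    using W that[of "{q \<in> W. r q \<noteq> 0}" r] smooth_funs_subset[OF W(4) smooth_funs_nonzero_open[OF W(4)]] by blast
qed

lemma divide_by_defining:
  assumes \<rho>: "local_defining k M U' \<rho>" and p: "p \<in> bdry k M" "p \<in> U'" "p \<in> V" and f: "f \<in> smooth_funs M V"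
    and van: "\<And>q. q \<in> V \<Longrightarrow> q \<in> bdry k M \<Longrightarrow> f q = 0"
  obtains W h where "p \<in> W" "W \<subseteq> U'" "W \<subseteq> V" "h \<in> smooth_funs M W" "\<And>q. q \<in> W \<Longrightarrow> f q = \<rho> q * h q"
proof -
  obtain U \<phi> where U: "(U, \<phi>) \<in> charts M" "p \<in> U" using chart_cover smooth_funs_topspace[OF f p(3)] by blast
  obtain W1 r where 1: "p \<in> W1" "W1 \<subseteq> U" "W1 \<subseteq> U'" "r \<in> smooth_funs M W1" "\<And>q. q \<in> W1 \<Longrightarrow> \<rho> q = \<phi> q $ k * r q"
    "\<And>q. q \<in> W1 \<Longrightarrow> r q \<noteq> 0" using local_defining_coord[OF \<rho> U p(1,2)] by metis
  obtain W2 h where 2: "p \<in> W2" "W2 \<subseteq> V" "h \<in> smooth_funs M W2" "\<And>q. q \<in> W2 \<Longrightarrow> f q = \<phi> q $ k * h q"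
    using divide_by_coord[OF U p(1,3) f van] by metis
  have r: "r \<in> smooth_funs M (W2 \<inter> W1)" by (rule smooth_funs_Int[OF 1(4) smooth_funs_openin[OF 2(3)]])
  have h: "h \<in> smooth_funs M (W1 \<inter> W2)" by (rule smooth_funs_Int[OF 2(3) smooth_funs_openin[OF 1(4)]])
  have "(\<lambda>q. h q / r q) \<in> smooth_funs M (W1 \<inter> W2)"
    by (rule smooth_funs_divide[OF h r[unfolded Int_commute[of W2]]]) (use 1(6) in auto)
  then show ?thesis using 1 2 by (intro that[of "W1 \<inter> W2" "\<lambda>q. h q / r q"]) auto
qed

text \<open>Functions vanishing on the boundary are multiples of \<open>\<rho>\<close>, so by the Leibniz rule \<open>v\<close> annihilates them
  all as soon as it annihilates \<open>\<rho>\<close>.\<close>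

lemma bdry_tspaceI:
  assumes \<rho>: "local_defining k M U' \<rho>" and p: "p \<in> bdry k M" "p \<in> U'" and v: "v \<in> tspace M p" "v \<rho> = 0"
  shows "v \<in> bdry_tspace k M p"
proof (rule bdry_tspaceI_vanish[OF v(1) p(1)])
  fix f V assume f: "f \<in> smooth_funs M V" "p \<in> V" "\<And>q. q \<in> V \<Longrightarrow> q \<in> bdry k M \<Longrightarrow> f q = 0"
  obtain W h where W: "p \<in> W" "W \<subseteq> U'" "W \<subseteq> V" "h \<in> smooth_funs M W" "\<And>q. q \<in> W \<Longrightarrow> f q = \<rho> q * h q"
    using divide_by_defining[OF \<rho> p f(2,1,3)] by metis
  have "v f = v (\<lambda>q. \<rho> q * h q)" by (rule tspace_cong[OF v(1) smooth_funs_openin[OF W(4)] W(1,5)])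
  also have "\<dots> = \<rho> p * v h + h p * v \<rho>"
    by (rule tspace_mult[OF v(1) smooth_atI[OF local_defining_smooth[OF \<rho>] p(2)] smooth_atI[OF W(4,1)]])
  finally show "v f = 0" using v(2) local_defining_zero[OF \<rho> p(2)] p(1) by simp
qed

lemma bdry_tspace_defining:
  assumes \<rho>: "local_defining k M U' \<rho>" and p: "p \<in> U'" and v: "v \<in> bdry_tspace k M p"
  shows "v \<rho> = 0"
  by (rule bdry_tspace_vanish[OF v local_defining_smooth[OF \<rho>] p]) (use local_defining_zero[OF \<rho>] in blast)

text \<open>In a chart the \<open>k\<close>-th derivative of \<open>\<rho>\<close> does not vanish near \<open>p\<close>.  Subtracting a multiple of the
  \<open>k\<close>-th coordinate vector makes the other coordinate vectors tangent to the level sets of \<open>\<rho>\<close>.\<close>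

lemma adapted_frame:
  assumes \<rho>: "local_defining k M U' \<rho>" and p: "p \<in> bdry k M" "p \<in> U'" and N: "openin (mtop M) N" "p \<in> N"
  obtains V y E where "p \<in> V" "V \<subseteq> U'" "V \<subseteq> N" "coord_frame M V y E" "y k = \<rho>"
proof -
  obtain U \<phi> where U: "(U, \<phi>) \<in> charts M" "p \<in> U" using chart_cover bdry_topspace p by blast
  let ?d = "\<lambda>i. chart_vf U \<phi> i" and ?y = "\<lambda>i q. \<phi> q $ i"
  have oS: "openin (mtop M) (U \<inter> U' \<inter> N)"
    using chart_open[OF U(1)] local_defining_openin[OF \<rho>] N(1) by blast
  have cf: "coord_frame M (U \<inter> U' \<inter> N) ?y ?d"
    by (rule coord_frame_subset[OF coord_frame_chart[OF U(1)] oS]) blast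
  have s\<rho>: "\<rho> \<in> smooth_funs M (U \<inter> U' \<inter> N)"
    by (rule smooth_funs_subset[OF local_defining_smooth[OF \<rho>] oS]) blast
  have d\<rho>: "(\<lambda>q. ?d i q \<rho>) \<in> smooth_funs M (U \<inter> U' \<inter> N)" for i
    by (rule vfields_smooth[OF coord_frameD(3)[OF cf] _ s\<rho>]) simp
  obtain W r where W: "p \<in> W" "r \<in> smooth_funs M W" "\<And>q. q \<in> W \<Longrightarrow> \<rho> q = \<phi> q $ k * r q" "r p \<noteq> 0"
    using local_defining_coord[OF \<rho> U p] by metis
  have "?d k p \<rho> = ?d k p (\<lambda>q. \<phi> q $ k * r q)"
    by (rule tspace_cong[OF chart_vf_tspace[OF U] smooth_funs_openin[OF W(2)] W(1,3)])
  also have "\<dots> = r p"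
    using tspace_mult[OF chart_vf_tspace[OF U] smooth_atI[OF smooth_funs_coord[OF U(1)] U(2)] smooth_atI[OF W(2,1)], of k k]
      bdry_iff[OF U] p(1) chart_vf_coord[OF U, of k k] by simp
  finally have nz: "?d k p \<rho> \<noteq> 0" using W(4) by simp
  define V where "V = {q \<in> U \<inter> U' \<inter> N. ?d k q \<rho> \<noteq> 0}"
  have oV: "openin (mtop M) V" unfolding V_def by (rule smooth_funs_nonzero_open[OF d\<rho>])
  have sub: "V \<subseteq> U \<inter> U' \<inter> N" by (auto simp: V_def)
  have cfV: "coord_frame M V ?y ?d" by (rule coord_frame_subset[OF cf oV sub])
  note dV = smooth_funs_subset[OF d\<rho> oV sub]
  have dk: "(\<lambda>q. inverse (?d k q \<rho>)) \<in> smooth_funs M V"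
    by (rule smooth_funs_inverse[OF dV]) (auto simp: V_def)
  define y where "y i = (if i = k then \<rho> else ?y i)" for i
  define E where "E i = (if i = k then (\<lambda>q f. inverse (?d k q \<rho>) * ?d k q f)
      else (\<lambda>q f. 1 * ?d i q f + - (?d i q \<rho> * inverse (?d k q \<rho>)) * ?d k q f))" for i
  have "coord_frame M V y E"
    unfolding coord_frame_def
  proof (intro conjI allI ballI)
    show "openin (mtop M) V" by (rule oV)
    show "y i \<in> smooth_funs M V" for i
      using coord_frameD(2)[OF cfV, of i] smooth_funs_subset[OF s\<rho> oV sub] by (auto simp: y_def)
    show "E i \<in> vfields M V" for i
    proof (cases "i = k")
      case True
      then show ?thesis using vfields_scale[OF coord_frameD(3)[OF cfV] dk, of k] by (simp add: E_def)
    next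
      case False
      have "(\<lambda>q f. 1 * ?d i q f + - (?d i q \<rho> * inverse (?d k q \<rho>)) * ?d k q f) \<in> vfields M V"
        by (rule vfields_lincomb[OF coord_frameD(3)[OF cfV] coord_frameD(3)[OF cfV] smooth_funs_const[OF oV]
            smooth_funs_uminus[OF smooth_funs_mult[OF dV dk]]])
      then show ?thesis using False by (simp add: E_def)
    qed
    fix q assume q: "q \<in> V"
    then have qU: "q \<in> U" and dq: "?d k q \<rho> \<noteq> 0" by (auto simp: V_def)
    show "E i q (y j) = (if i = j then 1 else 0)" for i j
      using dq by (auto simp: E_def y_def chart_vf_coord[OF U(1) qU])
    fix v f assume v: "v \<in> tspace M q"
    have sp: "(\<Sum>i\<in>UNIV. h i) = h k + (\<Sum>i\<in>UNIV - {k}. h i)" for h :: "'n \<Rightarrow> real"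
      by (simp add: sum.remove)
    have "(\<Sum>i\<in>UNIV. v (y i) * E i q f) = v \<rho> * (inverse (?d k q \<rho>) * ?d k q f) +
        (\<Sum>i\<in>UNIV - {k}. v (?y i) * (?d i q f + - (?d i q \<rho> * inverse (?d k q \<rho>)) * ?d k q f))"
      unfolding sp by (simp add: y_def E_def)
    also have "(\<Sum>i\<in>UNIV - {k}. v (?y i) * (?d i q f + - (?d i q \<rho> * inverse (?d k q \<rho>)) * ?d k q f))
       = (\<Sum>i\<in>UNIV - {k}. v (?y i) * ?d i q f) - (\<Sum>i\<in>UNIV - {k}. v (?y i) * ?d i q \<rho>) * (inverse (?d k q \<rho>) * ?d k q f)"
      unfolding sum_distrib_right sum_subtractf[symmetric] by (intro sum.cong) (auto simp: algebra_simps)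
    also have "v \<rho> = v (?y k) * ?d k q \<rho> + (\<Sum>i\<in>UNIV - {k}. v (?y i) * ?d i q \<rho>)"
      using chart_vf_expand[OF U(1) qU v, of \<rho>] unfolding sp .
    also have "(v (?y k) * ?d k q \<rho> + (\<Sum>i\<in>UNIV - {k}. v (?y i) * ?d i q \<rho>)) * (inverse (?d k q \<rho>) * ?d k q f) +
        ((\<Sum>i\<in>UNIV - {k}. v (?y i) * ?d i q f) - (\<Sum>i\<in>UNIV - {k}. v (?y i) * ?d i q \<rho>) * (inverse (?d k q \<rho>) * ?d k q f))
        = v (?y k) * ?d k q f + (\<Sum>i\<in>UNIV - {k}. v (?y i) * ?d i q f)"
      using dq by (simp add: field_simps)
    also have "\<dots> = v f" using chart_vf_expand[OF U(1) qU v, of f] unfolding sp by simp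
    finally show "v f = (\<Sum>i\<in>UNIV. v (y i) * E i q f)" by simp
  qed
  moreover have "p \<in> V" using U(2) p(2) N(2) nz by (simp add: V_def)
  moreover have "y k = \<rho>" by (simp add: y_def)
  ultimately show ?thesis using that sub by blast
qed

lemma coord_frame_exists:
  assumes "openin (mtop M) N" "p \<in> N"
  obtains V y E where "p \<in> V" "V \<subseteq> N" "coord_frame M V y E"
proof -
  obtain U \<phi> where U: "(U, \<phi>) \<in> charts M" "p \<in> U" using chart_cover assms openin_subset by blast
  have "coord_frame M (U \<inter> N) (\<lambda>i q. \<phi> q $ i) (chart_vf U \<phi>)"
    by (rule coord_frame_subset[OF coord_frame_chart[OF U(1)]]) (use chart_open[OF U(1)] assms in auto)
  then show ?thesis using that[of "U \<inter> N"] U assms by blast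
qed

end

section \<open>Connections, frames and densities\<close>

context smooth_mfd
begin

lemma conn_openin: "linear_connection M S D \<Longrightarrow> openin (mtop M) S"
  unfolding linear_connection_def by blast

lemma conn_vfields:
  "linear_connection M S D \<Longrightarrow> W \<subseteq> S \<Longrightarrow> X \<in> vfields M W \<Longrightarrow> Y \<in> vfields M W \<Longrightarrow> D X Y \<in> vfields M W"
  unfolding linear_connection_def by blast

context
  fixes S D W X Y
  assumes D: "linear_connection M S D" and W: "W \<subseteq> S" and X: "X \<in> vfields M W" and Y: "Y \<in> vfields M W"
begin

lemmas conn_rules = conjunct2[OF D[unfolded linear_connection_def], rule_format, OF conjI[OF W conjI[OF X Y]],
    THEN conjunct2]

lemma conn_cong:
  assumes "X' \<in> vfields M W" "Y' \<in> vfields M W" "\<And>q. q \<in> W \<Longrightarrow> X' q = X q" "\<And>q. q \<in> W \<Longrightarrow> Y' q = Y q" "p \<in> W"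
  shows "D X' Y' p = D X Y p"
  by (rule conn_rules[THEN conjunct1, rule_format, OF assms(1,2) _ assms(5)]) (use assms(3,4) in simp)

lemma conn_add:
  assumes "Z \<in> vfields M W" "p \<in> W"
  shows "D (\<lambda>q g. X q g + Z q g) Y p f = D X Y p f + D Z Y p f"
    "D X (\<lambda>q g. Y q g + Z q g) p f = D X Y p f + D X Z p f"
  using conn_rules[THEN conjunct2, THEN conjunct1, rule_format, OF assms] by simp_all

lemma conn_scale:
  assumes "h \<in> smooth_funs M W" "p \<in> W"
  shows "D (\<lambda>q g. h q * X q g) Y p f = h p * D X Y p f"
    "D X (\<lambda>q g. h q * Y q g) p f = X p h * Y p f + h p * D X Y p f"
  using conn_rules[THEN conjunct2, THEN conjunct2, rule_format, OF assms] by simp_all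

end

lemma conn_zero:
  assumes D: "linear_connection M S D" "W \<subseteq> S" and X: "X \<in> vfields M W" and p: "p \<in> W"
  shows "D (\<lambda>q g. 0) X p f = 0" "D X (\<lambda>q g. 0) p f = 0"
proof -
  note c = smooth_funs_const[OF vfields_openin[OF X], of 0]
  show "D (\<lambda>q g. 0) X p f = 0" using conn_scale(1)[OF D X X c p] by simp
  show "D X (\<lambda>q g. 0) p f = 0"
    using conn_scale(2)[OF D X X c p] tspace_const[OF vfields_tspace[OF X p]] by simp
qed

lemma conn_sum1:
  assumes D: "linear_connection M S D" "W \<subseteq> S" and Y: "Y \<in> vfields M W" and p: "p \<in> W" and I: "finite I"
    and X: "\<And>i. i \<in> I \<Longrightarrow> X i \<in> vfields M W" "\<And>i. i \<in> I \<Longrightarrow> a i \<in> smooth_funs M W"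
  shows "D (\<lambda>q g. \<Sum>i\<in>I. a i q * X i q g) Y p f = (\<Sum>i\<in>I. a i p * D (X i) Y p f)"
  using I X
proof (induction I)
  case empty
  then show ?case using conn_zero(1)[OF D Y p] by simp
next
  case (insert i I)
  have 1: "(\<lambda>q g. a i q * X i q g) \<in> vfields M W" using vfields_scale insert.prems by simp
  have 2: "(\<lambda>q g. \<Sum>i\<in>I. a i q * X i q g) \<in> vfields M W"
    by (rule vfields_sum[OF vfields_openin[OF Y]]) (use insert.prems in auto)
  have "D (\<lambda>q g. a i q * X i q g + (\<Sum>i\<in>I. a i q * X i q g)) Y p f
     = D (\<lambda>q g. a i q * X i q g) Y p f + D (\<lambda>q g. \<Sum>i\<in>I. a i q * X i q g) Y p f"
    by (rule conn_add(1)[OF D 1 Y 2 p])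
  moreover have "D (\<lambda>q g. a i q * X i q g) Y p f = a i p * D (X i) Y p f"
    by (rule conn_scale(1)[OF D _ Y _ p]) (use insert.prems in auto)
  ultimately show ?case using insert by simp
qed

lemma conn_sum2:
  assumes D: "linear_connection M S D" "W \<subseteq> S" and X: "X \<in> vfields M W" and p: "p \<in> W" and I: "finite I"
    and Y: "\<And>i. i \<in> I \<Longrightarrow> Y i \<in> vfields M W" "\<And>i. i \<in> I \<Longrightarrow> b i \<in> smooth_funs M W"
  shows "D X (\<lambda>q g. \<Sum>i\<in>I. b i q * Y i q g) p f = (\<Sum>i\<in>I. X p (b i) * Y i p f + b i p * D X (Y i) p f)"
  using I Y
proof (induction I)
  case empty
  then show ?case using conn_zero(2)[OF D X p] by simp
next
  case (insert i I)
  have 1: "(\<lambda>q g. b i q * Y i q g) \<in> vfields M W" using vfields_scale insert.prems by simp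
  have 2: "(\<lambda>q g. \<Sum>i\<in>I. b i q * Y i q g) \<in> vfields M W"
    by (rule vfields_sum[OF vfields_openin[OF X]]) (use insert.prems in auto)
  have "D X (\<lambda>q g. b i q * Y i q g + (\<Sum>i\<in>I. b i q * Y i q g)) p f
     = D X (\<lambda>q g. b i q * Y i q g) p f + D X (\<lambda>q g. \<Sum>i\<in>I. b i q * Y i q g) p f"
    by (rule conn_add(2)[OF D X 1 2 p])
  moreover have "D X (\<lambda>q g. b i q * Y i q g) p f = X p (b i) * Y i p f + b i p * D X (Y i) p f"
    by (rule conn_scale(2)[OF D X _ _ p]) (use insert.prems in auto)
  ultimately show ?case using insert by simp
qed

lemma conn_subset: "linear_connection M S D \<Longrightarrow> openin (mtop M) V \<Longrightarrow> V \<subseteq> S \<Longrightarrow> linear_connection M V D"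
  unfolding linear_connection_def by (meson order_trans)

lemma one_forms_lin:
  "\<Upsilon> \<in> one_forms M S \<Longrightarrow> p \<in> S \<Longrightarrow> v \<in> tspace M p \<Longrightarrow> w \<in> tspace M p \<Longrightarrow>
    \<Upsilon> p (\<lambda>f. a * v f + b * w f) = a * \<Upsilon> p v + b * \<Upsilon> p w"
  unfolding one_forms_def by blast

lemma one_forms_smooth:
  "\<Upsilon> \<in> one_forms M S \<Longrightarrow> V \<subseteq> S \<Longrightarrow> X \<in> vfields M V \<Longrightarrow> (\<lambda>p. \<Upsilon> p (X p)) \<in> smooth_funs M V"
  unfolding one_forms_def by blast

lemma one_form_dlog:
  assumes f: "f \<in> smooth_funs M S" "\<And>p. p \<in> S \<Longrightarrow> f p \<noteq> 0"
  shows "(\<lambda>p v. v f / f p) \<in> one_forms M S"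
proof -
  have "(\<lambda>p. X p f / f p) \<in> smooth_funs M V" if V: "V \<subseteq> S" "X \<in> vfields M V" for V X
  proof -
    have "f \<in> smooth_funs M V" by (rule smooth_funs_subset[OF f(1) vfields_openin[OF V(2)] V(1)])
    then show ?thesis using f(2) V(1) by (intro smooth_funs_divide vfields_smooth[OF V(2)]) auto
  qed
  then show ?thesis using smooth_funs_openin[OF f(1)] by (auto simp: one_forms_def add_divide_distrib)
qed

lemma linear_connection_proj_change:
  assumes D: "linear_connection M S D" and \<Upsilon>: "\<Upsilon> \<in> one_forms M S"
  shows "linear_connection M S (proj_change D \<Upsilon>)"
  unfolding linear_connection_def
proof (intro conjI allI impI ballI; (elim conjE)?)
  show "openin (mtop M) S" by (rule conn_openin[OF D])
  fix W X Y assume W: "W \<subseteq> S" and X: "X \<in> vfields M W" and Y: "Y \<in> vfields M W"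
  have "(\<lambda>p f. 1 * D X Y p f + 1 * ((\<Upsilon> p (X p)) * Y p f + (\<Upsilon> p (Y p)) * X p f)) \<in> vfields M W"
    by (intro vfields_lincomb conn_vfields[OF D W X Y] X Y one_forms_smooth[OF \<Upsilon> W] smooth_funs_const vfields_openin[OF X])
  then show "proj_change D \<Upsilon> X Y \<in> vfields M W" by (simp add: proj_change_def add.assoc)
  show "proj_change D \<Upsilon> X' Y' p = proj_change D \<Upsilon> X Y p"
    if "X' \<in> vfields M W" "Y' \<in> vfields M W" "\<forall>p\<in>W. X' p = X p \<and> Y' p = Y p" "p \<in> W" for X' Y' p
  proof -
    have "D X' Y' p = D X Y p" by (rule conn_cong[OF D W X Y that(1,2)]) (use that in auto)
    then show ?thesis using that(3,4) by (simp add: proj_change_def)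
  qed
  fix p f assume p: "p \<in> W"
  then have pS: "p \<in> S" using W by blast
  note Xp = vfields_tspace[OF X p] and Yp = vfields_tspace[OF Y p]
  show "proj_change D \<Upsilon> (\<lambda>q g. X q g + Z q g) Y p f = proj_change D \<Upsilon> X Y p f + proj_change D \<Upsilon> Z Y p f"
    and "proj_change D \<Upsilon> X (\<lambda>q g. Y q g + Z q g) p f = proj_change D \<Upsilon> X Y p f + proj_change D \<Upsilon> X Z p f"
    if Z: "Z \<in> vfields M W" for Z
  proof -
    note Zp = vfields_tspace[OF Z p]
    show "proj_change D \<Upsilon> (\<lambda>q g. X q g + Z q g) Y p f = proj_change D \<Upsilon> X Y p f + proj_change D \<Upsilon> Z Y p f"
      using one_forms_lin[OF \<Upsilon> pS Xp Zp, of 1 1] conn_add(1)[OF D W X Y Z p]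
      by (simp add: proj_change_def algebra_simps)
    show "proj_change D \<Upsilon> X (\<lambda>q g. Y q g + Z q g) p f = proj_change D \<Upsilon> X Y p f + proj_change D \<Upsilon> X Z p f"
      using one_forms_lin[OF \<Upsilon> pS Yp Zp, of 1 1] conn_add(2)[OF D W X Y Z p]
      by (simp add: proj_change_def algebra_simps)
  qed
  show "proj_change D \<Upsilon> (\<lambda>q g. h q * X q g) Y p f = h p * proj_change D \<Upsilon> X Y p f"
    and "proj_change D \<Upsilon> X (\<lambda>q g. h q * Y q g) p f = X p h * Y p f + h p * proj_change D \<Upsilon> X Y p f"
    if h: "h \<in> smooth_funs M W" for h
    using one_forms_lin[OF \<Upsilon> pS Xp Xp, of "h p" 0] conn_scale(1)[OF D W X Y h p]
      one_forms_lin[OF \<Upsilon> pS Yp Yp, of "h p" 0] conn_scale(2)[OF D W X Y h p]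
    by (simp_all add: proj_change_def algebra_simps)
qed

lemma torsion_free_proj_change: "torsion_free M S D \<Longrightarrow> torsion_free M S (proj_change D \<Upsilon>)"
  unfolding torsion_free_def proj_change_def by simp

text \<open>The \<open>j\<close>-th column consists of the components of \<open>e j\<close> in the frame dual to \<open>y\<close>.\<close>

definition frame_mat :: "('n \<Rightarrow> 'm \<Rightarrow> real) \<Rightarrow> ('n \<Rightarrow> 'm tvec) \<Rightarrow> real ^ 'n ^ 'n" where
  "frame_mat y e = (\<chi> i j. e j (y i))"

lemma tspace_eqI:
  assumes cf: "coord_frame M V y E" and p: "p \<in> V" and v: "v \<in> tspace M p" and w: "w \<in> tspace M p"
    and eq: "\<And>i. v (y i) = w (y i)"
  shows "v = w"
proof
  fix f
  have "v f = (\<Sum>i\<in>UNIV. v (y i) * E i p f)" by (rule coord_frameD(5)[OF cf p v])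
  also have "\<dots> = (\<Sum>i\<in>UNIV. w (y i) * E i p f)" by (simp only: eq)
  also have "\<dots> = w f" by (rule coord_frameD(5)[OF cf p w, symmetric])
  finally show "v f = w f" .
qed

lemma frame_combination_iff:
  assumes cf: "coord_frame M V y E" and p: "p \<in> V" and v: "v \<in> tspace M p" and e: "\<And>j. e j \<in> tspace M p"
  shows "v = (\<lambda>f. \<Sum>j\<in>UNIV. c $ j * e j f) \<longleftrightarrow> (\<chi> i. v (y i)) = frame_mat y e *v c"
proof
  assume "v = (\<lambda>f. \<Sum>j\<in>UNIV. c $ j * e j f)"
  then have "v (y i) = (\<Sum>j\<in>UNIV. e j (y i) * c $ j)" for i by (simp add: mult.commute)
  then show "(\<chi> i. v (y i)) = frame_mat y e *v c"
    by (simp add: vec_eq_iff frame_mat_def matrix_vector_mult_def)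
next
  assume eq: "(\<chi> i. v (y i)) = frame_mat y e *v c"
  let ?w = "\<lambda>f. \<Sum>j\<in>UNIV. c $ j * e j f"
  have w: "?w \<in> tspace M p" by (rule tspace_sum_mem[OF tspace_topspace[OF v] e])
  have "v (y i) = ?w (y i)" for i
    using eq by (simp add: vec_eq_iff frame_mat_def matrix_vector_mult_def mult.commute)
  then show "v = ?w" by (rule tspace_eqI[OF cf p v w])
qed

text \<open>A tuple is a frame if and only if the linear system for the coefficients of every tangent vector has
  a unique solution.\<close>

lemma frame_at_iff:
  assumes cf: "coord_frame M V y E" and p: "p \<in> V"
  shows "frame_at M p e \<longleftrightarrow> (\<forall>j. e j \<in> tspace M p) \<and> invertible (frame_mat y e)"
proof (cases "\<forall>j. e j \<in> tspace M p")
  case True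
  let ?A = "frame_mat y e"
  have tp: "p \<in> topspace (mtop M)" using openin_subset[OF coord_frameD(1)[OF cf]] p by blast
  have "frame_at M p e \<longleftrightarrow> (\<forall>v\<in>tspace M p. \<exists>!c. (\<chi> i. v (y i)) = ?A *v c)"
    using True frame_combination_iff[OF cf p, of _ e] unfolding frame_at_def by auto
  also have "\<dots> \<longleftrightarrow> (\<forall>b. \<exists>!c. b = ?A *v c)"
  proof (intro iffI allI ballI)
    fix b :: "real ^ 'n" assume *: "\<forall>v\<in>tspace M p. \<exists>!c. (\<chi> i. v (y i)) = ?A *v c"
    let ?v = "\<lambda>f. \<Sum>j\<in>UNIV. b $ j * E j p f"
    have v: "?v \<in> tspace M p" by (rule tspace_sum_mem[OF tp vfields_tspace[OF coord_frameD(3)[OF cf] p]])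
    have "?v (y i) = b $ i" for i
    proof -
      have "?v (y i) = (\<Sum>j\<in>UNIV. if j = i then b $ j else 0)"
        by (intro sum.cong) (auto simp: coord_frameD(4)[OF cf p])
      then show ?thesis by simp
    qed
    then have b: "(\<chi> i. ?v (y i)) = b" by (simp add: vec_eq_iff)
    show "\<exists>!c. b = ?A *v c" using bspec[OF * v] unfolding b .
  qed blast
  also have "\<dots> \<longleftrightarrow> bij ((*v) ?A)" by (simp add: bij_iff eq_commute)
  also have "\<dots> \<longleftrightarrow> invertible ?A" by (simp add: invertible_eq_bij)
  finally show ?thesis using True by simp
next
  case False
  then show ?thesis by (auto simp: frame_at_def)
qed

lemma frame_mat_self:
  "coord_frame M V y E \<Longrightarrow> p \<in> V \<Longrightarrow> frame_mat y (\<lambda>i. E i p) = mat 1"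
  by (auto simp: vec_eq_iff frame_mat_def mat_def coord_frameD(4))

lemma coord_frame_frame_at:
  assumes "coord_frame M V y E" "p \<in> V"
  shows "frame_at M p (\<lambda>i. E i p)"
  unfolding frame_at_iff[OF assms] frame_mat_self[OF assms]
  using vfields_tspace[OF coord_frameD(3)[OF assms(1)] assms(2)] by (simp add: invertible_def)

lemma coord_frame_local_frame: "coord_frame M V y E \<Longrightarrow> local_frame M V E"
  unfolding local_frame_def using coord_frameD(3) coord_frame_frame_at by blast

lemma frame_mat_change:
  "frame_mat y (\<lambda>j f. \<Sum>i\<in>UNIV. A $ i $ j * e i f) = frame_mat y e ** A"
  by (simp add: vec_eq_iff frame_mat_def matrix_matrix_mult_def mult.commute)

lemma density_at_coord_frame:
  assumes cf: "coord_frame M V y E" and p: "p \<in> V" and \<delta>: "\<delta> \<in> density_at M s p"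
  shows "\<delta> e = (if frame_at M p e then \<bar>det (frame_mat y e)\<bar> powr s * \<delta> (\<lambda>i. E i p) else 0)"
proof (cases "frame_at M p e")
  case True
  then have e: "\<And>j. e j \<in> tspace M p" "invertible (frame_mat y e)" using frame_at_iff[OF cf p] by blast+
  have "e j = (\<lambda>f. \<Sum>i\<in>UNIV. frame_mat y e $ i $ j * E i p f)" for j
    unfolding frame_mat_def vec_lambda_beta by (rule ext, rule coord_frameD(5)[OF cf p e(1)])
  then have eq: "e = (\<lambda>j f. \<Sum>i\<in>UNIV. frame_mat y e $ i $ j * E i p f)" by (rule ext)
  have "\<delta> (\<lambda>j f. \<Sum>i\<in>UNIV. frame_mat y e $ i $ j * E i p f) = \<bar>det (frame_mat y e)\<bar> powr s * \<delta> (\<lambda>i. E i p)"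
    using \<delta> e(2) coord_frame_frame_at[OF cf p] unfolding density_at_def by blast
  then have "\<delta> e = \<bar>det (frame_mat y e)\<bar> powr s * \<delta> (\<lambda>i. E i p)" by (subst eq)
  then show ?thesis using True by simp
next
  case False
  then show ?thesis using \<delta> by (simp add: density_at_def)
qed

lemma density_at_eqI:
  assumes "coord_frame M V y E" "p \<in> V" "\<delta> \<in> density_at M s p" "\<delta>' \<in> density_at M s p"
    "\<delta> (\<lambda>i. E i p) = \<delta>' (\<lambda>i. E i p)"
  shows "\<delta> = \<delta>'"
proof
  fix e
  show "\<delta> e = \<delta>' e"
    by (subst density_at_coord_frame[OF assms(1-3)], subst density_at_coord_frame[OF assms(1,2,4)]) (simp add: assms(5))
qed

lemma density_sections_at: "\<tau> \<in> density_sections M s W \<Longrightarrow> p \<in> W \<Longrightarrow> \<tau> p \<in> density_at M s p"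
  unfolding density_sections_def by blast

lemma density_sections_smooth:
  assumes "\<tau> \<in> density_sections M s W" "coord_frame M V y E" "V \<subseteq> W"
  shows "(\<lambda>p. \<tau> p (\<lambda>i. E i p)) \<in> smooth_funs M V"
  using assms(1,3) coord_frame_local_frame[OF assms(2)] coord_frameD(1)[OF assms(2)]
  by (simp add: density_sections_def)

lemma density_sections_subset:
  "\<tau> \<in> density_sections M s W \<Longrightarrow> openin (mtop M) V \<Longrightarrow> V \<subseteq> W \<Longrightarrow> \<tau> \<in> density_sections M s V"
  unfolding density_sections_def by (simp add: subset_eq)

lemma density_sections_scale:
  assumes \<tau>: "\<tau> \<in> density_sections M s W" and f: "f \<in> smooth_funs M W"
  shows "(\<lambda>p e. f p * \<tau> p e) \<in> density_sections M s W"
proof -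
  have "(\<lambda>e. f p * \<tau> p e) \<in> density_at M s p" if "p \<in> W" for p
    using density_sections_at[OF \<tau> that] unfolding density_at_def by simp
  moreover have "(\<lambda>p. f p * \<tau> p (\<lambda>i. e i p)) \<in> smooth_funs M V"
    if V: "V \<subseteq> W" "openin (mtop M) V" "local_frame M V e" for V e
    by (intro smooth_funs_mult smooth_funs_subset[OF f V(2,1)])
      (use \<tau> V in \<open>auto simp: density_sections_def\<close>)
  ultimately show ?thesis using smooth_funs_openin[OF f] by (simp add: density_sections_def)
qed

text \<open>The density of order \<open>s\<close> that takes the value \<open>g p\<close> on the frame dual to \<open>y\<close>.\<close>

definition frame_density :: "real \<Rightarrow> ('n \<Rightarrow> 'm \<Rightarrow> real) \<Rightarrow> ('m \<Rightarrow> real) \<Rightarrow> 'm \<Rightarrow> ('m, 'n) dens" where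
  "frame_density s y g p e = (if frame_at M p e then \<bar>det (frame_mat y e)\<bar> powr s * g p else 0)"

lemma frame_density_sections:
  assumes cf: "coord_frame M V y E" and g: "g \<in> smooth_funs M V"
  shows "frame_density s y g \<in> density_sections M s V"
proof -
  have "frame_density s y g p \<in> density_at M s p" if p: "p \<in> V" for p
  proof -
    have "frame_density s y g p (\<lambda>j f. \<Sum>i\<in>UNIV. A $ i $ j * e i f) = \<bar>det A\<bar> powr s * frame_density s y g p e"
      if e: "frame_at M p e" and A: "invertible A" for e and A :: "real ^ 'n ^ 'n"
    proof -
      let ?e = "\<lambda>j f. \<Sum>i\<in>UNIV. A $ i $ j * e i f"
      have e': "\<And>j. e j \<in> tspace M p" "invertible (frame_mat y e)" using frame_at_iff[OF cf p] e by blast+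
      have "?e j \<in> tspace M p" for j by (rule tspace_sum_mem[OF tspace_topspace e'(1)]) (rule e'(1))
      moreover have "invertible (frame_mat y ?e)" unfolding frame_mat_change by (rule invertible_mult[OF e'(2) A])
      ultimately have "frame_at M p ?e" using frame_at_iff[OF cf p] by blast
      then show ?thesis using e unfolding frame_density_def frame_mat_change
        by (simp add: det_mul abs_mult powr_mult)
    qed
    then show ?thesis unfolding density_at_def by (auto simp: frame_density_def[of s y g p])
  qed
  moreover have "(\<lambda>p. frame_density s y g p (\<lambda>i. e i p)) \<in> smooth_funs M V'"
    if V': "V' \<subseteq> V" "openin (mtop M) V'" "local_frame M V' e" for V' e
  proof -
    have e: "e i \<in> vfields M V'" "p \<in> V' \<Longrightarrow> frame_at M p (\<lambda>i. e i p)" for i p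
      using V'(3) unfolding local_frame_def by blast+
    have d: "(\<lambda>p. det (frame_mat y (\<lambda>i. e i p))) \<in> smooth_funs M V'"
      by (rule smooth_funs_det[OF V'(2)])
        (simp add: frame_mat_def vfields_smooth[OF e(1) subset_refl smooth_funs_subset[OF coord_frameD(2)[OF cf] V'(2,1)]])
    have nz: "det (frame_mat y (\<lambda>i. e i p)) \<noteq> 0" if "p \<in> V'" for p
      using frame_at_iff[OF cf, of p "\<lambda>i. e i p"] e(2)[OF that] that V'(1) invertible_det_nz by blast
    have "(\<lambda>p. \<bar>det (frame_mat y (\<lambda>i. e i p))\<bar> powr s) \<in> smooth_funs M V'"
      by (rule smooth_funs_compose[OF d _ Cinf_on_abs_powr[of s]]) (use nz in \<open>auto simp: open_Collect_neq\<close>)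
    then have "(\<lambda>p. \<bar>det (frame_mat y (\<lambda>i. e i p))\<bar> powr s * g p) \<in> smooth_funs M V'"
      by (rule smooth_funs_mult[OF _ smooth_funs_subset[OF g V'(2,1)]])
    then show ?thesis by (rule smooth_funs_cong) (use e(2) in \<open>simp add: frame_density_def\<close>)
  qed
  ultimately show ?thesis using coord_frameD(1)[OF cf] by (simp add: density_sections_def)
qed

lemma frame_density_frame:
  "coord_frame M V y E \<Longrightarrow> p \<in> V \<Longrightarrow> frame_density s y g p (\<lambda>i. E i p) = g p"
  using coord_frame_frame_at frame_mat_self by (simp add: frame_density_def)

lemma conn_coord_frame:
  assumes D: "linear_connection M W D" and X: "X \<in> vfields M W" and cf: "coord_frame M V y E" "V \<subseteq> W" and p: "p \<in> V"
  shows "D X (E j) p = (\<lambda>f. \<Sum>i\<in>UNIV. (\<chi> i j. D X (E j) p (y i)) $ i $ j * E i p f)"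
proof -
  have "D X (E j) \<in> vfields M V"
    by (rule conn_vfields[OF D cf(2) vfields_subset[OF X coord_frameD(1)[OF cf(1)] cf(2)] coord_frameD(3)[OF cf(1)]])
  from coord_frameD(5)[OF cf(1) p vfields_tspace[OF this p]]
  show ?thesis unfolding vec_lambda_beta by (rule ext)
qed

text \<open>The defining formula determines the value on one frame at \<open>p\<close>, and a density is determined by that.\<close>

lemma density_deriv_unique:
  assumes D: "linear_connection M W D" and X: "X \<in> vfields M W"
    and d: "density_deriv M D s W X \<tau> \<tau>'" "density_deriv M D s W X \<upsilon> \<upsilon>'"
    and eq: "\<And>p. p \<in> W \<Longrightarrow> \<tau> p = \<upsilon> p" and p: "p \<in> W"
    and fr: "\<And>N. openin (mtop M) N \<Longrightarrow> p \<in> N \<Longrightarrow> \<exists>V y E. p \<in> V \<and> V \<subseteq> N \<and> coord_frame M V y E"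
  shows "\<tau>' p = \<upsilon>' p"
proof -
  obtain V y E where V: "p \<in> V" "V \<subseteq> W" "coord_frame M V y E" using fr[OF conn_openin[OF D] p] by blast
  let ?c = "\<chi> i j. D X (E j) p (y i)"
  note c = conn_coord_frame[OF D X V(3,2,1)]
  have 1: "\<tau>' p (\<lambda>i. E i p) = X p (\<lambda>q. \<tau> q (\<lambda>i. E i q)) - s * trace ?c * \<tau> p (\<lambda>i. E i p)"
    using d(1) V c coord_frameD(1)[OF V(3)] coord_frame_local_frame[OF V(3)] unfolding density_deriv_def by blast
  have 2: "\<upsilon>' p (\<lambda>i. E i p) = X p (\<lambda>q. \<upsilon> q (\<lambda>i. E i q)) - s * trace ?c * \<upsilon> p (\<lambda>i. E i p)"
    using d(2) V c coord_frameD(1)[OF V(3)] coord_frame_local_frame[OF V(3)] unfolding density_deriv_def by blast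
  have "X p (\<lambda>q. \<tau> q (\<lambda>i. E i q)) = X p (\<lambda>q. \<upsilon> q (\<lambda>i. E i q))"
    by (rule tspace_cong[OF vfields_tspace[OF X p] coord_frameD(1)[OF V(3)] V(1)]) (use eq V(2) in auto)
  then have "\<tau>' p (\<lambda>i. E i p) = \<upsilon>' p (\<lambda>i. E i p)" using 1 2 eq[OF p] by simp
  moreover have "\<tau>' \<in> density_sections M s W" "\<upsilon>' \<in> density_sections M s W"
    using d unfolding density_deriv_def by simp_all
  ultimately show ?thesis by (intro density_at_eqI[OF V(3,1)] density_sections_at[OF _ p])
qed

end

section \<open>Projectively pre-compact connections and the second fundamental form\<close>

lemma (in smooth_mfd) density_sections_cong:
  assumes "\<tau> \<in> density_sections M s W" "\<And>p. p \<in> W \<Longrightarrow> \<upsilon> p = \<tau> p"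
  shows "\<upsilon> \<in> density_sections M s W"
proof -
  have "(\<lambda>p. \<upsilon> p (\<lambda>i. e i p)) \<in> smooth_funs M V"
    if V: "V \<subseteq> W" "openin (mtop M) V" "local_frame M V e" for V e
  proof -
    have "(\<lambda>p. \<tau> p (\<lambda>i. e i p)) \<in> smooth_funs M V" using assms(1) V by (simp add: density_sections_def)
    then show ?thesis by (rule smooth_funs_cong) (use assms(2) V(1) in auto)
  qed
  then show ?thesis using assms by (simp add: density_sections_def)
qed

locale precompact_mfd = bdry_manifold M k for M :: "('m, 'n::finite) mfd" and k :: 'n +
  fixes D :: "'m conn"
  assumes D: "linear_connection M (intr k M) D"
    and tf: "torsion_free M (intr k M) D"
    and pc: "proj_precompact k M D"
begin

abbreviation projective_conn :: "('m \<Rightarrow> real) \<Rightarrow> 'm conn" ("\<nabla>") where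
  "\<nabla> \<equiv> nabla_rho D"

lemma one_form_dlog_defining:
  assumes \<rho>: "local_defining k M U \<rho>"
  shows "(\<lambda>p v. v \<rho> / \<rho> p) \<in> one_forms M (U \<inter> intr k M)"
proof (rule one_form_dlog)
  show "\<rho> \<in> smooth_funs M (U \<inter> intr k M)"
    by (rule smooth_funs_subset[OF local_defining_smooth[OF \<rho>]])
      (use local_defining_openin[OF \<rho>] openin_intr in auto)
qed (use local_defining_intr[OF \<rho>] in blast)

lemma nabla_connection:
  assumes \<rho>: "local_defining k M U \<rho>"
  shows "linear_connection M (U \<inter> intr k M) (\<nabla> \<rho>)"
  unfolding nabla_rho_def
  by (rule linear_connection_proj_change[OF conn_subset[OF D] one_form_dlog_defining[OF \<rho>]])
    (use local_defining_openin[OF \<rho>] openin_intr in auto)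

lemma nabla_torsion_free: "torsion_free M (U \<inter> intr k M) (\<nabla> \<rho>)"
proof -
  have "torsion_free M (intr k M) (\<nabla> \<rho>)"
    unfolding nabla_rho_def by (rule torsion_free_proj_change[OF tf])
  then show ?thesis unfolding torsion_free_def by blast
qed

lemma nabla_conormal_extends:
  assumes "local_defining k M V \<rho>" "\<xi> \<in> vfields M V" "\<eta> \<in> vfields M V"
  shows "\<exists>h\<in>smooth_funs M V. \<forall>p\<in>V \<inter> intr k M. h p = \<nabla> \<rho> \<xi> \<eta> p \<rho>"
  using pc assms unfolding proj_precompact_def by blast

lemma nabla_tan_extends:
  assumes "local_defining k M V \<rho>" "\<xi> \<in> vfields M V" "\<eta> \<in> vfields M V"
    "\<xi> \<in> vfields_tan k M V \<or> \<eta> \<in> vfields_tan k M V"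
  shows "\<exists>\<zeta>\<in>vfields M V. \<forall>p\<in>V \<inter> intr k M. \<zeta> p = \<nabla> \<rho> \<xi> \<eta> p"
  using pc assms unfolding proj_precompact_def by blast

lemma vfields_tan_iff:
  assumes "local_defining k M V \<rho>"
  shows "X \<in> vfields_tan k M V \<longleftrightarrow> X \<in> vfields M V \<and> (\<forall>p\<in>V \<inter> bdry k M. X p \<rho> = 0)"
  unfolding vfields_tan_def
  using bdry_tspaceI[OF assms] bdry_tspace_defining[OF assms] vfields_tspace by auto

lemma vfields_tan_subset:
  "X \<in> vfields_tan k M W \<Longrightarrow> openin (mtop M) V \<Longrightarrow> V \<subseteq> W \<Longrightarrow> X \<in> vfields_tan k M V"
  unfolding vfields_tan_def using vfields_subset by auto

lemma adapted_frame_tan: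
  assumes "local_defining k M V \<rho>" "coord_frame M V y E" "y k = \<rho>" "i \<noteq> k"
  shows "E i \<in> vfields_tan k M V"
  using coord_frameD(3)[OF assms(2)] coord_frameD(4)[OF assms(2), of _ i k] assms(3,4)
  by (simp add: vfields_tan_iff[OF assms(1)])

text \<open>All diagonal entries of the connection matrix in an adapted frame are smooth up to the
  boundary: the \<open>k\<close>-th one by condition (i), the others by condition (iii).  So the trace is.\<close>

lemma nabla_trace_extends:
  assumes \<rho>: "local_defining k M V \<rho>" and cf: "coord_frame M V y E" "y k = \<rho>" and X: "X \<in> vfields M V"
  shows "\<exists>\<theta>\<in>smooth_funs M V. \<forall>p\<in>V \<inter> intr k M. \<theta> p = (\<Sum>j\<in>UNIV. \<nabla> \<rho> X (E j) p (y j))"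
proof -
  have "\<exists>t\<in>smooth_funs M V. \<forall>p\<in>V \<inter> intr k M. t p = \<nabla> \<rho> X (E j) p (y j)" for j
  proof (cases "j = k")
    case True
    then show ?thesis using nabla_conormal_extends[OF \<rho> X coord_frameD(3)[OF cf(1)]] cf(2) by simp
  next
    case False
    then obtain \<zeta> where \<zeta>: "\<zeta> \<in> vfields M V" "\<forall>p\<in>V \<inter> intr k M. \<zeta> p = \<nabla> \<rho> X (E j) p"
      using nabla_tan_extends[OF \<rho> X coord_frameD(3)[OF cf(1)]] adapted_frame_tan[OF \<rho> cf] by blast
    then show ?thesis using vfields_smooth[OF \<zeta>(1) subset_refl coord_frameD(2)[OF cf(1)], of j]
      by (intro bexI[of _ "\<lambda>p. \<zeta> p (y j)"]) simp_all
  qed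
  then obtain t where t: "\<And>j. t j \<in> smooth_funs M V" "\<And>j. \<forall>p\<in>V \<inter> intr k M. t j p = \<nabla> \<rho> X (E j) p (y j)"
    by metis
  show ?thesis
    by (rule bexI[of _ "\<lambda>p. \<Sum>j\<in>UNIV. t j p"])
      (use t(2) smooth_funs_sum[OF coord_frameD(1)[OF cf(1)] t(1)] in auto)
qed

lemma nabla_expand:
  assumes \<rho>: "local_defining k M U \<rho>" and cf: "coord_frame M V y E" "y k = \<rho>"
    and W: "W \<subseteq> V" "W \<subseteq> U \<inter> intr k M" and \<xi>: "\<xi> \<in> vfields M W" and \<eta>: "\<eta> \<in> vfields M W" and q: "q \<in> W"
  shows "\<nabla> \<rho> \<xi> \<eta> q f = (\<Sum>j\<in>UNIV. \<xi> q (\<lambda>r. \<eta> r (y j)) * E j q f + \<eta> q (y j) * \<nabla> \<rho> \<xi> (E j) q f)"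
    and "\<nabla> \<rho> \<xi> \<eta> q f = (\<Sum>i\<in>UNIV. \<xi> q (y i) * \<nabla> \<rho> (E i) \<eta> q f)"
proof -
  note N = nabla_connection[OF \<rho>] and oW = vfields_openin[OF \<xi>]
  have cfW: "coord_frame M W y E" by (rule coord_frame_subset[OF cf(1) oW W(1)])
  note E = coord_frameD(3)[OF cfW] and y = coord_frameD(2)[OF cfW]
  have exp: "X r = (\<lambda>g. \<Sum>i\<in>UNIV. X r (y i) * E i r g)" if "X \<in> vfields M W" "r \<in> W" for X r
    by (rule ext, rule coord_frameD(5)[OF cfW that(2) vfields_tspace[OF that]])
  have mem: "(\<lambda>r g. \<Sum>i\<in>UNIV. X r (y i) * E i r g) \<in> vfields M W" if "X \<in> vfields M W" for X
    by (rule vfields_sum[OF oW E vfields_smooth[OF that subset_refl y]])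
  have "\<nabla> \<rho> \<xi> \<eta> q = \<nabla> \<rho> \<xi> (\<lambda>r g. \<Sum>i\<in>UNIV. \<eta> r (y i) * E i r g) q"
    by (rule conn_cong[OF N W(2) \<xi> mem[OF \<eta>] \<xi> \<eta> refl exp[OF \<eta>] q])
  then show "\<nabla> \<rho> \<xi> \<eta> q f = (\<Sum>j\<in>UNIV. \<xi> q (\<lambda>r. \<eta> r (y j)) * E j q f + \<eta> q (y j) * \<nabla> \<rho> \<xi> (E j) q f)"
    using conn_sum2[OF N W(2) \<xi> q finite E vfields_smooth[OF \<eta> subset_refl y]] by simp
  have "\<nabla> \<rho> \<xi> \<eta> q = \<nabla> \<rho> (\<lambda>r g. \<Sum>i\<in>UNIV. \<xi> r (y i) * E i r g) \<eta> q"
    by (rule conn_cong[OF N W(2) mem[OF \<xi>] \<eta> \<xi> \<eta> exp[OF \<xi>] refl q])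
  then show "\<nabla> \<rho> \<xi> \<eta> q f = (\<Sum>i\<in>UNIV. \<xi> q (y i) * \<nabla> \<rho> (E i) \<eta> q f)"
    using conn_sum1[OF N W(2) \<eta> q finite E vfields_smooth[OF \<xi> subset_refl y]] by simp
qed

text \<open>Derivatives of the components of \<open>\<eta>\<close> enter only through \<open>\<xi> (\<eta> \<rho>)\<close>, because \<open>\<rho>\<close> is constant along \<open>E j\<close>
  for \<open>j \<noteq> k\<close> and has derivative 1 along \<open>E k\<close>.  So \<open>\<xi> (\<eta> \<rho>) - d\<rho> (\<nabla>\<^sub>\<xi> \<eta>)\<close> is tensorial.\<close>

lemma nabla_conormal_expand:
  assumes \<rho>: "local_defining k M U \<rho>" and cf: "coord_frame M V y E" "y k = \<rho>"
    and W: "W \<subseteq> V" "W \<subseteq> U \<inter> intr k M" and \<xi>: "\<xi> \<in> vfields M W" and \<eta>: "\<eta> \<in> vfields M W" and q: "q \<in> W"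
  shows "\<nabla> \<rho> \<xi> \<eta> q \<rho> = \<xi> q (\<lambda>r. \<eta> r \<rho>) + (\<Sum>i\<in>UNIV. \<Sum>j\<in>UNIV. \<xi> q (y i) * \<eta> q (y j) * \<nabla> \<rho> (E i) (E j) q \<rho>)"
proof -
  have qV: "q \<in> V" using q W by blast
  have E: "E j \<in> vfields M W" for j
    by (rule vfields_subset[OF coord_frameD(3)[OF cf(1)] vfields_openin[OF \<xi>] W(1)])
  have "\<nabla> \<rho> \<xi> \<eta> q \<rho> = (\<Sum>j\<in>UNIV. \<xi> q (\<lambda>r. \<eta> r (y j)) * E j q \<rho>) + (\<Sum>j\<in>UNIV. \<eta> q (y j) * \<nabla> \<rho> \<xi> (E j) q \<rho>)"
    by (simp add: nabla_expand(1)[OF \<rho> cf W \<xi> \<eta> q] sum.distrib)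
  also have "(\<Sum>j\<in>UNIV. \<xi> q (\<lambda>r. \<eta> r (y j)) * E j q \<rho>) = (\<Sum>j\<in>UNIV. if j = k then \<xi> q (\<lambda>r. \<eta> r (y j)) else 0)"
    using coord_frameD(4)[OF cf(1) qV, of _ k] cf(2) by (intro sum.cong) auto
  also have "\<dots> = \<xi> q (\<lambda>r. \<eta> r \<rho>)" using cf(2) by simp
  also have "(\<Sum>j\<in>UNIV. \<eta> q (y j) * \<nabla> \<rho> \<xi> (E j) q \<rho>)
      = (\<Sum>j\<in>UNIV. \<Sum>i\<in>UNIV. \<xi> q (y i) * \<eta> q (y j) * \<nabla> \<rho> (E i) (E j) q \<rho>)"
    by (intro sum.cong refl, subst nabla_expand(2)[OF \<rho> cf W \<xi> E q]) (simp add: sum_distrib_left mult_ac)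
  also have "\<dots> = (\<Sum>i\<in>UNIV. \<Sum>j\<in>UNIV. \<xi> q (y i) * \<eta> q (y j) * \<nabla> \<rho> (E i) (E j) q \<rho>)"
    by (rule sum.swap)
  finally show ?thesis .
qed

end

locale parallel_precompact_mfd = precompact_mfd M k D for M :: "('m, 'n::finite) mfd" and k :: 'n and D +
  fixes \<sigma> :: "'m \<Rightarrow> ('m, 'n) dens"
  assumes par: "parallel_density M (intr k M) D (weight1 TYPE('n)) \<sigma>"
    and nv: "nowhere_vanishing M (intr k M) \<sigma>"
begin

lemma \<sigma>_section: "\<sigma> \<in> density_sections M (weight1 TYPE('n)) (intr k M)"
  using par unfolding parallel_density_def by blast

text \<open>The weight is chosen so that \<open>\<nabla>\<^sup>\<rho> \<sigma> = (d\<rho> / \<rho>) \<sigma>\<close>: the projective change adds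
  \<open>(n + 1) \<Upsilon>\<close> to the trace of the connection matrix, \<open>n\<close> being the dimension.\<close>

lemma density_deriv_nabla:
  assumes \<rho>: "local_defining k M U \<rho>" and W: "W \<subseteq> U \<inter> intr k M" and X: "X \<in> vfields M W"
    and f: "f \<in> smooth_funs M W"
    and \<tau>: "\<And>q. q \<in> W \<Longrightarrow> \<tau> q = (\<lambda>e. f q * \<sigma> q e)"
    and \<tau>': "\<And>q. q \<in> W \<Longrightarrow> \<tau>' q = (\<lambda>e. (X q f + f q * (X q \<rho> / \<rho> q)) * \<sigma> q e)"
  shows "density_deriv M (\<nabla> \<rho>) (weight1 TYPE('n)) W X \<tau> \<tau>'"
  unfolding density_deriv_def
proof (intro conjI allI impI; (elim conjE)?)
  note oW = vfields_openin[OF X]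
  have \<sigma>W: "\<sigma> \<in> density_sections M (weight1 TYPE('n)) W" using density_sections_subset[OF \<sigma>_section oW] W by blast
  have \<rho>W: "\<rho> \<in> smooth_funs M W" using smooth_funs_subset[OF local_defining_smooth[OF \<rho>] oW] W by blast
  have nz: "\<rho> q \<noteq> 0" if "q \<in> W" for q using local_defining_intr[OF \<rho>] W that by blast
  show "\<tau>' \<in> density_sections M (weight1 TYPE('n)) W"
    by (rule density_sections_cong[OF density_sections_scale[OF \<sigma>W] \<tau>'])
      (intro smooth_funs_add smooth_funs_mult smooth_funs_divide vfields_smooth[OF X] f \<rho>W nz subset_refl)
  fix V e p and c :: "real ^ 'n ^ 'n"
  assume V: "V \<subseteq> W" "openin (mtop M) V" "local_frame M V e" "p \<in> V"
    and c: "\<forall>j. \<nabla> \<rho> X (e j) p = (\<lambda>f. \<Sum>i\<in>UNIV. c $ i $ j * e i p f)"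
  have pW: "p \<in> W" using V by blast
  note Xp = vfields_tspace[OF X pW]
  have "frame_at M p (\<lambda>i. e i p)" using V(3,4) unfolding local_frame_def by blast
  then obtain a :: "real ^ 'n" where a: "X p = (\<lambda>f. \<Sum>i\<in>UNIV. a $ i * e i p f)"
    using Xp unfolding frame_at_def by blast
  define u where "u = X p \<rho> / \<rho> p"
  define u' where "u' j = e j p \<rho> / \<rho> p" for j
  define c' where "c' = (\<chi> i j. c $ i $ j - (if i = j then u else 0) - u' j * a $ i)"
  have "D X (e j) p f = (\<Sum>i\<in>UNIV. c' $ i $ j * e i p f)" for j f
  proof -
    have "D X (e j) p f = \<nabla> \<rho> X (e j) p f - u * e j p f - u' j * X p f"
      by (simp add: nabla_rho_def proj_change_def u_def u'_def)
    also have "\<nabla> \<rho> X (e j) p f = (\<Sum>i\<in>UNIV. c $ i $ j * e i p f)" by (simp add: c)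
    also have "u * e j p f = (\<Sum>i\<in>UNIV. (if i = j then u else 0) * e i p f)"
      by (simp add: if_distrib[where f="\<lambda>x. x * _"] cong: if_cong)
    also have "u' j * X p f = (\<Sum>i\<in>UNIV. u' j * a $ i * e i p f)"
      by (subst a) (simp add: sum_distrib_left mult.assoc)
    finally show ?thesis by (simp add: c'_def left_diff_distrib sum_subtractf)
  qed
  then have c'_eq: "\<forall>j. D X (e j) p = (\<lambda>f. \<Sum>i\<in>UNIV. c' $ i $ j * e i p f)" by blast
  have "(\<Sum>i\<in>UNIV. u' i * a $ i) = u"
    unfolding u_def u'_def by (subst a) (simp add: sum_divide_distrib mult.commute)
  then have tr: "trace c' = trace c - (real CARD('n) + 1) * u"
    by (simp add: trace_def c'_def sum_subtractf sum.distrib algebra_simps)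
  have "density_deriv M D (weight1 TYPE('n)) W X \<sigma> (\<lambda>_ _. 0)"
    using par X W unfolding parallel_density_def by blast
  then have "0 = X p (\<lambda>q. \<sigma> q (\<lambda>i. e i q)) - (weight1 TYPE('n)) * trace c' * \<sigma> p (\<lambda>i. e i p)"
    using V c'_eq unfolding density_deriv_def by blast
  moreover have "(weight1 TYPE('n)) * trace c' = (weight1 TYPE('n)) * trace c + u"
    unfolding tr by (simp add: weight1_def field_simps)
  ultimately have X\<sigma>: "X p (\<lambda>q. \<sigma> q (\<lambda>i. e i q)) = ((weight1 TYPE('n)) * trace c + u) * \<sigma> p (\<lambda>i. e i p)" by simp
  have s: "(\<lambda>q. \<sigma> q (\<lambda>i. e i q)) \<in> smooth_funs M V" using \<sigma>W V unfolding density_sections_def by blast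
  have "X p (\<lambda>q. \<tau> q (\<lambda>i. e i q)) = X p (\<lambda>q. f q * \<sigma> q (\<lambda>i. e i q))"
    by (rule tspace_cong[OF Xp V(2,4)]) (use \<tau> V(1) in auto)
  also have "\<dots> = f p * X p (\<lambda>q. \<sigma> q (\<lambda>i. e i q)) + \<sigma> p (\<lambda>i. e i p) * X p f"
    by (rule tspace_mult[OF Xp smooth_atI[OF f pW] smooth_atI[OF s V(4)]])
  finally show "\<tau>' p (\<lambda>i. e i p) = X p (\<lambda>q. \<tau> q (\<lambda>i. e i q)) - (weight1 TYPE('n)) * trace c * \<tau> p (\<lambda>i. e i p)"
    using \<tau>[OF pW] \<tau>'[OF pW] X\<sigma> by (simp add: u_def algebra_simps)
qed

text \<open>Differentiate \<open>\<nabla>\<^sup>\<rho> \<sigma> = (d\<rho> / \<rho>) \<sigma>\<close> once more: the two terms with the product of \<open>\<xi> \<rho>\<close> and \<open>\<eta> \<rho>\<close> cancel,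
  and a multiple of \<open>\<sigma> / \<rho>\<close> remains.\<close>

lemma density_hessian_iff:
  assumes \<rho>: "local_defining k M U \<rho>" and W: "W \<subseteq> U \<inter> intr k M" and \<xi>: "\<xi> \<in> vfields M W" and \<eta>: "\<eta> \<in> vfields M W"
  shows "density_hessian M (\<nabla> \<rho>) (weight1 TYPE('n)) W \<xi> \<eta> \<sigma> H \<longleftrightarrow>
    (\<forall>p\<in>W. \<forall>e. H p e = (\<xi> p (\<lambda>q. \<eta> q \<rho>) - \<nabla> \<rho> \<xi> \<eta> p \<rho>) / \<rho> p * \<sigma> p e)"
proof -
  note oW = vfields_openin[OF \<xi>]
  have N: "linear_connection M W (\<nabla> \<rho>)" by (rule conn_subset[OF nabla_connection[OF \<rho>] oW W])
  have \<rho>W: "\<rho> \<in> smooth_funs M W" using smooth_funs_subset[OF local_defining_smooth[OF \<rho>] oW] W by blast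
  have nz: "\<rho> q \<noteq> 0" if "q \<in> W" for q using local_defining_intr[OF \<rho>] W that by blast
  define g where "g q = \<eta> q \<rho> / \<rho> q" for q
  have \<eta>\<rho>: "(\<lambda>q. \<eta> q \<rho>) \<in> smooth_funs M W" by (rule vfields_smooth[OF \<eta> subset_refl \<rho>W])
  have g: "g \<in> smooth_funs M W" unfolding g_def by (rule smooth_funs_divide[OF \<eta>\<rho> \<rho>W nz])
  have N\<xi>\<eta>: "\<nabla> \<rho> \<xi> \<eta> \<in> vfields M W" by (rule conn_vfields[OF N subset_refl \<xi> \<eta>])
  let ?t1 = "\<lambda>q e. g q * \<sigma> q e"
  let ?t2 = "\<lambda>q e. \<xi> q (\<lambda>r. \<eta> r \<rho>) / \<rho> q * \<sigma> q e"
  let ?t3 = "\<lambda>q e. \<nabla> \<rho> \<xi> \<eta> q \<rho> / \<rho> q * \<sigma> q e"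
  have d1: "density_deriv M (\<nabla> \<rho>) (weight1 TYPE('n)) W X \<sigma> (\<lambda>q e. X q \<rho> / \<rho> q * \<sigma> q e)" if X: "X \<in> vfields M W" for X
    by (rule density_deriv_nabla[OF \<rho> W X smooth_funs_const[OF oW, of 1]])
      (simp_all add: tspace_const[OF vfields_tspace[OF X]])
  have t1: "density_deriv M (\<nabla> \<rho>) (weight1 TYPE('n)) W \<eta> \<sigma> ?t1" using d1[OF \<eta>] by (simp add: g_def)
  have t3: "density_deriv M (\<nabla> \<rho>) (weight1 TYPE('n)) W (\<nabla> \<rho> \<xi> \<eta>) \<sigma> ?t3" by (rule d1[OF N\<xi>\<eta>])
  have quot: "\<xi> q (\<lambda>r. \<eta> r \<rho>) / \<rho> q = \<xi> q g + g q * (\<xi> q \<rho> / \<rho> q)" if q: "q \<in> W" for q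
  proof -
    note v = vfields_tspace[OF \<xi> q]
    have "\<xi> q (\<lambda>r. \<eta> r \<rho>) = \<xi> q (\<lambda>r. g r * \<rho> r)"
      by (rule tspace_cong[OF v oW q]) (use nz in \<open>simp add: g_def\<close>)
    also have "\<dots> = g q * \<xi> q \<rho> + \<rho> q * \<xi> q g"
      by (rule tspace_mult[OF v smooth_atI[OF g q] smooth_atI[OF \<rho>W q]])
    finally show ?thesis using nz[OF q] by (simp add: field_simps)
  qed
  have t2: "density_deriv M (\<nabla> \<rho>) (weight1 TYPE('n)) W \<xi> ?t1 ?t2"
    by (rule density_deriv_nabla[OF \<rho> W \<xi> g]) (simp_all add: quot)
  note uniq = density_deriv_unique[OF N]
  have fr: "\<exists>V y E. p \<in> V \<and> V \<subseteq> A \<and> coord_frame M V y E" if "openin (mtop M) A" "p \<in> A" for A p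
    using coord_frame_exists[OF that] by metis
  show ?thesis
  proof
    assume "density_hessian M (\<nabla> \<rho>) (weight1 TYPE('n)) W \<xi> \<eta> \<sigma> H"
    then obtain s1 s2 s3 where s: "density_deriv M (\<nabla> \<rho>) (weight1 TYPE('n)) W \<eta> \<sigma> s1"
      "density_deriv M (\<nabla> \<rho>) (weight1 TYPE('n)) W \<xi> s1 s2" "density_deriv M (\<nabla> \<rho>) (weight1 TYPE('n)) W (\<nabla> \<rho> \<xi> \<eta>) \<sigma> s3"
      and H: "\<forall>p\<in>W. \<forall>e. H p e = s2 p e - s3 p e"
      unfolding density_hessian_def by blast
    have e1: "s1 p = ?t1 p" if "p \<in> W" for p by (rule uniq[OF \<eta> s(1) t1 refl that fr])
    have e2: "s2 p = ?t2 p" if "p \<in> W" for p by (rule uniq[OF \<xi> s(2) t2 e1 that fr])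
    have e3: "s3 p = ?t3 p" if "p \<in> W" for p by (rule uniq[OF N\<xi>\<eta> s(3) t3 refl that fr])
    show "\<forall>p\<in>W. \<forall>e. H p e = (\<xi> p (\<lambda>q. \<eta> q \<rho>) - \<nabla> \<rho> \<xi> \<eta> p \<rho>) / \<rho> p * \<sigma> p e"
      using H e2 e3 by (simp add: diff_divide_distrib left_diff_distrib)
  next
    assume H: "\<forall>p\<in>W. \<forall>e. H p e = (\<xi> p (\<lambda>q. \<eta> q \<rho>) - \<nabla> \<rho> \<xi> \<eta> p \<rho>) / \<rho> p * \<sigma> p e"
    show "density_hessian M (\<nabla> \<rho>) (weight1 TYPE('n)) W \<xi> \<eta> \<sigma> H"
      unfolding density_hessian_def
      by (intro exI[of _ ?t1] exI[of _ ?t2] exI[of _ ?t3] conjI t1 t2 t3)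
        (use H in \<open>simp add: diff_divide_distrib left_diff_distrib\<close>)
  qed
qed

text \<open>\<open>\<sigma> / \<rho>\<close> is \<open>\<nabla>\<^sup>\<rho>\<close>-parallel, and the trace of the connection matrix is smooth up to the boundary.
  So in an adapted frame \<open>\<sigma> / \<rho>\<close> solves a linear ordinary differential equation in the normal
  direction with smooth coefficient, and therefore extends to the boundary without zeros.\<close>

lemma sigma_over_rho_extends:
  assumes \<rho>: "local_defining k M U \<rho>" and p: "p \<in> bdry k M" "p \<in> U" and N: "openin (mtop M) N" "p \<in> N"
  obtains V y E s where "p \<in> V" "V \<subseteq> U" "V \<subseteq> N" "coord_frame M V y E" "y k = \<rho>" "s \<in> smooth_funs M V"
    "\<And>q. q \<in> V \<Longrightarrow> s q \<noteq> 0" "\<And>q. q \<in> V \<Longrightarrow> q \<in> intr k M \<Longrightarrow> \<sigma> q (\<lambda>i. E i q) = s q * \<rho> q"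
proof -
  obtain U1 \<phi> where U1: "(U1, \<phi>) \<in> charts M" "p \<in> U1" using chart_cover bdry_topspace p by blast
  have "openin (mtop M) (N \<inter> U1)" using N(1) chart_open[OF U1(1)] by blast
  then obtain V y E where V: "p \<in> V" "V \<subseteq> U" "V \<subseteq> N \<inter> U1" and cf: "coord_frame M V y E" "y k = \<rho>"
    using adapted_frame[OF \<rho> p, of "N \<inter> U1"] N(2) U1(2) by (metis IntI)
  note oV = coord_frameD(1)[OF cf(1)]
  have \<rho>V: "local_defining k M V \<rho>" by (rule local_defining_subset[OF \<rho> oV V(2)])
  let ?X = "chart_vf U1 \<phi> k"
  have X: "?X \<in> vfields M V" by (rule vfields_subset[OF chart_vf_vfields[OF U1(1)] oV]) (use V(3) in blast)
  obtain \<theta> where \<theta>: "\<theta> \<in> smooth_funs M V" "\<And>q. q \<in> V \<Longrightarrow> q \<in> intr k M \<Longrightarrow> \<theta> q = (\<Sum>j\<in>UNIV. \<nabla> \<rho> ?X (E j) q (y j))"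
    using nabla_trace_extends[OF \<rho>V cf X] by blast
  let ?W = "V \<inter> intr k M"
  have oW: "openin (mtop M) ?W" using oV openin_intr by blast
  have XW: "?X \<in> vfields M ?W" by (rule vfields_subset[OF X oW]) blast
  have cfW: "coord_frame M ?W y E" by (rule coord_frame_subset[OF cf(1) oW]) blast
  have \<rho>W: "\<rho> \<in> smooth_funs M ?W" by (rule smooth_funs_subset[OF local_defining_smooth[OF \<rho>V] oW]) blast
  have nz: "\<rho> q \<noteq> 0" if "q \<in> ?W" for q using local_defining_intr[OF \<rho>V] that by blast
  have \<sigma>E: "(\<lambda>q. \<sigma> q (\<lambda>i. E i q)) \<in> smooth_funs M ?W"
    by (rule density_sections_smooth[OF \<sigma>_section cfW]) blast
  \<comment> \<open>The coefficient of \<open>\<sigma> / \<rho>\<close> in the frame \<open>E\<close>; \<open>Xs\<close> below is its differential equation.\<close>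
  define s where "s q = \<sigma> q (\<lambda>i. E i q) / \<rho> q" for q
  have s: "s \<in> smooth_funs M ?W" unfolding s_def by (rule smooth_funs_divide[OF \<sigma>E \<rho>W nz])
  have s0: "s q \<noteq> 0" if "q \<in> ?W" for q
    using nv coord_frame_frame_at[OF cfW that] nz[OF that] that unfolding nowhere_vanishing_def s_def by simp
  have N': "linear_connection M ?W (\<nabla> \<rho>)" by (rule nabla_connection[OF \<rho>V])
  have Xs: "?X q s = (weight1 TYPE('n)) * \<theta> q * s q" if q: "q \<in> ?W" for q
  proof -
    note v = vfields_tspace[OF XW q]
    let ?c = "\<chi> i j. \<nabla> \<rho> ?X (E j) q (y i)"
    have dd: "density_deriv M (\<nabla> \<rho>) (weight1 TYPE('n)) ?W ?X \<sigma> (\<lambda>q e. (?X q (\<lambda>_. 1) + 1 * (?X q \<rho> / \<rho> q)) * \<sigma> q e)"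
      by (rule density_deriv_nabla[OF \<rho>V subset_refl XW smooth_funs_const[OF oW, of 1]]) simp_all
    have "(?X q (\<lambda>_. 1) + 1 * (?X q \<rho> / \<rho> q)) * \<sigma> q (\<lambda>i. E i q)
        = ?X q (\<lambda>q. \<sigma> q (\<lambda>i. E i q)) - (weight1 TYPE('n)) * trace ?c * \<sigma> q (\<lambda>i. E i q)"
      by (rule dd[unfolded density_deriv_def, THEN conjunct2, rule_format, of ?W E q ?c])
        (intro conjI allI subset_refl oW coord_frame_local_frame[OF cfW] q conn_coord_frame[OF N' XW cfW subset_refl q])
    then have 1: "?X q (\<lambda>q. \<sigma> q (\<lambda>i. E i q)) = ((weight1 TYPE('n)) * \<theta> q + ?X q \<rho> / \<rho> q) * \<sigma> q (\<lambda>i. E i q)"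
      using \<theta>(2)[of q] q by (simp add: tspace_const[OF v] trace_def algebra_simps)
    have "?X q (\<lambda>q. \<sigma> q (\<lambda>i. E i q)) = ?X q (\<lambda>q. s q * \<rho> q)"
      by (rule tspace_cong[OF v oW q]) (use nz in \<open>simp add: s_def\<close>)
    also have "\<dots> = s q * ?X q \<rho> + \<rho> q * ?X q s"
      by (rule tspace_mult[OF v smooth_atI[OF s q] smooth_atI[OF \<rho>W q]])
    finally have "s q * ?X q \<rho> + \<rho> q * ?X q s = ((weight1 TYPE('n)) * \<theta> q + ?X q \<rho> / \<rho> q) * (s q * \<rho> q)"
      using 1 nz[OF q] by (simp add: s_def)
    then have "\<rho> q * ?X q s = \<rho> q * ((weight1 TYPE('n)) * \<theta> q * s q)" using nz[OF q] by (simp add: field_simps)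
    then show ?thesis using nz[OF q] by simp
  qed
  obtain G g where G: "open G" "\<phi> p \<in> G" "Cinf_on G g" "\<And>q. q \<in> U1 \<Longrightarrow> q \<in> V \<Longrightarrow> \<phi> q \<in> G \<Longrightarrow> \<theta> q = g (\<phi> q)"
    using smooth_funsE[OF \<theta>(1) U1 V(1)] by blast
  obtain Q where Q: "open Q" "\<phi> ` (U1 \<inter> V) = halfspace k \<inter> Q"
    using chart_image_open[OF U1(1) oV] model_M by metis
  have "\<phi> p \<in> G \<inter> Q" using Q(2) U1(2) V(1) G(2) by blast
  moreover have "open (G \<inter> Q)" using G(1) Q(1) by (rule open_Int)
  ultimately obtain e where e: "0 < e" "ball (\<phi> p) e \<subseteq> G \<inter> Q" using openE by blast
  define r where "r = e / 3"
  have r: "0 < r" "3 * r = e" using e(1) by (auto simp: r_def)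
  let ?f = "s \<circ> inv_into U1 \<phi>"
  let ?P = "ball (\<phi> p) (3 * r) \<inter> {x. 0 < x $ k}"
  have oP: "open ?P" by (intro open_Int open_ball open_Collect_less continuous_intros)
  have P: "\<exists>q. q \<in> U1 \<and> q \<in> ?W \<and> \<phi> q = x" if "x \<in> ?P" for x
  proof -
    have "x \<in> halfspace k \<inter> Q" using that e(2) r(2) by (auto simp: halfspace_def)
    then have "x \<in> \<phi> ` (U1 \<inter> V)" unfolding Q(2) .
    then obtain q where "q \<in> U1" "q \<in> V" "\<phi> q = x" by blast
    then show ?thesis using intr_iff[OF U1(1)] that by auto
  qed
  have fq: "?f (\<phi> q) = s q" if "q \<in> U1" for q using chart_inv[OF U1(1) that] by simp
  have "smooth_on_set (\<phi> ` (U1 \<inter> ?W)) ?f" using s U1(1) unfolding smooth_funs_def by blast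
  then have "smooth_on_set ?P ?f" by (rule smooth_on_set_cong) (use P in blast)+
  then have f: "Cinf_on ?P ?f" by (rule smooth_on_set_imp_Cinf_on[OF oP])
  have gB: "Cinf_on (ball (\<phi> p) (3 * r)) (\<lambda>x. (weight1 TYPE('n)) * g x)"
    by (intro Cinf_on_mult Cinf_on_const open_ball Cinf_on_subset[OF G(3)]) (use e(2) r(2) in auto)
  have ode: "pd ?f k x = (weight1 TYPE('n)) * g x * ?f x" if x: "x \<in> ball (\<phi> p) (3 * r)" "0 < x $ k" for x
  proof -
    obtain q where q: "q \<in> U1" "q \<in> ?W" "\<phi> q = x" using P x by blast
    have "chart_rep U1 \<phi> q s ?f"
      by (rule chart_repI[OF oP _ f oW q(2)]) (use q(3) x fq in auto)
    then have "pd ?f k x = ?X q s" using chart_vf_eq[OF U1(1) q(1)] q(3) by simp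
    moreover have "\<theta> q = g x" using G(4)[OF q(1)] q(2,3) x(1) e(2) r(2) by auto
    ultimately show ?thesis using Xs[OF q(2)] fq[OF q(1)] q(3) by simp
  qed
  have k0: "\<phi> p $ k = 0" using bdry_iff[OF U1] p(1) by simp
  have f0: "?f x \<noteq> 0" if x: "x \<in> ball (\<phi> p) (3 * r)" "0 < x $ k" for x
  proof -
    obtain q where q: "q \<in> U1" "q \<in> ?W" "\<phi> q = x" using P x by blast
    then show ?thesis using fq[OF q(1)] s0[OF q(2)] by simp
  qed
  obtain F where F: "Cinf_on (ball (\<phi> p) r) F" "\<And>x. x \<in> ball (\<phi> p) r \<Longrightarrow> 0 < x $ k \<Longrightarrow> F x = ?f x"
    "\<And>x. x \<in> ball (\<phi> p) r \<Longrightarrow> F x \<noteq> 0"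
    using linear_ode_extend[OF k0 r(1) f gB ode] f0 by metis
  let ?V = "V \<inter> {q \<in> U1. \<phi> q \<in> ball (\<phi> p) r}"
  have oV': "openin (mtop M) ?V" using oV chart_preimage_open[OF U1(1) open_ball] by blast
  show ?thesis
  proof (rule that[of ?V y E "\<lambda>q. F (\<phi> q)"])
    show "coord_frame M ?V y E" by (rule coord_frame_subset[OF cf(1) oV']) blast
    show "(\<lambda>q. F (\<phi> q)) \<in> smooth_funs M ?V"
      by (rule smooth_funs_Int[OF smooth_funs_chart_compose[OF U1(1) open_ball F(1)] oV])
    fix q assume q: "q \<in> ?V"
    show "F (\<phi> q) \<noteq> 0" using F(3) q by blast
    assume "q \<in> intr k M"
    then have qW: "q \<in> ?W" and "0 < \<phi> q $ k" using q intr_iff[OF U1(1)] by auto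
    then have "F (\<phi> q) = s q" using F(2)[of "\<phi> q"] fq[of q] q by auto
    then show "\<sigma> q (\<lambda>i. E i q) = F (\<phi> q) * \<rho> q" using nz[OF qW] by (simp add: s_def)
  qed (use V cf(2) U1(2) r(1) in auto)
qed

text \<open>In the interior \<open>\<nabla>\<^sup>\<rho>\<nabla>\<^sup>\<rho> \<sigma>\<close> is \<open>\<sigma> / \<rho>\<close> times an expression that is tensorial in the two fields.  Both
  factors are smooth up to the boundary, so an extension exists, and as the interior is dense its value
  at \<open>p\<close> depends only on \<open>v\<close> and \<open>w\<close>: the definite description denotes it.\<close>

lemma second_fundamental_form_value:
  assumes \<rho>: "local_defining k M U \<rho>" and cf: "coord_frame M V y E" "y k = \<rho>" and V: "V \<subseteq> U"
    and p: "p \<in> V"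
    and s: "s \<in> smooth_funs M V" "\<And>q. q \<in> V \<Longrightarrow> q \<in> intr k M \<Longrightarrow> \<sigma> q (\<lambda>i. E i q) = s q * \<rho> q"
    and h: "\<And>i j. h i j \<in> smooth_funs M V"
      "\<And>i j q. q \<in> V \<Longrightarrow> q \<in> intr k M \<Longrightarrow> h i j q = \<nabla> \<rho> (E i) (E j) q \<rho>"
    and vw: "v \<in> tspace M p" "w \<in> tspace M p"
  shows "second_fundamental_form k M D \<sigma> U \<rho> p v w (\<lambda>i. E i p) = - (\<Sum>i\<in>UNIV. \<Sum>j\<in>UNIV. v (y i) * w (y j) * h i j p) * s p"
proof -
  note oV = coord_frameD(1)[OF cf(1)]
  \<comment> \<open>The coefficient, in the frame \<open>E\<close>, of the extension of \<open>\<nabla>\<^sup>\<rho>\<nabla>\<^sup>\<rho> \<sigma>\<close> evaluated on \<open>\<xi>, \<eta>\<close>.\<close>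
  define K where "K \<xi> \<eta> q = - (\<Sum>i\<in>UNIV. \<Sum>j\<in>UNIV. \<xi> q (y i) * \<eta> q (y j) * h i j q) * s q" for \<xi> \<eta> :: "'m field" and q
  have K_smooth: "K \<xi> \<eta> \<in> smooth_funs M W" if W: "W \<subseteq> V" "\<xi> \<in> vfields M W" "\<eta> \<in> vfields M W" for \<xi> \<eta> W
    unfolding K_def
    by (intro smooth_funs_mult smooth_funs_uminus smooth_funs_sum vfields_smooth[OF W(2) subset_refl] vfields_smooth[OF W(3) subset_refl]
        smooth_funs_subset[OF coord_frameD(2)[OF cf(1)]] smooth_funs_subset[OF h(1)] smooth_funs_subset[OF s(1)]
        W(1) vfields_openin[OF W(2)])
  have K_int: "(\<xi> q (\<lambda>r. \<eta> r \<rho>) - \<nabla> \<rho> \<xi> \<eta> q \<rho>) / \<rho> q * \<sigma> q (\<lambda>i. E i q) = K \<xi> \<eta> q"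
    if W: "W \<subseteq> V" "W \<subseteq> intr k M" "\<xi> \<in> vfields M W" "\<eta> \<in> vfields M W" "q \<in> W" for \<xi> \<eta> W q
  proof -
    have q: "q \<in> V" "q \<in> intr k M" using W by auto
    have W': "W \<subseteq> U \<inter> intr k M" using W(1,2) V by blast
    have "\<rho> q \<noteq> 0" using local_defining_intr[OF \<rho>] q V by blast
    moreover have "\<xi> q (\<lambda>r. \<eta> r \<rho>) - \<nabla> \<rho> \<xi> \<eta> q \<rho> = - (\<Sum>i\<in>UNIV. \<Sum>j\<in>UNIV. \<xi> q (y i) * \<eta> q (y j) * h i j q)"
      unfolding nabla_conormal_expand[OF \<rho> cf W(1) W' W(3,4,5)] by (simp add: h(2)[OF q])
    ultimately show ?thesis unfolding K_def s(2)[OF q] by simp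
  qed
  let ?v = "\<lambda>q f. \<Sum>i\<in>UNIV. v (y i) * E i q f" and ?w = "\<lambda>q f. \<Sum>i\<in>UNIV. w (y i) * E i q f"
  have vf: "(\<lambda>q f. \<Sum>i\<in>UNIV. c i * E i q f) \<in> vfields M V" for c :: "'n \<Rightarrow> real"
    by (rule vfields_sum[OF oV coord_frameD(3)[OF cf(1)] smooth_funs_const[OF oV]])
  have at: "?v p = v" "?w p = w"
    by (rule ext, rule coord_frameD(5)[OF cf(1) p vw(1), symmetric],
        rule ext, rule coord_frameD(5)[OF cf(1) p vw(2), symmetric])
  let ?Z = "\<lambda>z. \<exists>V' \<xi> \<eta> \<Psi>. V' \<subseteq> U \<and> p \<in> V' \<and>
        \<xi> \<in> vfields M V' \<and> \<eta> \<in> vfields M V' \<and> \<xi> p = v \<and> \<eta> p = w \<and>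
        \<Psi> \<in> density_sections M (weight1 TYPE('n)) V' \<and>
        density_hessian M (\<nabla> \<rho>) (weight1 TYPE('n)) (V' \<inter> intr k M) \<xi> \<eta> \<sigma> \<Psi> \<and> z = \<Psi> p"
  define \<Psi>0 where "\<Psi>0 = frame_density (weight1 TYPE('n)) y (K ?v ?w)"
  have \<Psi>0: "\<Psi>0 \<in> density_sections M (weight1 TYPE('n)) V"
    unfolding \<Psi>0_def by (rule frame_density_sections[OF cf(1) K_smooth[OF subset_refl vf vf]])
  have "?Z (\<Psi>0 p)"
  proof (intro exI conjI)
    have oI: "openin (mtop M) (V \<inter> intr k M)" using oV openin_intr by blast
    have sub: "V \<inter> intr k M \<subseteq> U \<inter> intr k M" using V by blast
    have vfI: "(\<lambda>q f. \<Sum>i\<in>UNIV. c i * E i q f) \<in> vfields M (V \<inter> intr k M)" for c :: "'n \<Rightarrow> real"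
      by (rule vfields_subset[OF vf oI]) blast
    show "density_hessian M (\<nabla> \<rho>) (weight1 TYPE('n)) (V \<inter> intr k M) ?v ?w \<sigma> \<Psi>0"
      unfolding density_hessian_iff[OF \<rho> sub vfI vfI]
    proof (intro ballI allI)
      fix q e assume q: "q \<in> V \<inter> intr k M"
      let ?k = "(?v q (\<lambda>q. ?w q \<rho>) - \<nabla> \<rho> ?v ?w q \<rho>) / \<rho> q"
      have "(\<lambda>e. ?k * \<sigma> q e) = \<Psi>0 q"
      proof (rule density_at_eqI[OF cf(1)])
        show "\<Psi>0 q \<in> density_at M (weight1 TYPE('n)) q" using density_sections_at[OF \<Psi>0] q by blast
        show "(\<lambda>e. ?k * \<sigma> q e) \<in> density_at M (weight1 TYPE('n)) q"
          using density_sections_at[OF \<sigma>_section, of q] q unfolding density_at_def by simp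
        have "\<Psi>0 q (\<lambda>i. E i q) = K ?v ?w q"
          unfolding \<Psi>0_def by (rule frame_density_frame[OF cf(1)]) (use q in blast)
        then show "?k * \<sigma> q (\<lambda>i. E i q) = \<Psi>0 q (\<lambda>i. E i q)"
          using K_int[of "V \<inter> intr k M" ?v ?w q] vfI q by simp
      qed (use q in blast)
      from fun_cong[OF this, of e] show "\<Psi>0 q e = ?k * \<sigma> q e" by (rule sym)
    qed
  qed (rule V p vf at \<Psi>0 refl)+
  moreover have "z = \<Psi>0 p" if "?Z z" for z
  proof -
    obtain V' \<xi> \<eta> \<Psi> where V': "V' \<subseteq> U" "p \<in> V'" and \<xi>: "\<xi> \<in> vfields M V'" "\<eta> \<in> vfields M V'" "\<xi> p = v" "\<eta> p = w"
      and \<Psi>: "\<Psi> \<in> density_sections M (weight1 TYPE('n)) V'" "density_hessian M (\<nabla> \<rho>) (weight1 TYPE('n)) (V' \<inter> intr k M) \<xi> \<eta> \<sigma> \<Psi>" "z = \<Psi> p"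
      using \<open>?Z z\<close> by blast
    let ?W = "V' \<inter> V"
    have oW: "openin (mtop M) ?W" using oV vfields_openin[OF \<xi>(1)] by blast
    have oI: "openin (mtop M) (V' \<inter> intr k M)" using openin_intr vfields_openin[OF \<xi>(1)] by blast
    have oWI: "openin (mtop M) (?W \<inter> intr k M)" using openin_intr oW by blast
    have cfW: "coord_frame M ?W y E" by (rule coord_frame_subset[OF cf(1) oW]) blast
    have \<xi>W: "\<xi> \<in> vfields M ?W" "\<eta> \<in> vfields M ?W" using vfields_subset[OF _ oW] \<xi>(1,2) by auto
    have \<xi>I: "\<xi> \<in> vfields M (V' \<inter> intr k M)" "\<eta> \<in> vfields M (V' \<inter> intr k M)"
      using vfields_subset[OF _ oI] \<xi>(1,2) by auto
    have \<xi>WI: "\<xi> \<in> vfields M (?W \<inter> intr k M)" "\<eta> \<in> vfields M (?W \<inter> intr k M)"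
      using vfields_subset[OF _ oWI] \<xi>W by auto
    have sub: "V' \<inter> intr k M \<subseteq> U \<inter> intr k M" using V' by blast
    have sm: "(\<lambda>q. \<Psi> q (\<lambda>i. E i q)) \<in> smooth_funs M ?W"
      by (rule density_sections_smooth[OF \<Psi>(1) cfW]) blast
    have KW: "K \<xi> \<eta> \<in> smooth_funs M ?W" by (rule K_smooth[OF _ \<xi>W]) blast
    have "\<Psi> p (\<lambda>i. E i p) = K \<xi> \<eta> p"
    proof (rule smooth_funs_eq_of_intr[OF sm KW])
      fix q assume q: "q \<in> ?W" "q \<in> intr k M"
      have "\<Psi> q (\<lambda>i. E i q) = (\<xi> q (\<lambda>r. \<eta> r \<rho>) - \<nabla> \<rho> \<xi> \<eta> q \<rho>) / \<rho> q * \<sigma> q (\<lambda>i. E i q)"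
        using \<Psi>(2)[unfolded density_hessian_iff[OF \<rho> sub \<xi>I]] q by blast
      also have "\<dots> = K \<xi> \<eta> q" by (rule K_int[of "?W \<inter> intr k M"]) (use \<xi>WI q in auto)
      finally show "\<Psi> q (\<lambda>i. E i q) = K \<xi> \<eta> q" .
    qed (use V' p in blast)
    also have "\<dots> = K ?v ?w p" unfolding K_def \<xi>(3,4) at ..
    also have "\<dots> = \<Psi>0 p (\<lambda>i. E i p)" unfolding \<Psi>0_def by (rule frame_density_frame[OF cf(1) p, symmetric])
    finally show ?thesis unfolding \<Psi>(3)
      by (rule density_at_eqI[OF cf(1) p density_sections_at[OF \<Psi>(1) V'(2)] density_sections_at[OF \<Psi>0 p]])
  qed
  ultimately have "second_fundamental_form k M D \<sigma> U \<rho> p v w = \<Psi>0 p"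
    unfolding second_fundamental_form_def by (rule the_equality)
  then have "second_fundamental_form k M D \<sigma> U \<rho> p v w (\<lambda>i. E i p) = K ?v ?w p"
    unfolding \<Psi>0_def by (simp only: frame_density_frame[OF cf(1) p])
  then show ?thesis unfolding K_def at .
qed

end

section \<open>The induced connection on the boundary\<close>

context bdry_manifold
begin

lemma bdry_incl_lincomb:
  "bdry_incl M p (\<lambda>f. a * v f + b * w f) = (\<lambda>f. a * bdry_incl M p v f + b * bdry_incl M p w f)"
  by (auto simp: bdry_incl_def)

lemma bdry_incl_add: "bdry_incl M p (\<lambda>f. v f + w f) = (\<lambda>f. bdry_incl M p v f + bdry_incl M p w f)"
  by (auto simp: bdry_incl_def)

lemma bdry_incl_mult: "bdry_incl M p (\<lambda>f. a * v f) = (\<lambda>f. a * bdry_incl M p v f)"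
  by (auto simp: bdry_incl_def)

definition extends_field :: "'m set \<Rightarrow> 'm field \<Rightarrow> 'm field \<Rightarrow> bool" where
  "extends_field V \<xi> X \<longleftrightarrow> \<xi> \<in> vfields_tan k M V \<and> (\<forall>q\<in>V \<inter> bdry k M. \<xi> q = bdry_incl M q (X q))"

lemma extends_fieldD:
  assumes "extends_field V \<xi> X"
  shows "\<xi> \<in> vfields_tan k M V" "\<xi> \<in> vfields M V" "q \<in> V \<Longrightarrow> q \<in> bdry k M \<Longrightarrow> \<xi> q = bdry_incl M q (X q)"
  using assms unfolding extends_field_def vfields_tan_def by auto

lemma extends_field_subset:
  "extends_field W \<xi> X \<Longrightarrow> openin (mtop M) V \<Longrightarrow> V \<subseteq> W \<Longrightarrow> extends_field V \<xi> X"
  unfolding extends_field_def vfields_tan_def using vfields_subset by auto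

lemma extends_fieldI:
  assumes "\<xi> \<in> vfields M V" "\<And>q. q \<in> V \<Longrightarrow> q \<in> bdry k M \<Longrightarrow> \<xi> q = bdry_incl M q (X q)"
    "\<And>q. q \<in> V \<Longrightarrow> q \<in> bdry k M \<Longrightarrow> X q \<in> tspace (bdry_mfd k M) q"
  shows "extends_field V \<xi> X"
  using assms unfolding extends_field_def vfields_tan_def bdry_tspace_def by auto

text \<open>In a chart, extend the coefficients of a boundary field.\<close>

lemma extends_field_exists:
  assumes X: "X \<in> vfields (bdry_mfd k M) W" and p: "p \<in> W"
  obtains V \<xi> where "p \<in> V" "V \<inter> bdry k M \<subseteq> W" "extends_field V \<xi> X"
proof -
  have pb: "p \<in> bdry k M" using bdry_tspace_bdry[OF bdry.vfields_tspace[OF X p]] .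
  obtain U \<phi> where U: "(U, \<phi>) \<in> charts M" "p \<in> U" using chart_cover bdry_topspace pb by blast
  obtain W' where W': "openin (mtop M) W'" "W = W' \<inter> bdry k M"
    using openin_bdryE[OF bdry.vfields_openin[OF X]] .
  let ?y = "\<lambda>i q. \<phi> q $ i"
  have "(\<lambda>q. X q (?y i)) \<in> smooth_funs (bdry_mfd k M) (W' \<inter> U \<inter> bdry k M)" for i
  proof (rule bdry.vfields_smooth[OF X])
    show "?y i \<in> smooth_funs (bdry_mfd k M) (W' \<inter> U \<inter> bdry k M)"
      by (rule smooth_funs_restrict[OF smooth_funs_Int[OF smooth_funs_coord[OF U(1)] W'(1)]])
  qed (use W' in blast)
  then have "\<exists>V a. p \<in> V \<and> a \<in> smooth_funs M V \<and> (\<forall>q\<in>V \<inter> bdry k M. a q = X q (?y i))" for i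
    using smooth_funs_extend[of "\<lambda>q. X q (?y i)" "W' \<inter> U \<inter> bdry k M" p] p U(2) W'(2) pb by (metis IntE IntI)
  then obtain A a where a: "\<And>i. p \<in> A i" "\<And>i. a i \<in> smooth_funs M (A i)"
    "\<And>i. \<forall>q\<in>A i \<inter> bdry k M. a i q = X q (?y i)" by metis
  define V where "V = (\<Inter>i. A i) \<inter> (U \<inter> W')"
  have "openin (mtop M) (\<Inter>(range A))"
    by (rule openin_Inter) (use smooth_funs_openin[OF a(2)] in auto)
  then have oV: "openin (mtop M) V" unfolding V_def using chart_open[OF U(1)] W'(1) by blast
  let ?\<xi> = "\<lambda>q f. \<Sum>i\<in>UNIV. a i q * chart_vf U \<phi> i q f"
  have aV: "a i \<in> smooth_funs M V" for i
    by (rule smooth_funs_subset[OF a(2) oV, of i]) (auto simp: V_def)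
  have cV: "chart_vf U \<phi> i \<in> vfields M V" for i
    by (rule vfields_subset[OF chart_vf_vfields[OF U(1)] oV]) (auto simp: V_def)
  have "?\<xi> \<in> vfields M V" by (rule vfields_sum[OF oV cV aV])
  moreover have Xq: "X q \<in> tspace (bdry_mfd k M) q" if "q \<in> V" "q \<in> bdry k M" for q
    using bdry.vfields_tspace[OF X] W'(2) that by (auto simp: V_def)
  moreover have "?\<xi> q = bdry_incl M q (X q)" if q: "q \<in> V" "q \<in> bdry k M" for q
  proof
    fix f
    have qU: "q \<in> U" using q by (simp add: V_def)
    have "bdry_incl M q (X q) f = (\<Sum>i\<in>UNIV. bdry_incl M q (X q) (?y i) * chart_vf U \<phi> i q f)"
      by (rule chart_vf_expand[OF U(1) qU bdry_incl_tspace[OF Xq[OF q]]])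
    moreover have "bdry_incl M q (X q) (?y i) = a i q" for i
      using bdry_incl_apply[OF smooth_atI[OF smooth_funs_coord[OF U(1)] qU]] a(3)[of i] q by (auto simp: V_def)
    ultimately show "?\<xi> q f = bdry_incl M q (X q) f" by simp
  qed
  ultimately have "extends_field V ?\<xi> X" using extends_fieldI by blast
  moreover have "p \<in> V" using a(1) U(2) p W'(2) by (auto simp: V_def)
  moreover have "V \<inter> bdry k M \<subseteq> W" using W'(2) by (auto simp: V_def)
  ultimately show ?thesis using that by blast
qed

lemma extends_field_apply:
  assumes \<xi>: "extends_field V \<xi> X" and X: "X p \<in> tspace (bdry_mfd k M) p" and p: "p \<in> V"
    and f: "f' \<in> smooth_funs M V" "\<And>q. q \<in> V \<Longrightarrow> q \<in> bdry k M \<Longrightarrow> f' q = f q"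
  shows "\<xi> p f' = X p f"
  using bdry_incl_extend[OF X f(1) p f(2)] extends_fieldD(3)[OF \<xi> p bdry_tspace_bdry[OF X]] by simp

lemma extends_field3_exists:
  assumes X: "X \<in> vfields (bdry_mfd k M) W" "Y \<in> vfields (bdry_mfd k M) W" "Z \<in> vfields (bdry_mfd k M) W"
    and W: "W \<subseteq> U \<inter> bdry k M" and U: "openin (mtop M) U" and p: "p \<in> W"
  obtains V \<xi> \<eta> \<omega> where "p \<in> V" "V \<subseteq> U" "V \<inter> bdry k M \<subseteq> W" "openin (mtop M) V"
    "extends_field V \<xi> X" "extends_field V \<eta> Y" "extends_field V \<omega> Z"
proof -
  obtain V1 \<xi> where 1: "p \<in> V1" "V1 \<inter> bdry k M \<subseteq> W" "extends_field V1 \<xi> X" by (rule extends_field_exists[OF X(1) p])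
  obtain V2 \<eta> where 2: "p \<in> V2" "V2 \<inter> bdry k M \<subseteq> W" "extends_field V2 \<eta> Y" by (rule extends_field_exists[OF X(2) p])
  obtain V3 \<omega> where 3: "p \<in> V3" "V3 \<inter> bdry k M \<subseteq> W" "extends_field V3 \<omega> Z" by (rule extends_field_exists[OF X(3) p])
  let ?V = "V1 \<inter> V2 \<inter> V3 \<inter> U"
  have o: "openin (mtop M) ?V"
    using vfields_openin[OF extends_fieldD(2)[OF 1(3)]] vfields_openin[OF extends_fieldD(2)[OF 2(3)]]
      vfields_openin[OF extends_fieldD(2)[OF 3(3)]] U by blast
  show ?thesis
    by (rule that[of ?V \<xi> \<eta> \<omega>])
      (use 1(1,2) 2(1) 3(1) p W o extends_field_subset[OF 1(3) o] extends_field_subset[OF 2(3) o]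
        extends_field_subset[OF 3(3) o] in auto)
qed

end

context precompact_mfd
begin

lemma vfields_tan_lincomb:
  assumes "\<xi> \<in> vfields_tan k M V" "\<eta> \<in> vfields_tan k M V" "a \<in> smooth_funs M V" "b \<in> smooth_funs M V"
    and \<rho>: "local_defining k M V \<rho>"
  shows "(\<lambda>p f. a p * \<xi> p f + b p * \<eta> p f) \<in> vfields_tan k M V"
  using assms(1,2) vfields_lincomb[OF _ _ assms(3,4)] by (simp add: vfields_tan_iff[OF \<rho>])

text \<open>Expand the field that vanishes on the boundary in an adapted frame.  By condition (iii) all terms of
  the expansion are smooth up to the boundary, since the other field is tangential, and they vanish
  there.\<close>

lemma nabla_extension_zero:
  assumes \<rho>: "local_defining k M U \<rho>" and \<xi>: "\<xi> \<in> vfields_tan k M U" and \<eta>: "\<eta> \<in> vfields_tan k M U"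
    and z: "(\<forall>q\<in>U \<inter> bdry k M. \<xi> q = (\<lambda>f. 0)) \<or> (\<forall>q\<in>U \<inter> bdry k M. \<eta> q = (\<lambda>f. 0))"
    and \<zeta>: "\<zeta> \<in> vfields M U" "\<And>q. q \<in> U \<Longrightarrow> q \<in> intr k M \<Longrightarrow> \<zeta> q = \<nabla> \<rho> \<xi> \<eta> q"
    and p: "p \<in> U" "p \<in> bdry k M"
  shows "\<zeta> p = (\<lambda>f. 0)"
proof -
  obtain V y E where V: "p \<in> V" "V \<subseteq> U" and cf: "coord_frame M V y E" "y k = \<rho>"
    using adapted_frame[OF \<rho> p(2,1) local_defining_openin[OF \<rho>] p(1)] by metis
  note oV = coord_frameD(1)[OF cf(1)] and E = coord_frameD(3)[OF cf(1)] and y = coord_frameD(2)[OF cf(1)]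
  have \<rho>V: "local_defining k M V \<rho>" by (rule local_defining_subset[OF \<rho> oV V(2)])
  have \<xi>V: "\<xi> \<in> vfields_tan k M V" and \<eta>V: "\<eta> \<in> vfields_tan k M V"
    using vfields_tan_subset[OF _ oV V(2)] \<xi> \<eta> by auto
  then have v: "\<xi> \<in> vfields M V" "\<eta> \<in> vfields M V" by (simp_all add: vfields_tan_def)
  have \<zeta>V: "\<zeta> \<in> vfields M V" by (rule vfields_subset[OF \<zeta>(1) oV V(2)])
  have oI: "openin (mtop M) (V \<inter> intr k M)" using oV openin_intr by blast
  have vI: "\<xi> \<in> vfields M (V \<inter> intr k M)" "\<eta> \<in> vfields M (V \<inter> intr k M)" using vfields_subset[OF _ oI] v by auto
  note expand = nabla_expand[OF \<rho>V cf Int_lower1 subset_refl vI]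
  from z show ?thesis
  proof
    assume z: "\<forall>q\<in>U \<inter> bdry k M. \<xi> q = (\<lambda>f. 0)"
    have "\<exists>\<zeta>'\<in>vfields M V. \<forall>q\<in>V \<inter> intr k M. \<zeta>' q = \<nabla> \<rho> (E i) \<eta> q" for i
      by (rule nabla_tan_extends[OF \<rho>V E v(2) disjI2[OF \<eta>V]])
    then obtain \<zeta>' where \<zeta>': "\<And>i. \<zeta>' i \<in> vfields M V" "\<And>i. \<forall>q\<in>V \<inter> intr k M. \<zeta>' i q = \<nabla> \<rho> (E i) \<eta> q"
      by metis
    have "\<zeta> p = (\<lambda>f. \<Sum>i\<in>UNIV. \<xi> p (y i) * \<zeta>' i p f)"
    proof (rule vfields_eq_of_intr[OF \<zeta>V _ _ V(1)])
      show "(\<lambda>q f. \<Sum>i\<in>UNIV. \<xi> q (y i) * \<zeta>' i q f) \<in> vfields M V"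
        by (rule vfields_sum[OF oV \<zeta>'(1) vfields_smooth[OF v(1) subset_refl y]])
      show "\<zeta> q f = (\<Sum>i\<in>UNIV. \<xi> q (y i) * \<zeta>' i q f)" if q: "q \<in> V" "q \<in> intr k M" for q f
      proof -
        have "\<zeta> q f = \<nabla> \<rho> \<xi> \<eta> q f" using \<zeta>(2) q V(2) by auto
        then show ?thesis using expand(2)[of q f] \<zeta>'(2) q by simp
      qed
    qed
    then show ?thesis using z p by simp
  next
    assume z: "\<forall>q\<in>U \<inter> bdry k M. \<eta> q = (\<lambda>f. 0)"
    have "\<exists>\<zeta>'\<in>vfields M V. \<forall>q\<in>V \<inter> intr k M. \<zeta>' q = \<nabla> \<rho> \<xi> (E j) q" for j
      by (rule nabla_tan_extends[OF \<rho>V v(1) E disjI1[OF \<xi>V]])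
    then obtain \<zeta>' where \<zeta>': "\<And>j. \<zeta>' j \<in> vfields M V" "\<And>j. \<forall>q\<in>V \<inter> intr k M. \<zeta>' j q = \<nabla> \<rho> \<xi> (E j) q"
      by metis
    note \<eta>y = vfields_smooth[OF v(2) subset_refl y]
    have "\<zeta> p = (\<lambda>f. (\<Sum>j\<in>UNIV. \<xi> p (\<lambda>r. \<eta> r (y j)) * E j p f) + (\<Sum>j\<in>UNIV. \<eta> p (y j) * \<zeta>' j p f))"
    proof (rule vfields_eq_of_intr[OF \<zeta>V _ _ V(1)])
      show "(\<lambda>q f. (\<Sum>j\<in>UNIV. \<xi> q (\<lambda>r. \<eta> r (y j)) * E j q f) + (\<Sum>j\<in>UNIV. \<eta> q (y j) * \<zeta>' j q f)) \<in> vfields M V"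
        by (intro vfields_add vfields_sum oV E \<zeta>'(1) vfields_smooth[OF v(1) subset_refl] \<eta>y)
      show "\<zeta> q f = (\<Sum>j\<in>UNIV. \<xi> q (\<lambda>r. \<eta> r (y j)) * E j q f) + (\<Sum>j\<in>UNIV. \<eta> q (y j) * \<zeta>' j q f)"
        if q: "q \<in> V" "q \<in> intr k M" for q f
      proof -
        have "\<zeta> q f = \<nabla> \<rho> \<xi> \<eta> q f" using \<zeta>(2) q V(2) by auto
        then show ?thesis using expand(1)[of q f] \<zeta>'(2) q by (simp add: sum.distrib)
      qed
    qed
    moreover have "\<xi> p (\<lambda>r. \<eta> r (y j)) = 0" for j
    proof (rule bdry_tspace_vanish[OF _ \<eta>y V(1)])
      show "\<xi> p \<in> bdry_tspace k M p" using \<xi> p by (simp add: vfields_tan_def)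
    qed (use z V(2) in auto)
    ultimately show ?thesis using z p by simp
  qed
qed

text \<open>By additivity the difference of the two boundary values is a sum of two boundary values in each of
  which one field vanishes on the boundary.\<close>

lemma nabla_extension_unique:
  assumes \<rho>: "local_defining k M U \<rho>"
    and 1: "V1 \<subseteq> U" "extends_field V1 \<xi>1 X" "extends_field V1 \<eta>1 Y" "\<zeta>1 \<in> vfields M V1"
      "\<And>q. q \<in> V1 \<Longrightarrow> q \<in> intr k M \<Longrightarrow> \<zeta>1 q = \<nabla> \<rho> \<xi>1 \<eta>1 q"
    and 2: "V2 \<subseteq> U" "extends_field V2 \<xi>2 X" "extends_field V2 \<eta>2 Y" "\<zeta>2 \<in> vfields M V2"
      "\<And>q. q \<in> V2 \<Longrightarrow> q \<in> intr k M \<Longrightarrow> \<zeta>2 q = \<nabla> \<rho> \<xi>2 \<eta>2 q"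
    and p: "p \<in> V1" "p \<in> V2" "p \<in> bdry k M"
  shows "\<zeta>1 p = \<zeta>2 p"
proof -
  let ?V = "V1 \<inter> V2"
  have oV: "openin (mtop M) ?V" using vfields_openin 1(4) 2(4) by blast
  have \<rho>V: "local_defining k M ?V \<rho>" by (rule local_defining_subset[OF \<rho> oV]) (use 1(1) in blast)
  note N = nabla_connection[OF \<rho>V]
  have x1: "extends_field ?V \<xi>1 X" "extends_field ?V \<eta>1 Y" and x2: "extends_field ?V \<xi>2 X" "extends_field ?V \<eta>2 Y"
    using extends_field_subset[OF _ oV] 1(2,3) 2(2,3) by auto
  note t = extends_fieldD(1)[OF x1(1)] extends_fieldD(1)[OF x1(2)] extends_fieldD(1)[OF x2(1)] extends_fieldD(1)[OF x2(2)]
  \<comment> \<open>The coefficients 1 and -1 bring the differences into the form of \<open>vfields_tan_lincomb\<close>.\<close>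
  define d\<xi> where "d\<xi> = (\<lambda>q f. 1 * \<xi>1 q f + (-1) * \<xi>2 q f)"
  define d\<eta> where "d\<eta> = (\<lambda>q f. 1 * \<eta>1 q f + (-1) * \<eta>2 q f)"
  have d: "d\<xi> \<in> vfields_tan k M ?V" "d\<eta> \<in> vfields_tan k M ?V"
    unfolding d\<xi>_def d\<eta>_def
    by (rule vfields_tan_lincomb[OF t(1,3) smooth_funs_const[OF oV] smooth_funs_const[OF oV] \<rho>V])
      (rule vfields_tan_lincomb[OF t(2,4) smooth_funs_const[OF oV] smooth_funs_const[OF oV] \<rho>V])
  have d0: "d\<xi> q = (\<lambda>f. 0)" "d\<eta> q = (\<lambda>f. 0)" if "q \<in> ?V" "q \<in> bdry k M" for q
    using extends_fieldD(3)[OF x1(1) that] extends_fieldD(3)[OF x2(1) that]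
      extends_fieldD(3)[OF x1(2) that] extends_fieldD(3)[OF x2(2) that] by (simp_all add: d\<xi>_def d\<eta>_def)
  have tv: "X \<in> vfields M ?V" if "X \<in> vfields_tan k M ?V" for X using that by (simp add: vfields_tan_def)
  obtain \<alpha> where \<alpha>: "\<alpha> \<in> vfields M ?V" "\<forall>q\<in>?V \<inter> intr k M. \<alpha> q = \<nabla> \<rho> d\<xi> \<eta>1 q"
    using nabla_tan_extends[OF \<rho>V tv[OF d(1)] tv[OF t(2)] disjI1[OF d(1)]] by blast
  obtain \<beta> where \<beta>: "\<beta> \<in> vfields M ?V" "\<forall>q\<in>?V \<inter> intr k M. \<beta> q = \<nabla> \<rho> \<xi>2 d\<eta> q"
    using nabla_tan_extends[OF \<rho>V tv[OF t(3)] tv[OF d(2)] disjI1[OF t(3)]] by blast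
  have pV: "p \<in> ?V" using p by blast
  have \<alpha>0: "\<alpha> p = (\<lambda>f. 0)"
    by (rule nabla_extension_zero[OF \<rho>V d(1) t(2) _ \<alpha>(1) _ pV p(3)]) (use d0 \<alpha>(2) in auto)
  have \<beta>0: "\<beta> p = (\<lambda>f. 0)"
    by (rule nabla_extension_zero[OF \<rho>V t(3) d(2) _ \<beta>(1) _ pV p(3)]) (use d0 \<beta>(2) in auto)
  have "\<zeta>1 p = (\<lambda>f. \<zeta>2 p f + (\<alpha> p f + \<beta> p f))"
  proof (rule vfields_eq_of_intr[OF _ _ _ pV])
    show "\<zeta>1 \<in> vfields M ?V" by (rule vfields_subset[OF 1(4) oV]) blast
    have "\<zeta>2 \<in> vfields M ?V" by (rule vfields_subset[OF 2(4) oV]) blast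
    then show "(\<lambda>p f. \<zeta>2 p f + (\<alpha> p f + \<beta> p f)) \<in> vfields M ?V" by (intro vfields_add \<alpha>(1) \<beta>(1))
    fix q f assume q: "q \<in> ?V" "q \<in> intr k M"
    let ?I = "?V \<inter> intr k M"
    have oI: "openin (mtop M) ?I" using oV openin_intr by blast
    have I: "X \<in> vfields M ?I" if "X \<in> vfields_tan k M ?V" for X by (rule vfields_subset[OF tv[OF that] oI]) blast
    have e: "(\<lambda>q f. d\<xi> q f + \<xi>2 q f) = \<xi>1" "(\<lambda>q f. d\<eta> q f + \<eta>2 q f) = \<eta>1"
      by (simp_all add: d\<xi>_def d\<eta>_def)
    have qI: "q \<in> ?I" using q by blast
    have "\<nabla> \<rho> \<xi>1 \<eta>1 q f = \<nabla> \<rho> d\<xi> \<eta>1 q f + \<nabla> \<rho> \<xi>2 \<eta>1 q f"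
      using conn_add(1)[OF N subset_refl I[OF d(1)] I[OF t(2)] I[OF t(3)] qI] unfolding e .
    moreover have "\<nabla> \<rho> \<xi>2 \<eta>1 q f = \<nabla> \<rho> \<xi>2 d\<eta> q f + \<nabla> \<rho> \<xi>2 \<eta>2 q f"
      using conn_add(2)[OF N subset_refl I[OF t(3)] I[OF d(2)] I[OF t(4)] qI] unfolding e .
    ultimately show "\<zeta>1 q f = \<zeta>2 q f + (\<alpha> q f + \<beta> q f)"
      using 1(5)[of q] 2(5)[of q] \<alpha>(2) \<beta>(2) q by simp
  qed
  then show ?thesis by (simp add: \<alpha>0 \<beta>0)
qed

text \<open>Defined pointwise, through local extensions of the two fields; by \<open>nabla_extension_unique\<close> and
  \<open>bdry_incl_inj\<close> there is at most one such \<open>w\<close>, and by \<open>nabla_boundary_tangent\<close> there is one in the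
  totally geodesic case.\<close>

definition bdry_conn :: "('m \<Rightarrow> real) \<Rightarrow> 'm set \<Rightarrow> 'm conn" where
  "bdry_conn \<rho> U X Y p = (THE w. w \<in> tspace (bdry_mfd k M) p \<and>
     (\<exists>V \<xi> \<eta> \<zeta>. V \<subseteq> U \<and> p \<in> V \<and> extends_field V \<xi> X \<and> extends_field V \<eta> Y \<and> \<zeta> \<in> vfields M V \<and>
        (\<forall>q\<in>V \<inter> intr k M. \<zeta> q = \<nabla> \<rho> \<xi> \<eta> q) \<and> \<zeta> p = bdry_incl M p w))"

end

locale totally_geodesic_precompact_mfd = parallel_precompact_mfd M k D \<sigma>
  for M :: "('m, 'n::finite) mfd" and k :: 'n and D \<sigma> +
  assumes flat: "second_fundamental_form_vanishes k M D \<sigma>"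
begin

text \<open>Here the second fundamental form enters: it is, up to the nowhere vanishing factor
  \<open>\<sigma> / \<rho>\<close>, the boundary value of \<open>- d\<rho> (\<nabla>\<^sup>\<rho>\<^sub>\<xi> \<eta>)\<close> on tangential fields.\<close>

lemma nabla_boundary_tangent:
  assumes \<rho>: "local_defining k M U \<rho>" and \<xi>: "\<xi> \<in> vfields_tan k M U" and \<eta>: "\<eta> \<in> vfields_tan k M U"
    and \<zeta>: "\<zeta> \<in> vfields M U" "\<And>q. q \<in> U \<Longrightarrow> q \<in> intr k M \<Longrightarrow> \<zeta> q = \<nabla> \<rho> \<xi> \<eta> q"
    and p: "p \<in> U" "p \<in> bdry k M"
  shows "\<zeta> p \<in> bdry_tspace k M p"
proof (rule bdry_tspaceI[OF \<rho> p(2,1) vfields_tspace[OF \<zeta>(1) p(1)]])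
  obtain V y E s where V: "p \<in> V" "V \<subseteq> U" and cf: "coord_frame M V y E" "y k = \<rho>" and s: "s \<in> smooth_funs M V"
    "\<And>q. q \<in> V \<Longrightarrow> s q \<noteq> 0" "\<And>q. q \<in> V \<Longrightarrow> q \<in> intr k M \<Longrightarrow> \<sigma> q (\<lambda>i. E i q) = s q * \<rho> q"
    using sigma_over_rho_extends[OF \<rho> p(2,1) local_defining_openin[OF \<rho>] p(1)] by metis
  note oV = coord_frameD(1)[OF cf(1)] and E = coord_frameD(3)[OF cf(1)] and y = coord_frameD(2)[OF cf(1)]
  have \<rho>V: "local_defining k M V \<rho>" by (rule local_defining_subset[OF \<rho> oV V(2)])
  have \<xi>V: "\<xi> \<in> vfields_tan k M V" and \<eta>V: "\<eta> \<in> vfields_tan k M V"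
    using vfields_tan_subset[OF _ oV V(2)] \<xi> \<eta> by auto
  then have v: "\<xi> \<in> vfields M V" "\<eta> \<in> vfields M V" by (simp_all add: vfields_tan_def)
  have "\<exists>h\<in>smooth_funs M V. \<forall>q\<in>V \<inter> intr k M. h q = \<nabla> \<rho> (E i) (E j) q \<rho>" for i j
    by (rule nabla_conormal_extends[OF \<rho>V E E])
  then obtain h where h: "\<And>i j. h i j \<in> smooth_funs M V" "\<And>i j. \<forall>q\<in>V \<inter> intr k M. h i j q = \<nabla> \<rho> (E i) (E j) q \<rho>"
    by metis
  have tan: "\<xi> p \<in> bdry_tspace k M p" "\<eta> p \<in> bdry_tspace k M p" using \<xi> \<eta> p by (simp_all add: vfields_tan_def)
  let ?S = "\<lambda>q. \<Sum>i\<in>UNIV. \<Sum>j\<in>UNIV. \<xi> q (y i) * \<eta> q (y j) * h i j q"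
  have "second_fundamental_form k M D \<sigma> U \<rho> p (\<xi> p) (\<eta> p) (\<lambda>i. E i p) = - ?S p * s p"
    by (rule second_fundamental_form_value[OF \<rho> cf V(2,1) s(1,3) h(1)])
      (use h(2) vfields_tspace[OF v(1) V(1)] vfields_tspace[OF v(2) V(1)] in auto)
  moreover have "second_fundamental_form k M D \<sigma> U \<rho> p (\<xi> p) (\<eta> p) = (\<lambda>_. 0)"
    using flat \<rho> p tan unfolding second_fundamental_form_vanishes_def by blast
  ultimately have S0: "?S p = 0" using s(2)[OF V(1)] by simp
  have \<rho>s: "\<rho> \<in> smooth_funs M V" by (rule local_defining_smooth[OF \<rho>V])
  note \<eta>\<rho> = vfields_smooth[OF v(2) subset_refl \<rho>s]
  have "\<zeta> p \<rho> = \<xi> p (\<lambda>r. \<eta> r \<rho>) + ?S p"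
  proof (rule smooth_funs_eq_of_intr[OF _ _ _ V(1)])
    show "(\<lambda>q. \<zeta> q \<rho>) \<in> smooth_funs M V" by (rule vfields_smooth[OF \<zeta>(1) V(2) \<rho>s])
    show "(\<lambda>q. \<xi> q (\<lambda>r. \<eta> r \<rho>) + ?S q) \<in> smooth_funs M V"
      by (intro smooth_funs_add smooth_funs_sum smooth_funs_mult vfields_smooth[OF v(1) subset_refl]
          vfields_smooth[OF v(2) subset_refl] \<rho>s y h(1) oV)
    fix q assume q: "q \<in> V" "q \<in> intr k M"
    have oI: "openin (mtop M) (V \<inter> intr k M)" using oV openin_intr by blast
    have vI: "\<xi> \<in> vfields M (V \<inter> intr k M)" "\<eta> \<in> vfields M (V \<inter> intr k M)" using vfields_subset[OF _ oI] v by auto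
    have "\<zeta> q \<rho> = \<nabla> \<rho> \<xi> \<eta> q \<rho>" using \<zeta>(2)[of q] q V(2) by auto
    also have "\<dots> = \<xi> q (\<lambda>r. \<eta> r \<rho>) + ?S q"
      using nabla_conormal_expand[OF \<rho>V cf Int_lower1 subset_refl vI, of q] h(2) q by simp
    finally show "\<zeta> q \<rho> = \<xi> q (\<lambda>r. \<eta> r \<rho>) + ?S q" .
  qed
  moreover have "\<xi> p (\<lambda>r. \<eta> r \<rho>) = 0"
    by (rule bdry_tspace_vanish[OF tan(1) \<eta>\<rho> V(1)]) (use \<eta>V in \<open>simp add: vfields_tan_iff[OF \<rho>V]\<close>)
  ultimately show "\<zeta> p \<rho> = 0" using S0 by simp
qed

lemma bdry_conn_eq:
  assumes \<rho>: "local_defining k M U \<rho>" and V: "V \<subseteq> U" and x: "extends_field V \<xi> X" "extends_field V \<eta> Y"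
    and \<zeta>: "\<zeta> \<in> vfields M V" "\<And>q. q \<in> V \<Longrightarrow> q \<in> intr k M \<Longrightarrow> \<zeta> q = \<nabla> \<rho> \<xi> \<eta> q"
    and p: "p \<in> V" "p \<in> bdry k M"
  shows "bdry_conn \<rho> U X Y p \<in> tspace (bdry_mfd k M) p" "bdry_incl M p (bdry_conn \<rho> U X Y p) = \<zeta> p"
proof -
  have \<rho>V: "local_defining k M V \<rho>" by (rule local_defining_subset[OF \<rho> vfields_openin[OF \<zeta>(1)] V])
  have "\<zeta> p \<in> bdry_tspace k M p"
    by (rule nabla_boundary_tangent[OF \<rho>V extends_fieldD(1)[OF x(1)] extends_fieldD(1)[OF x(2)] \<zeta> p])
  then obtain w where w: "w \<in> tspace (bdry_mfd k M) p" "\<zeta> p = bdry_incl M p w" unfolding bdry_tspace_def by blast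
  have "bdry_conn \<rho> U X Y p = w"
    unfolding bdry_conn_def
  proof (rule the_equality, intro conjI exI)
    show "w \<in> tspace (bdry_mfd k M) p" "V \<subseteq> U" "p \<in> V" "extends_field V \<xi> X" "extends_field V \<eta> Y"
      "\<zeta> \<in> vfields M V" "\<zeta> p = bdry_incl M p w" by fact+
    show "\<forall>q\<in>V \<inter> intr k M. \<zeta> q = \<nabla> \<rho> \<xi> \<eta> q" using \<zeta>(2) by blast
    fix w' assume "w' \<in> tspace (bdry_mfd k M) p \<and>
     (\<exists>V \<xi> \<eta> \<zeta>. V \<subseteq> U \<and> p \<in> V \<and> extends_field V \<xi> X \<and> extends_field V \<eta> Y \<and> \<zeta> \<in> vfields M V \<and>
        (\<forall>q\<in>V \<inter> intr k M. \<zeta> q = \<nabla> \<rho> \<xi> \<eta> q) \<and> \<zeta> p = bdry_incl M p w')"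
    then obtain V' \<xi>' \<eta>' \<zeta>' where w': "w' \<in> tspace (bdry_mfd k M) p" "V' \<subseteq> U" "p \<in> V'" "extends_field V' \<xi>' X"
      "extends_field V' \<eta>' Y" "\<zeta>' \<in> vfields M V'" "\<forall>q\<in>V' \<inter> intr k M. \<zeta>' q = \<nabla> \<rho> \<xi>' \<eta>' q" "\<zeta>' p = bdry_incl M p w'"
      by (elim conjE exE) rule
    have "\<zeta>' p = \<zeta> p"
      by (rule nabla_extension_unique[OF \<rho> w'(2,4,5,6) _ V x \<zeta> w'(3) p]) (use w'(7) in auto)
    then show "w' = w" using bdry_incl_inj[OF w'(1) w(1)] w'(8) w(2) by simp
  qed
  then show "bdry_conn \<rho> U X Y p \<in> tspace (bdry_mfd k M) p" "bdry_incl M p (bdry_conn \<rho> U X Y p) = \<zeta> p"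
    using w by simp_all
qed

lemma bdry_conn_tspace:
  assumes \<rho>: "local_defining k M U \<rho>" and W: "W \<subseteq> U \<inter> bdry k M"
    and X: "X \<in> vfields (bdry_mfd k M) W" "Y \<in> vfields (bdry_mfd k M) W" and p: "p \<in> W"
  shows "bdry_conn \<rho> U X Y p \<in> tspace (bdry_mfd k M) p"
proof -
  obtain V \<xi> \<eta> where V: "p \<in> V" "V \<subseteq> U" "openin (mtop M) V" and x: "extends_field V \<xi> X" "extends_field V \<eta> Y"
    using extends_field3_exists[OF X X(1) W local_defining_openin[OF \<rho>] p] by metis
  have \<rho>V: "local_defining k M V \<rho>" by (rule local_defining_subset[OF \<rho> V(3,2)])
  obtain \<zeta> where \<zeta>: "\<zeta> \<in> vfields M V" "\<forall>q\<in>V \<inter> intr k M. \<zeta> q = \<nabla> \<rho> \<xi> \<eta> q"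
    using nabla_tan_extends[OF \<rho>V extends_fieldD(2)[OF x(1)] extends_fieldD(2)[OF x(2)] disjI1[OF extends_fieldD(1)[OF x(1)]]]
    by blast
  show ?thesis
    by (rule bdry_conn_eq(1)[OF \<rho> V(2) x \<zeta>(1) _ V(1)]) (use \<zeta>(2) p W in auto)
qed

text \<open>All identities hold in the interior for extensions of the boundary fields and of the functions, with
  \<open>\<nabla>\<^sup>\<rho>\<close> in place of the boundary connection; they are restricted to the boundary by continuity.\<close>

lemma bdry_conn_connection:
  assumes \<rho>: "local_defining k M U \<rho>"
  shows "linear_connection (bdry_mfd k M) (U \<inter> bdry k M) (bdry_conn \<rho> U)"
    and "torsion_free (bdry_mfd k M) (U \<inter> bdry k M) (bdry_conn \<rho> U)"
proof -
  let ?N = "bdry_mfd k M" and ?C = "bdry_conn \<rho> U"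
  note oU = local_defining_openin[OF \<rho>]
  have ext: "\<exists>\<zeta>. \<zeta> \<in> vfields M V \<and> (\<forall>q\<in>V \<inter> intr k M. \<zeta> q = \<nabla> \<rho> \<xi> \<eta> q)"
    if V: "V \<subseteq> U" "openin (mtop M) V" and x: "extends_field V \<xi> X" "extends_field V \<eta> Y" for V \<xi> \<eta> X Y
    using nabla_tan_extends[OF local_defining_subset[OF \<rho> V(2,1)] extends_fieldD(2)[OF x(1)] extends_fieldD(2)[OF x(2)]
        disjI1[OF extends_fieldD(1)[OF x(1)]]] by blast
  have smooth: "?C X Y \<in> vfields ?N W"
    if W: "W \<subseteq> U \<inter> bdry k M" and X: "X \<in> vfields ?N W" and Y: "Y \<in> vfields ?N W" for W X Y
  proof (rule bdry.vfieldsI[OF bdry.vfields_openin[OF X] bdry_conn_tspace[OF \<rho> W X Y]])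
    fix S f assume S: "S \<subseteq> W" and f: "f \<in> smooth_funs ?N S"
    have oS: "openin (mtop ?N) S" by (rule bdry.smooth_funs_openin[OF f])
    show "(\<lambda>p. ?C X Y p f) \<in> smooth_funs ?N S"
    proof (rule bdry.smooth_funs_local)
      fix p assume p: "p \<in> S"
      have XS: "X \<in> vfields ?N S" "Y \<in> vfields ?N S" using bdry.vfields_subset[OF _ oS S] X Y by auto
      have SU: "S \<subseteq> U \<inter> bdry k M" using S W by blast
      obtain V \<xi> \<eta> where V: "p \<in> V" "V \<subseteq> U" "V \<inter> bdry k M \<subseteq> S" "openin (mtop M) V"
        and x: "extends_field V \<xi> X" "extends_field V \<eta> Y"
        using extends_field3_exists[OF XS XS(1) SU oU p] by metis
      obtain \<zeta> where \<zeta>: "\<zeta> \<in> vfields M V" "\<forall>q\<in>V \<inter> intr k M. \<zeta> q = \<nabla> \<rho> \<xi> \<eta> q" using ext[OF V(2,4) x] by blast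
      obtain V1 f' where f': "p \<in> V1" "f' \<in> smooth_funs M V1" "\<And>q. q \<in> V1 \<Longrightarrow> q \<in> bdry k M \<Longrightarrow> f' q = f q"
        using smooth_funs_extend[OF f p] by metis
      have fV: "f' \<in> smooth_funs M (V \<inter> V1)" by (rule smooth_funs_Int[OF f'(2) V(4)])
      have "(\<lambda>q. \<zeta> q f') \<in> smooth_funs M (V \<inter> V1)" by (rule vfields_smooth[OF \<zeta>(1) _ fV]) blast
      then have "(\<lambda>q. \<zeta> q f') \<in> smooth_funs ?N (V \<inter> V1 \<inter> bdry k M)" by (rule smooth_funs_restrict)
      then have "(\<lambda>q. ?C X Y q f) \<in> smooth_funs ?N (V \<inter> V1 \<inter> bdry k M)"
      proof (rule bdry.smooth_funs_cong)
        fix q assume q: "q \<in> V \<inter> V1 \<inter> bdry k M"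
        have c: "?C X Y q \<in> tspace ?N q" "bdry_incl M q (?C X Y q) = \<zeta> q"
          using bdry_conn_eq[OF \<rho> V(2) x \<zeta>(1), of q] \<zeta>(2) q by auto
        have "?C X Y q f = bdry_incl M q (?C X Y q) f'"
          by (rule bdry_incl_extend[OF c(1) fV]) (use q f'(3) in auto)
        then show "\<zeta> q f' = ?C X Y q f" using c(2) by simp
      qed
      then show "\<exists>V. p \<in> V \<and> V \<subseteq> S \<and> (\<lambda>p. ?C X Y p f) \<in> smooth_funs ?N V"
        using V(1,3) f'(1) p SU by (intro exI[of _ "V \<inter> V1 \<inter> bdry k M"]) auto
    qed
  qed
  show "linear_connection ?N (U \<inter> bdry k M) ?C"
    unfolding linear_connection_def
  proof (intro conjI allI impI ballI; (elim conjE)?)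
    show "openin (mtop ?N) (U \<inter> bdry k M)" by (rule openin_bdryI[OF oU])
    fix W X Y assume W: "W \<subseteq> U \<inter> bdry k M" and X: "X \<in> vfields ?N W" and Y: "Y \<in> vfields ?N W"
    show "?C X Y \<in> vfields ?N W" by (rule smooth[OF W X Y])
    note tsp = bdry_conn_tspace[OF \<rho> W]
    have Xt: "X q \<in> tspace ?N q" "Y q \<in> tspace ?N q" if "q \<in> W" for q
      using bdry.vfields_tspace X Y that by auto
    show "?C X' Y' p = ?C X Y p"
      if X': "X' \<in> vfields ?N W" "Y' \<in> vfields ?N W" "\<forall>p\<in>W. X' p = X p \<and> Y' p = Y p" "p \<in> W" for X' Y' p
    proof -
      obtain V \<xi> \<eta> where V: "p \<in> V" "V \<subseteq> U" "V \<inter> bdry k M \<subseteq> W" "openin (mtop M) V"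
        and x: "extends_field V \<xi> X" "extends_field V \<eta> Y"
        using extends_field3_exists[OF X Y X W oU X'(4)] by metis
      obtain \<zeta> where \<zeta>: "\<zeta> \<in> vfields M V" "\<forall>q\<in>V \<inter> intr k M. \<zeta> q = \<nabla> \<rho> \<xi> \<eta> q" using ext[OF V(2,4) x] by blast
      have x': "extends_field V \<xi> X'" "extends_field V \<eta> Y'"
        using x V(3) X'(3) unfolding extends_field_def by auto
      have pb: "p \<in> bdry k M" using X'(4) W by blast
      have "bdry_incl M p (?C X Y p) = \<zeta> p"
        by (rule bdry_conn_eq(2)[OF \<rho> V(2) x \<zeta>(1) _ V(1) pb]) (use \<zeta>(2) in blast)
      moreover have "bdry_incl M p (?C X' Y' p) = \<zeta> p"
        by (rule bdry_conn_eq(2)[OF \<rho> V(2) x' \<zeta>(1) _ V(1) pb]) (use \<zeta>(2) in blast)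
      ultimately show ?thesis using bdry_incl_inj tsp X Y X'(1,2,4) by metis
    qed
    fix p f assume p: "p \<in> W"
    have pb: "p \<in> bdry k M" using p W by blast
    show "?C (\<lambda>q g. X q g + Z q g) Y p f = ?C X Y p f + ?C Z Y p f"
      and "?C X (\<lambda>q g. Y q g + Z q g) p f = ?C X Y p f + ?C X Z p f"
      if Z: "Z \<in> vfields ?N W" for Z
    proof -
      obtain V \<xi> \<eta> \<omega> where V: "p \<in> V" "V \<subseteq> U" "V \<inter> bdry k M \<subseteq> W" "openin (mtop M) V"
        and x: "extends_field V \<xi> X" "extends_field V \<eta> Y" "extends_field V \<omega> Z"
        using extends_field3_exists[OF X Y Z W oU p] by metis
      have \<rho>V: "local_defining k M V \<rho>" by (rule local_defining_subset[OF \<rho> V(4,2)])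
      note N = nabla_connection[OF \<rho>V]
      have oI: "openin (mtop M) (V \<inter> intr k M)" using V(4) openin_intr by blast
      have I: "\<xi> \<in> vfields M (V \<inter> intr k M)" "\<eta> \<in> vfields M (V \<inter> intr k M)" "\<omega> \<in> vfields M (V \<inter> intr k M)"
        using vfields_subset[OF _ oI] x[THEN extends_fieldD(2)] by auto
      note xf = x[THEN extends_fieldD(2)]
      have Zt: "Z q \<in> tspace ?N q" if "q \<in> W" for q using bdry.vfields_tspace[OF Z that] .
      have sumX: "extends_field V (\<lambda>q g. \<xi> q g + \<omega> q g) (\<lambda>q g. X q g + Z q g)"
        by (rule extends_fieldI[OF vfields_add[OF xf(1,3)]])
          (use V(3) x[THEN extends_fieldD(3)] bdry.tspace_lincomb[OF Xt(1) Zt, where a=1 and b=1] in \<open>auto simp: bdry_incl_add\<close>)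
      have sumY: "extends_field V (\<lambda>q g. \<eta> q g + \<omega> q g) (\<lambda>q g. Y q g + Z q g)"
        by (rule extends_fieldI[OF vfields_add[OF xf(2,3)]])
          (use V(3) x[THEN extends_fieldD(3)] bdry.tspace_lincomb[OF Xt(2) Zt, where a=1 and b=1] in \<open>auto simp: bdry_incl_add\<close>)
      obtain \<zeta> where \<zeta>: "\<zeta> \<in> vfields M V" "\<forall>q\<in>V \<inter> intr k M. \<zeta> q = \<nabla> \<rho> \<xi> \<eta> q" using ext[OF V(2,4) x(1,2)] by blast
      obtain \<zeta>1 where \<zeta>1: "\<zeta>1 \<in> vfields M V" "\<forall>q\<in>V \<inter> intr k M. \<zeta>1 q = \<nabla> \<rho> \<omega> \<eta> q" using ext[OF V(2,4) x(3,2)] by blast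
      obtain \<zeta>2 where \<zeta>2: "\<zeta>2 \<in> vfields M V" "\<forall>q\<in>V \<inter> intr k M. \<zeta>2 q = \<nabla> \<rho> \<xi> \<omega> q" using ext[OF V(2,4) x(1,3)] by blast
      have c: "bdry_incl M p (?C X Y p) = \<zeta> p" "?C X Y p \<in> tspace ?N p"
        using bdry_conn_eq[OF \<rho> V(2) x(1,2) \<zeta>(1) _ V(1) pb] \<zeta>(2) by auto
      have c1: "bdry_incl M p (?C Z Y p) = \<zeta>1 p" "?C Z Y p \<in> tspace ?N p"
        using bdry_conn_eq[OF \<rho> V(2) x(3,2) \<zeta>1(1) _ V(1) pb] \<zeta>1(2) by auto
      have c2: "bdry_incl M p (?C X Z p) = \<zeta>2 p" "?C X Z p \<in> tspace ?N p"
        using bdry_conn_eq[OF \<rho> V(2) x(1,3) \<zeta>2(1) _ V(1) pb] \<zeta>2(2) by auto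
      have e1: "(\<lambda>g. \<zeta> q g + \<zeta>1 q g) = \<nabla> \<rho> (\<lambda>q g. \<xi> q g + \<omega> q g) \<eta> q"
        and e2: "(\<lambda>g. \<zeta> q g + \<zeta>2 q g) = \<nabla> \<rho> \<xi> (\<lambda>q g. \<eta> q g + \<omega> q g) q"
        if q: "q \<in> V" "q \<in> intr k M" for q
        using conn_add[OF N subset_refl I, of q] \<zeta>(2) \<zeta>1(2) \<zeta>2(2) q by (auto simp: fun_eq_iff)
      have s1: "bdry_incl M p (?C (\<lambda>q g. X q g + Z q g) Y p) = (\<lambda>g. \<zeta> p g + \<zeta>1 p g)"
          "?C (\<lambda>q g. X q g + Z q g) Y p \<in> tspace ?N p"
        using bdry_conn_eq[OF \<rho> V(2) sumX x(2) vfields_add[OF \<zeta>(1) \<zeta>1(1)] e1 V(1) pb] by auto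
      have s2: "bdry_incl M p (?C X (\<lambda>q g. Y q g + Z q g) p) = (\<lambda>g. \<zeta> p g + \<zeta>2 p g)"
          "?C X (\<lambda>q g. Y q g + Z q g) p \<in> tspace ?N p"
        using bdry_conn_eq[OF \<rho> V(2) x(1) sumY vfields_add[OF \<zeta>(1) \<zeta>2(1)] e2 V(1) pb] by auto
      have "?C (\<lambda>q g. X q g + Z q g) Y p = (\<lambda>f. ?C X Y p f + ?C Z Y p f)"
        by (rule bdry_incl_inj[OF s1(2)]) (use bdry.tspace_lincomb[OF c(2) c1(2), of 1 1] s1(1) c(1) c1(1) in \<open>simp_all add: bdry_incl_add\<close>)
      then show "?C (\<lambda>q g. X q g + Z q g) Y p f = ?C X Y p f + ?C Z Y p f" by (rule fun_cong)
      have "?C X (\<lambda>q g. Y q g + Z q g) p = (\<lambda>f. ?C X Y p f + ?C X Z p f)"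
        by (rule bdry_incl_inj[OF s2(2)]) (use bdry.tspace_lincomb[OF c(2) c2(2), of 1 1] s2(1) c(1) c2(1) in \<open>simp_all add: bdry_incl_add\<close>)
      then show "?C X (\<lambda>q g. Y q g + Z q g) p f = ?C X Y p f + ?C X Z p f" by (rule fun_cong)
    qed
    show "?C (\<lambda>q g. h q * X q g) Y p f = h p * ?C X Y p f"
      and "?C X (\<lambda>q g. h q * Y q g) p f = X p h * Y p f + h p * ?C X Y p f"
      if h: "h \<in> smooth_funs ?N W" for h
    proof -
      obtain V0 \<xi> \<eta> where V0: "p \<in> V0" "V0 \<subseteq> U" "V0 \<inter> bdry k M \<subseteq> W" "openin (mtop M) V0"
        and x0: "extends_field V0 \<xi> X" "extends_field V0 \<eta> Y"
        using extends_field3_exists[OF X Y X W oU p] by metis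
      obtain V1 h' where h1: "p \<in> V1" "h' \<in> smooth_funs M V1" "\<And>q. q \<in> V1 \<Longrightarrow> q \<in> bdry k M \<Longrightarrow> h' q = h q"
        using smooth_funs_extend[OF h p] by metis
      define V where "V = V0 \<inter> V1"
      have h': "h' \<in> smooth_funs M V" unfolding V_def by (rule smooth_funs_Int[OF h1(2) V0(4)])
      have hh: "h' q = h q" if "q \<in> V" "q \<in> bdry k M" for q using h1(3) that by (simp add: V_def)
      have V: "p \<in> V" "V \<subseteq> U" "V \<inter> bdry k M \<subseteq> W" "openin (mtop M) V"
        using V0 h1(1) smooth_funs_openin[OF h'] by (auto simp: V_def)
      have x: "extends_field V \<xi> X" "extends_field V \<eta> Y"
        using extends_field_subset[OF _ V(4)] x0 by (auto simp: V_def)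
      have \<rho>V: "local_defining k M V \<rho>" by (rule local_defining_subset[OF \<rho> V(4,2)])
      note N = nabla_connection[OF \<rho>V]
      have oI: "openin (mtop M) (V \<inter> intr k M)" using V(4) openin_intr by blast
      note xf = x[THEN extends_fieldD(2)]
      have I: "\<xi> \<in> vfields M (V \<inter> intr k M)" "\<eta> \<in> vfields M (V \<inter> intr k M)"
        using vfields_subset[OF _ oI] xf by auto
      have hI: "h' \<in> smooth_funs M (V \<inter> intr k M)" by (rule smooth_funs_subset[OF h' oI]) blast
      have hX: "extends_field V (\<lambda>q g. h' q * \<xi> q g) (\<lambda>q g. h q * X q g)"
        by (rule extends_fieldI[OF vfields_scale[OF xf(1) h']])
          (use V(3) hh x[THEN extends_fieldD(3)] bdry.tspace_lincomb[OF Xt(1) Xt(1), where b=0] in \<open>auto simp: bdry_incl_mult\<close>)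
      have hY: "extends_field V (\<lambda>q g. h' q * \<eta> q g) (\<lambda>q g. h q * Y q g)"
        by (rule extends_fieldI[OF vfields_scale[OF xf(2) h']])
          (use V(3) hh x[THEN extends_fieldD(3)] bdry.tspace_lincomb[OF Xt(2) Xt(2), where b=0] in \<open>auto simp: bdry_incl_mult\<close>)
      obtain \<zeta> where \<zeta>: "\<zeta> \<in> vfields M V" "\<forall>q\<in>V \<inter> intr k M. \<zeta> q = \<nabla> \<rho> \<xi> \<eta> q" using ext[OF V(2,4) x] by blast
      have c: "bdry_incl M p (?C X Y p) = \<zeta> p" "?C X Y p \<in> tspace ?N p"
        using bdry_conn_eq[OF \<rho> V(2) x \<zeta>(1) _ V(1) pb] \<zeta>(2) by auto
      have e1: "(\<lambda>g. h' q * \<zeta> q g) = \<nabla> \<rho> (\<lambda>q g. h' q * \<xi> q g) \<eta> q"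
        and e2: "(\<lambda>g. \<xi> q h' * \<eta> q g + h' q * \<zeta> q g) = \<nabla> \<rho> \<xi> (\<lambda>q g. h' q * \<eta> q g) q"
        if q: "q \<in> V" "q \<in> intr k M" for q
        using conn_scale[OF N subset_refl I hI, of q] \<zeta>(2) q by (auto simp: fun_eq_iff)
      have s1: "bdry_incl M p (?C (\<lambda>q g. h q * X q g) Y p) = (\<lambda>g. h' p * \<zeta> p g)"
          "?C (\<lambda>q g. h q * X q g) Y p \<in> tspace ?N p"
        using bdry_conn_eq[OF \<rho> V(2) hX x(2) vfields_scale[OF \<zeta>(1) h'] e1 V(1) pb] by auto
      have s2: "bdry_incl M p (?C X (\<lambda>q g. h q * Y q g) p) = (\<lambda>g. \<xi> p h' * \<eta> p g + h' p * \<zeta> p g)"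
          "?C X (\<lambda>q g. h q * Y q g) p \<in> tspace ?N p"
        using bdry_conn_eq[OF \<rho> V(2) x(1) hY vfields_lincomb[OF xf(2) \<zeta>(1) vfields_smooth[OF xf(1) subset_refl h'] h'] e2 V(1) pb] by auto
      have hp: "h' p = h p" by (rule hh[OF V(1) pb])
      have \<xi>h: "\<xi> p h' = X p h" by (rule extends_field_apply[OF x(1) Xt(1)[OF p] V(1) h' hh])
      have \<eta>p: "\<eta> p = bdry_incl M p (Y p)" by (rule extends_fieldD(3)[OF x(2) V(1) pb])
      have "?C (\<lambda>q g. h q * X q g) Y p = (\<lambda>f. h p * ?C X Y p f)"
        by (rule bdry_incl_inj[OF s1(2)])
          (use bdry.tspace_lincomb[OF c(2) c(2), of "h p" 0] s1(1) c(1) hp in \<open>simp_all add: bdry_incl_mult\<close>)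
      then show "?C (\<lambda>q g. h q * X q g) Y p f = h p * ?C X Y p f" by (rule fun_cong)
      have "?C X (\<lambda>q g. h q * Y q g) p = (\<lambda>f. X p h * Y p f + h p * ?C X Y p f)"
        by (rule bdry_incl_inj[OF s2(2) bdry.tspace_lincomb[OF Xt(2)[OF p] c(2)]])
          (use s2(1) c(1) hp \<xi>h \<eta>p in \<open>simp add: bdry_incl_lincomb\<close>)
      then show "?C X (\<lambda>q g. h q * Y q g) p f = X p h * Y p f + h p * ?C X Y p f" by (rule fun_cong)
    qed
  qed
  show "torsion_free ?N (U \<inter> bdry k M) ?C"
    unfolding torsion_free_def
  proof (intro allI impI ballI; elim conjE)
    fix W X Y p f assume W: "W \<subseteq> U \<inter> bdry k M" and X: "X \<in> vfields ?N W" and Y: "Y \<in> vfields ?N W" and p: "p \<in> W"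
    have t: "?C X Y p \<in> tspace ?N p" "?C Y X p \<in> tspace ?N p"
      using bdry_conn_tspace[OF \<rho> W] X Y p by auto
    show "?C X Y p f - ?C Y X p f = lie_bracket ?N X Y p f"
    proof (cases "smooth_at ?N p f")
      case False
      then show ?thesis using bdry.tspace_nonsmooth[OF t(1)] bdry.tspace_nonsmooth[OF t(2)] by (simp add: lie_bracket_def)
    next
      case True
      have pb: "p \<in> bdry k M" using p W by blast
      obtain S where "p \<in> S" "f \<in> smooth_funs ?N S" using True unfolding smooth_at_def by blast
      then obtain V1 f' where f1: "p \<in> V1" "f' \<in> smooth_funs M V1" "\<And>q. q \<in> V1 \<Longrightarrow> q \<in> bdry k M \<Longrightarrow> f' q = f q"
        using smooth_funs_extend by metis
      obtain V0 \<xi> \<eta> where V0: "p \<in> V0" "V0 \<subseteq> U" "V0 \<inter> bdry k M \<subseteq> W" "openin (mtop M) V0"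
        and x0: "extends_field V0 \<xi> X" "extends_field V0 \<eta> Y"
        using extends_field3_exists[OF X Y X W oU p] by metis
      define V where "V = V0 \<inter> V1"
      have f': "f' \<in> smooth_funs M V" unfolding V_def by (rule smooth_funs_Int[OF f1(2) V0(4)])
      have ff: "f' q = f q" if "q \<in> V" "q \<in> bdry k M" for q using f1(3) that by (simp add: V_def)
      have V: "p \<in> V" "V \<subseteq> U" "V \<inter> bdry k M \<subseteq> W" "openin (mtop M) V"
        using V0 f1(1) smooth_funs_openin[OF f'] by (auto simp: V_def)
      have x: "extends_field V \<xi> X" "extends_field V \<eta> Y"
        using extends_field_subset[OF _ V(4)] x0 by (auto simp: V_def)
      note xf = x[THEN extends_fieldD(2)]
      have oI: "openin (mtop M) (V \<inter> intr k M)" using V(4) openin_intr by blast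
      have I: "\<xi> \<in> vfields M (V \<inter> intr k M)" "\<eta> \<in> vfields M (V \<inter> intr k M)"
        using vfields_subset[OF _ oI] xf by auto
      obtain \<zeta> where \<zeta>: "\<zeta> \<in> vfields M V" "\<forall>q\<in>V \<inter> intr k M. \<zeta> q = \<nabla> \<rho> \<xi> \<eta> q" using ext[OF V(2,4) x] by blast
      obtain \<zeta>1 where \<zeta>1: "\<zeta>1 \<in> vfields M V" "\<forall>q\<in>V \<inter> intr k M. \<zeta>1 q = \<nabla> \<rho> \<eta> \<xi> q" using ext[OF V(2,4) x(2,1)] by blast
      have c: "bdry_incl M p (?C X Y p) = \<zeta> p" "bdry_incl M p (?C Y X p) = \<zeta>1 p"
        using bdry_conn_eq(2)[OF \<rho> V(2) x \<zeta>(1) _ V(1) pb] \<zeta>(2)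
          bdry_conn_eq(2)[OF \<rho> V(2) x(2,1) \<zeta>1(1) _ V(1) pb] \<zeta>1(2) by auto
      have sm: "(\<lambda>q. \<xi> q f') \<in> smooth_funs M V" "(\<lambda>q. \<eta> q f') \<in> smooth_funs M V"
        using vfields_smooth[OF _ subset_refl f'] xf by auto
      have "\<zeta> p f' - \<zeta>1 p f' = \<xi> p (\<lambda>q. \<eta> q f') - \<eta> p (\<lambda>q. \<xi> q f')"
      proof (rule smooth_funs_eq_of_intr[OF _ _ _ V(1)])
        show "(\<lambda>q. \<zeta> q f' - \<zeta>1 q f') \<in> smooth_funs M V"
          by (intro smooth_funs_diff vfields_smooth[OF \<zeta>(1) subset_refl f'] vfields_smooth[OF \<zeta>1(1) subset_refl f'])
        show "(\<lambda>p. \<xi> p (\<lambda>q. \<eta> q f') - \<eta> p (\<lambda>q. \<xi> q f')) \<in> smooth_funs M V"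
          by (intro smooth_funs_diff vfields_smooth[OF xf(1) subset_refl sm(2)] vfields_smooth[OF xf(2) subset_refl sm(1)])
        fix q assume q: "q \<in> V" "q \<in> intr k M"
        have "\<nabla> \<rho> \<xi> \<eta> q f' - \<nabla> \<rho> \<eta> \<xi> q f' = lie_bracket M \<xi> \<eta> q f'"
          using nabla_torsion_free[of U \<rho>] I q V(2) unfolding torsion_free_def by blast
        then show "\<zeta> q f' - \<zeta>1 q f' = \<xi> q (\<lambda>q. \<eta> q f') - \<eta> q (\<lambda>q. \<xi> q f')"
          using \<zeta>(2) \<zeta>1(2) q smooth_atI[OF f' q(1)] by (simp add: lie_bracket_def)
      qed
      moreover have "?C X Y p f = \<zeta> p f'" "?C Y X p f = \<zeta>1 p f'"
        using bdry_incl_extend[OF t(1) f' V(1) ff] bdry_incl_extend[OF t(2) f' V(1) ff] c by simp_all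
      moreover have "\<xi> p (\<lambda>q. \<eta> q f') = X p (\<lambda>q. Y q f)"
        by (rule extends_field_apply[OF x(1) bdry.vfields_tspace[OF X p] V(1) sm(2)])
          (use extends_field_apply[OF x(2) bdry.vfields_tspace[OF Y] _ f' ff] V(3) in blast)
      moreover have "\<eta> p (\<lambda>q. \<xi> q f') = Y p (\<lambda>q. X q f)"
        by (rule extends_field_apply[OF x(2) bdry.vfields_tspace[OF Y p] V(1) sm(1)])
          (use extends_field_apply[OF x(1) bdry.vfields_tspace[OF X] _ f' ff] V(3) in blast)
      ultimately show ?thesis using True by (simp add: lie_bracket_def)
    qed
  qed
qed

lemma bdry_conn_restricts:
  assumes \<rho>: "local_defining k M U \<rho>"
  shows "restricts_to_boundary k M U (\<nabla> \<rho>) (bdry_conn \<rho> U)"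
  unfolding restricts_to_boundary_def
proof (intro conjI allI impI bdry_conn_connection(1)[OF \<rho>]; elim conjE)
  fix V \<xi> \<eta> \<xi>b \<eta>b
  assume V: "V \<subseteq> U" and \<xi>: "\<xi> \<in> vfields_tan k M V" and \<eta>: "\<eta> \<in> vfields_tan k M V"
    and b: "\<forall>p\<in>V \<inter> bdry k M. \<xi> p = bdry_incl M p (\<xi>b p) \<and> \<eta> p = bdry_incl M p (\<eta>b p)"
  have v: "\<xi> \<in> vfields M V" "\<eta> \<in> vfields M V" using \<xi> \<eta> by (simp_all add: vfields_tan_def)
  have x: "extends_field V \<xi> \<xi>b" "extends_field V \<eta> \<eta>b" using \<xi> \<eta> b unfolding extends_field_def by auto
  obtain \<zeta> where \<zeta>: "\<zeta> \<in> vfields M V" "\<forall>q\<in>V \<inter> intr k M. \<zeta> q = \<nabla> \<rho> \<xi> \<eta> q"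
    using nabla_tan_extends[OF local_defining_subset[OF \<rho> vfields_openin[OF v(1)] V] v disjI1[OF \<xi>]] by blast
  have "\<zeta> p = bdry_incl M p (bdry_conn \<rho> U \<xi>b \<eta>b p)" if "p \<in> V \<inter> bdry k M" for p
    using bdry_conn_eq(2)[OF \<rho> V x \<zeta>(1), of p] \<zeta>(2) that by auto
  then show "\<exists>\<zeta>\<in>vfields M V. (\<forall>p\<in>V \<inter> intr k M. \<zeta> p = \<nabla> \<rho> \<xi> \<eta> p) \<and>
      (\<forall>p\<in>V \<inter> bdry k M. \<zeta> p = bdry_incl M p (bdry_conn \<rho> U \<xi>b \<eta>b p))"
    using \<zeta> by blast
qed

end

section \<open>Change of the defining function and the projective structure\<close>

context smooth_mfd
begin

lemma one_forms_subset: "\<Upsilon> \<in> one_forms M S \<Longrightarrow> openin (mtop M) S' \<Longrightarrow> S' \<subseteq> S \<Longrightarrow> \<Upsilon> \<in> one_forms M S'"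
  unfolding one_forms_def by (simp add: subset_eq)

lemma one_forms_lincomb:
  assumes "\<Upsilon> \<in> one_forms M S" "\<Theta> \<in> one_forms M S"
  shows "(\<lambda>p v. a * \<Upsilon> p v + b * \<Theta> p v) \<in> one_forms M S"
proof -
  have "(\<lambda>p. a * \<Upsilon> p (X p) + b * \<Theta> p (X p)) \<in> smooth_funs M V" if "V \<subseteq> S" "X \<in> vfields M V" for V X
    by (intro smooth_funs_add smooth_funs_cmult one_forms_smooth[OF assms(1) that] one_forms_smooth[OF assms(2) that])
  moreover have "openin (mtop M) S" using assms(1) unfolding one_forms_def by blast
  ultimately show ?thesis
    using one_forms_lin[OF assms(1)] one_forms_lin[OF assms(2)]
    by (simp add: one_forms_def algebra_simps)
qed

lemma proj_equivalent_refl: "openin (mtop M) S \<Longrightarrow> proj_equivalent M S D D"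
  unfolding proj_equivalent_def agree_on_def proj_change_def
  by (rule bexI[of _ "\<lambda>p v. 0"]) (auto simp: one_forms_def intro: smooth_funs_const vfields_openin)

lemma proj_equivalent_sym:
  assumes "proj_equivalent M S D D'"
  shows "proj_equivalent M S D' D"
proof -
  obtain \<Upsilon> where \<Upsilon>: "\<Upsilon> \<in> one_forms M S" "agree_on M S D' (proj_change D \<Upsilon>)"
    using assms unfolding proj_equivalent_def by blast
  have "(\<lambda>p v. (-1) * \<Upsilon> p v + 0 * \<Upsilon> p v) \<in> one_forms M S" by (rule one_forms_lincomb[OF \<Upsilon>(1,1)])
  moreover have "agree_on M S D (proj_change D' (\<lambda>p v. (-1) * \<Upsilon> p v + 0 * \<Upsilon> p v))"
    using \<Upsilon>(2) unfolding agree_on_def proj_change_def by (auto simp: fun_eq_iff)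
  ultimately show ?thesis unfolding proj_equivalent_def by blast
qed

lemma proj_equivalent_trans:
  assumes "proj_equivalent M S D1 D2" "proj_equivalent M S D2 D3"
  shows "proj_equivalent M S D1 D3"
proof -
  obtain \<Upsilon> where \<Upsilon>: "\<Upsilon> \<in> one_forms M S" "agree_on M S D2 (proj_change D1 \<Upsilon>)"
    using assms(1) unfolding proj_equivalent_def by blast
  obtain \<Theta> where \<Theta>: "\<Theta> \<in> one_forms M S" "agree_on M S D3 (proj_change D2 \<Theta>)"
    using assms(2) unfolding proj_equivalent_def by blast
  have "(\<lambda>p v. 1 * \<Upsilon> p v + 1 * \<Theta> p v) \<in> one_forms M S" by (rule one_forms_lincomb[OF \<Upsilon>(1) \<Theta>(1)])
  moreover have "agree_on M S D3 (proj_change D1 (\<lambda>p v. 1 * \<Upsilon> p v + 1 * \<Theta> p v))"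
    using \<Upsilon>(2) \<Theta>(2) unfolding agree_on_def proj_change_def by (auto simp: fun_eq_iff algebra_simps)
  ultimately show ?thesis unfolding proj_equivalent_def by blast
qed

lemma proj_equivalent_subset:
  assumes "proj_equivalent M S D D'" "openin (mtop M) S'" "S' \<subseteq> S"
  shows "proj_equivalent M S' D D'"
proof -
  obtain \<Upsilon> where \<Upsilon>: "\<Upsilon> \<in> one_forms M S" "agree_on M S D' (proj_change D \<Upsilon>)"
    using assms unfolding proj_equivalent_def by blast
  have "agree_on M S' D' (proj_change D \<Upsilon>)" using \<Upsilon>(2) assms(3) unfolding agree_on_def by blast
  then show ?thesis using one_forms_subset[OF \<Upsilon>(1) assms(2,3)] unfolding proj_equivalent_def by blast
qed

end

context bdry_manifold
begin

text \<open>Division by \<open>\<rho>\<close> gives local quotients, and they agree where they are both defined because the interior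
  is dense.  At a boundary point \<open>d\<rho>' = f d\<rho>\<close>, so \<open>f\<close> has no zero there.\<close>

lemma defining_quotient:
  assumes \<rho>: "local_defining k M U \<rho>" and \<rho>': "local_defining k M U \<rho>'"
  obtains f where "f \<in> smooth_funs M U" "\<And>p. p \<in> U \<Longrightarrow> f p \<noteq> 0" "\<And>p. p \<in> U \<Longrightarrow> \<rho>' p = \<rho> p * f p"
proof -
  define Q where "Q p r \<longleftrightarrow> (\<exists>W h. p \<in> W \<and> h \<in> smooth_funs M W \<and> W \<subseteq> U \<and> (\<forall>q\<in>W. \<rho>' q = \<rho> q * h q) \<and> r = h p)" for p r
  define f where "f p = (SOME r. Q p r)" for p
  have Q_unique: "r1 = r2" if Q: "Q p r1" "Q p r2" for p r1 r2
  proof -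
    obtain W1 h1 where 1: "p \<in> W1" "h1 \<in> smooth_funs M W1" "W1 \<subseteq> U" "\<forall>q\<in>W1. \<rho>' q = \<rho> q * h1 q" "r1 = h1 p"
      using Q(1) unfolding Q_def by blast
    obtain W2 h2 where 2: "p \<in> W2" "h2 \<in> smooth_funs M W2" "W2 \<subseteq> U" "\<forall>q\<in>W2. \<rho>' q = \<rho> q * h2 q" "r2 = h2 p"
      using Q(2) unfolding Q_def by blast
    have s1: "h1 \<in> smooth_funs M (W2 \<inter> W1)" by (rule smooth_funs_Int[OF 1(2) smooth_funs_openin[OF 2(2)]])
    have s2: "h2 \<in> smooth_funs M (W2 \<inter> W1)"
      using smooth_funs_Int[OF 2(2) smooth_funs_openin[OF 1(2)]] by (simp only: Int_commute)
    have "h1 p = h2 p"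
      by (rule smooth_funs_eq_of_intr[OF s1 s2])
        (use 1 2 local_defining_intr[OF \<rho>] in \<open>auto simp: subset_eq\<close>)
    then show ?thesis using 1(5) 2(5) by simp
  qed
  have Q_ex: "\<exists>W h. p \<in> W \<and> h \<in> smooth_funs M W \<and> W \<subseteq> U \<and> (\<forall>q\<in>W. \<rho>' q = \<rho> q * h q)" if p: "p \<in> U" for p
  proof (cases "p \<in> bdry k M")
    case True
    then obtain W h where "p \<in> W" "W \<subseteq> U" "h \<in> smooth_funs M W" "\<And>q. q \<in> W \<Longrightarrow> \<rho>' q = \<rho> q * h q"
      using divide_by_defining[OF \<rho> True p p local_defining_smooth[OF \<rho>']] local_defining_zero[OF \<rho>'] by metis
    then show ?thesis by blast
  next
    case False
    let ?W = "U \<inter> intr k M"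
    have "openin (mtop M) ?W" using local_defining_openin[OF \<rho>] openin_intr by blast
    then have "\<rho> \<in> smooth_funs M ?W" "\<rho>' \<in> smooth_funs M ?W"
      using smooth_funs_subset local_defining_smooth[OF \<rho>] local_defining_smooth[OF \<rho>'] by auto
    then have "(\<lambda>q. \<rho>' q / \<rho> q) \<in> smooth_funs M ?W"
      by (intro smooth_funs_divide) (use local_defining_intr[OF \<rho>] in auto)
    then show ?thesis
      using False p local_defining_intr[OF \<rho>] intr_cases[of p] openin_subset[OF local_defining_openin[OF \<rho>]]
      by (intro exI[of _ ?W] exI[of _ "\<lambda>q. \<rho>' q / \<rho> q"]) auto
  qed
  have f_eq: "f q = h q" if "q \<in> W" "h \<in> smooth_funs M W" "W \<subseteq> U" "\<forall>q\<in>W. \<rho>' q = \<rho> q * h q" for q W h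
  proof -
    have "Q q (h q)" using that unfolding Q_def by blast
    then show ?thesis unfolding f_def using Q_unique someI[of "Q q"] by blast
  qed
  have f\<rho>: "\<rho>' p = \<rho> p * f p" if "p \<in> U" for p
    using Q_ex[OF that] f_eq by metis
  have sm: "f \<in> smooth_funs M U"
  proof (rule smooth_funs_local)
    fix p assume "p \<in> U"
    then obtain W h where W: "p \<in> W" "h \<in> smooth_funs M W" "W \<subseteq> U" "\<forall>q\<in>W. \<rho>' q = \<rho> q * h q" using Q_ex by blast
    have "f \<in> smooth_funs M W" by (rule smooth_funs_cong[OF W(2)]) (use f_eq[OF _ W(2-4)] in simp)
    then show "\<exists>V. p \<in> V \<and> V \<subseteq> U \<and> f \<in> smooth_funs M V" using W by blast
  qed
  have "f p \<noteq> 0" if p: "p \<in> U" for p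
  proof (cases "p \<in> bdry k M")
    case True
    then obtain v where v: "v \<in> tspace M p" "v \<rho>' \<noteq> 0" using \<rho>' p unfolding local_defining_def by blast
    have "v \<rho>' = v (\<lambda>q. \<rho> q * f q)" by (rule tspace_cong[OF v(1) local_defining_openin[OF \<rho>] p f\<rho>])
    also have "\<dots> = \<rho> p * v f + f p * v \<rho>"
      by (rule tspace_mult[OF v(1) smooth_atI[OF local_defining_smooth[OF \<rho>] p] smooth_atI[OF sm p]])
    finally show ?thesis using v(2) local_defining_zero[OF \<rho> p] True by auto
  next
    case False
    then show ?thesis using f\<rho>[OF p] local_defining_zero[OF \<rho>' p] by auto
  qed
  then show ?thesis using that sm f\<rho> by blast
qed

end

context precompact_mfd
begin

lemma restricts_to_boundaryE:
  assumes Db: "restricts_to_boundary k M U N Db" and V: "V \<subseteq> U" and x: "extends_field V \<xi> X" "extends_field V \<eta> Y"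
    and XY: "X \<in> vfields (bdry_mfd k M) (V \<inter> bdry k M)" "Y \<in> vfields (bdry_mfd k M) (V \<inter> bdry k M)"
  obtains \<zeta> where "\<zeta> \<in> vfields M V" "\<And>p. p \<in> V \<Longrightarrow> p \<in> intr k M \<Longrightarrow> \<zeta> p = N \<xi> \<eta> p"
    "\<And>p. p \<in> V \<Longrightarrow> p \<in> bdry k M \<Longrightarrow> \<zeta> p = bdry_incl M p (Db X Y p)"
proof -
  have "\<exists>\<zeta>\<in>vfields M V. (\<forall>p\<in>V \<inter> intr k M. \<zeta> p = N \<xi> \<eta> p) \<and> (\<forall>p\<in>V \<inter> bdry k M. \<zeta> p = bdry_incl M p (Db X Y p))"
    by (rule Db[unfolded restricts_to_boundary_def, THEN conjunct2, rule_format])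
      (use V x XY in \<open>auto simp: extends_field_def\<close>)
  then show ?thesis using that by blast
qed

lemma restricts_to_boundary_conn:
  "restricts_to_boundary k M U N Db \<Longrightarrow> linear_connection (bdry_mfd k M) (U \<inter> bdry k M) Db"
  unfolding restricts_to_boundary_def by blast

text \<open>If \<open>\<rho>' = f \<rho>\<close> then \<open>\<nabla>\<^bsup>\<rho>'\<^esup> = \<nabla>\<^sup>\<rho> + df / f\<close>, and this relation restricts to the boundary.\<close>

lemma restrictions_proj_equivalent:
  assumes \<rho>: "local_defining k M U \<rho>" "restricts_to_boundary k M U (\<nabla> \<rho>) Db"
    and \<rho>': "local_defining k M U' \<rho>'" "restricts_to_boundary k M U' (\<nabla> \<rho>') Db'"
  shows "proj_equivalent (bdry_mfd k M) (U \<inter> U' \<inter> bdry k M) Db Db'"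
proof -
  let ?N = "bdry_mfd k M" and ?S = "U \<inter> U'"
  have oS: "openin (mtop M) ?S" using local_defining_openin \<rho>(1) \<rho>'(1) by blast
  have \<rho>S: "local_defining k M ?S \<rho>" by (rule local_defining_subset[OF \<rho>(1) oS]) blast
  have \<rho>S': "local_defining k M ?S \<rho>'" by (rule local_defining_subset[OF \<rho>'(1) oS]) blast
  obtain f where f: "f \<in> smooth_funs M ?S" "\<And>p. p \<in> ?S \<Longrightarrow> f p \<noteq> 0" "\<And>p. p \<in> ?S \<Longrightarrow> \<rho>' p = \<rho> p * f p"
    using defining_quotient[OF \<rho>S \<rho>S'] by blast
  let ?\<Upsilon> = "\<lambda>p v. v f / f p"
  have \<Upsilon>: "?\<Upsilon> \<in> one_forms ?N (?S \<inter> bdry k M)"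
    by (rule bdry.one_form_dlog[OF smooth_funs_restrict[OF f(1)]]) (use f(2) in blast)
  have dlog: "v \<rho>' / \<rho>' q = v \<rho> / \<rho> q + v f / f q" if q: "q \<in> ?S" "q \<in> intr k M" and v: "v \<in> tspace M q" for q v
  proof -
    have "v \<rho>' = v (\<lambda>q. \<rho> q * f q)" by (rule tspace_cong[OF v oS q(1) f(3)])
    also have "\<dots> = \<rho> q * v f + f q * v \<rho>"
      by (rule tspace_mult[OF v smooth_atI[OF local_defining_smooth[OF \<rho>S] q(1)] smooth_atI[OF f(1) q(1)]])
    finally show ?thesis using f(2,3)[OF q(1)] local_defining_intr[OF \<rho>S q] by (simp add: field_simps)
  qed
  have "agree_on ?N (?S \<inter> bdry k M) Db' (proj_change Db ?\<Upsilon>)"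
    unfolding agree_on_def
  proof (intro allI impI ballI; elim conjE)
    fix W X Y p assume W: "W \<subseteq> ?S \<inter> bdry k M" and X: "X \<in> vfields ?N W" and Y: "Y \<in> vfields ?N W" and p: "p \<in> W"
    obtain V \<xi> \<eta> where V: "p \<in> V" "V \<subseteq> ?S" "V \<inter> bdry k M \<subseteq> W" "openin (mtop M) V"
      and x: "extends_field V \<xi> X" "extends_field V \<eta> Y"
      using extends_field3_exists[OF X Y X W oS p] by metis
    note xf = x[THEN extends_fieldD(2)]
    have pb: "p \<in> bdry k M" using p W by blast
    have XV: "X \<in> vfields ?N (V \<inter> bdry k M)" "Y \<in> vfields ?N (V \<inter> bdry k M)"
      using bdry.vfields_subset[OF _ openin_bdryI[OF V(4)] V(3)] X Y by auto
    obtain \<zeta> where \<zeta>: "\<zeta> \<in> vfields M V" "\<And>p. p \<in> V \<Longrightarrow> p \<in> intr k M \<Longrightarrow> \<zeta> p = \<nabla> \<rho> \<xi> \<eta> p"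
      "\<And>p. p \<in> V \<Longrightarrow> p \<in> bdry k M \<Longrightarrow> \<zeta> p = bdry_incl M p (Db X Y p)"
      using restricts_to_boundaryE[OF \<rho>(2) _ x XV] V(2) by (metis Int_subset_iff)
    obtain \<zeta>' where \<zeta>': "\<zeta>' \<in> vfields M V" "\<And>p. p \<in> V \<Longrightarrow> p \<in> intr k M \<Longrightarrow> \<zeta>' p = \<nabla> \<rho>' \<xi> \<eta> p"
      "\<And>p. p \<in> V \<Longrightarrow> p \<in> bdry k M \<Longrightarrow> \<zeta>' p = bdry_incl M p (Db' X Y p)"
      using restricts_to_boundaryE[OF \<rho>'(2) _ x XV] V(2) by (metis Int_subset_iff)
    have fV: "f \<in> smooth_funs M V" by (rule smooth_funs_subset[OF f(1) V(4,2)])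
    have dV: "(\<lambda>q. X q f / f q) \<in> smooth_funs M V" if "X \<in> vfields M V" for X
      by (rule smooth_funs_divide[OF vfields_smooth[OF that subset_refl fV] fV]) (use f(2) V(2) in blast)
    have "\<zeta>' p = (\<lambda>g. 1 * \<zeta> p g + 1 * (\<xi> p f / f p * \<eta> p g + \<eta> p f / f p * \<xi> p g))"
    proof (rule vfields_eq_of_intr[OF \<zeta>'(1) _ _ V(1)])
      show "(\<lambda>p g. 1 * \<zeta> p g + 1 * (\<xi> p f / f p * \<eta> p g + \<eta> p f / f p * \<xi> p g)) \<in> vfields M V"
        by (intro vfields_lincomb \<zeta>(1) xf dV smooth_funs_const V(4))
      fix q g assume q: "q \<in> V" "q \<in> intr k M"
      have qS: "q \<in> ?S" using q(1) V(2) by blast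
      note d = dlog[OF qS q(2) vfields_tspace[OF xf(1) q(1)]] dlog[OF qS q(2) vfields_tspace[OF xf(2) q(1)]]
      show "\<zeta>' q g = 1 * \<zeta> q g + 1 * (\<xi> q f / f q * \<eta> q g + \<eta> q f / f q * \<xi> q g)"
        unfolding \<zeta>'(2)[OF q] \<zeta>(2)[OF q] nabla_rho_def proj_change_def d by (simp add: algebra_simps)
    qed
    moreover have XYp: "\<xi> p = bdry_incl M p (X p)" "\<eta> p = bdry_incl M p (Y p)"
      using extends_fieldD(3)[OF x(1) V(1) pb] extends_fieldD(3)[OF x(2) V(1) pb] by auto
    moreover have "\<xi> p f = X p f" "\<eta> p f = Y p f"
      unfolding XYp by (rule bdry_incl_apply[OF smooth_atI[OF fV V(1)]])+
    ultimately have eq: "bdry_incl M p (Db' X Y p)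
        = bdry_incl M p (\<lambda>g. 1 * Db X Y p g + 1 * (X p f / f p * Y p g + Y p f / f p * X p g))"
      unfolding bdry_incl_lincomb using \<zeta>(3)[OF V(1) pb] \<zeta>'(3)[OF V(1) pb] by simp
    have t: "Db X Y p \<in> tspace ?N p" "Db' X Y p \<in> tspace ?N p"
      using bdry.vfields_tspace[OF bdry.conn_vfields[OF restricts_to_boundary_conn[OF \<rho>(2)] _ X Y] p]
        bdry.vfields_tspace[OF bdry.conn_vfields[OF restricts_to_boundary_conn[OF \<rho>'(2)] _ X Y] p] W by auto
    have "Db' X Y p = (\<lambda>g. 1 * Db X Y p g + 1 * (X p f / f p * Y p g + Y p f / f p * X p g))"
      by (rule bdry_incl_inj[OF t(2) _ eq])
        (intro bdry.tspace_lincomb t bdry.vfields_tspace[OF X p] bdry.vfields_tspace[OF Y p])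
    then show "Db' X Y p = proj_change Db ?\<Upsilon> X Y p" by (simp add: proj_change_def add.assoc)
  qed
  then show ?thesis using \<Upsilon> unfolding proj_equivalent_def by blast
qed

end

context totally_geodesic_precompact_mfd
begin

text \<open>Both connections describe the boundary values of the same extensions, and the inclusion of the
  boundary is injective on tangent vectors.\<close>

lemma bdry_conn_unique:
  assumes \<rho>: "local_defining k M U \<rho>" and Db: "restricts_to_boundary k M U (\<nabla> \<rho>) Db"
  shows "agree_on (bdry_mfd k M) (U \<inter> bdry k M) (bdry_conn \<rho> U) Db"
  unfolding agree_on_def
proof (intro allI impI ballI; elim conjE)
  let ?N = "bdry_mfd k M"
  fix W X Y p assume W: "W \<subseteq> U \<inter> bdry k M" and X: "X \<in> vfields ?N W" and Y: "Y \<in> vfields ?N W" and p: "p \<in> W"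
  obtain V \<xi> \<eta> where V: "p \<in> V" "V \<subseteq> U" "V \<inter> bdry k M \<subseteq> W" "openin (mtop M) V"
    and x: "extends_field V \<xi> X" "extends_field V \<eta> Y"
    using extends_field3_exists[OF X Y X W local_defining_openin[OF \<rho>] p] by metis
  have pb: "p \<in> bdry k M" using p W by blast
  have XV: "X \<in> vfields ?N (V \<inter> bdry k M)" "Y \<in> vfields ?N (V \<inter> bdry k M)"
    using bdry.vfields_subset[OF _ openin_bdryI[OF V(4)] V(3)] X Y by auto
  obtain \<zeta> where \<zeta>: "\<zeta> \<in> vfields M V" "\<And>p. p \<in> V \<Longrightarrow> p \<in> intr k M \<Longrightarrow> \<zeta> p = \<nabla> \<rho> \<xi> \<eta> p"
    "\<And>p. p \<in> V \<Longrightarrow> p \<in> bdry k M \<Longrightarrow> \<zeta> p = bdry_incl M p (Db X Y p)"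
    using restricts_to_boundaryE[OF Db V(2) x XV] by metis
  have t: "Db X Y p \<in> tspace ?N p"
    by (rule bdry.vfields_tspace[OF bdry.conn_vfields[OF restricts_to_boundary_conn[OF Db] W X Y] p])
  show "bdry_conn \<rho> U X Y p = Db X Y p"
    by (rule bdry_incl_inj[OF bdry_conn_eq(1)[OF \<rho> V(2) x \<zeta>(1,2) V(1) pb] t])
      (use bdry_conn_eq(2)[OF \<rho> V(2) x \<zeta>(1,2) V(1) pb] \<zeta>(3)[OF V(1) pb] in simp_all)
qed

end

context bdry_manifold
begin

text \<open>The positive coordinate directions do not leave the half-space, so these are one-sided derivatives of
  a nonnegative function at a zero.\<close>

lemma chart_vf_inward:
  assumes U: "(U, \<phi>) \<in> charts M" "p \<in> U" and f: "f \<in> smooth_funs M W" "p \<in> W" "\<And>q. q \<in> W \<Longrightarrow> 0 \<le> f q" "f p = 0"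
  shows "0 \<le> chart_vf U \<phi> i p f"
proof -
  obtain G g where G: "open G" "\<phi> p \<in> G" "Cinf_on G g"
    "\<And>q. q \<in> U \<Longrightarrow> q \<in> W \<Longrightarrow> \<phi> q \<in> G \<Longrightarrow> f q = g (\<phi> q)"
    using smooth_funsE[OF f(1) U f(2)] by blast
  have "chart_rep U \<phi> p f g"
    by (rule chart_repI[where G=G and W=W]) (use G f(2) smooth_funs_openin[OF f(1)] in auto)
  then have eq: "chart_vf U \<phi> i p f = pd g i (\<phi> p)" by (rule chart_vf_eq[OF U])
  obtain Q where Q: "open Q" "\<phi> ` (U \<inter> W) = halfspace k \<inter> Q"
    using chart_image_open[OF U(1) smooth_funs_openin[OF f(1)]] model_M by metis
  have pQ: "\<phi> p \<in> G \<inter> Q" using Q(2) U(2) f(2) G(2) by blast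
  have "open (G \<inter> Q)" using G(1) Q(1) by (rule open_Int)
  then obtain d where d: "0 < d" "ball (\<phi> p) d \<subseteq> G \<inter> Q" using openE[OF _ pQ] by blast
  show ?thesis unfolding eq pd_def
  proof (rule derivative_nonneg_along[OF Cinf_on_has_derivative[OF G(3,2)] _ d(1)])
    show "g (\<phi> p) = 0" using G(4)[OF U(2) f(2) G(2)] f(4) by simp
    fix t assume t: "0 < t" "t < d"
    let ?z = "\<phi> p + t *\<^sub>R axis i 1"
    have z: "?z \<in> ball (\<phi> p) d" using t by (simp add: dist_norm)
    have "?z \<in> halfspace k" using chart_nonneg[OF U] t(1) by (simp add: halfspace_def axis_def)
    then have "?z \<in> \<phi> ` (U \<inter> W)" unfolding Q(2) using subsetD[OF d(2) z] by blast
    then obtain q where q: "q \<in> U" "q \<in> W" "?z = \<phi> q" by blast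
    then show "0 \<le> g ?z" using G(4)[OF q(1,2)] f(3)[OF q(2)] subsetD[OF d(2) z] by simp
  qed
qed

text \<open>In a Hausdorff space the compact set that carries \<open>f\<close> is closed, so its complement is an open
  set on which the extension is 0.\<close>

lemma smooth_funs_extend_zero:
  assumes U: "(U, \<phi>) \<in> charts M" and K: "compact K" "halfspace k \<inter> K \<subseteq> \<phi> ` U"
    and f: "f \<in> smooth_funs M U" "\<And>q. q \<in> U \<Longrightarrow> \<phi> q \<notin> K \<Longrightarrow> f q = 0"
  shows "(\<lambda>q. if q \<in> U then f q else 0) \<in> smooth_funs M (topspace (mtop M))"
proof -
  define C where "C = {q \<in> U. \<phi> q \<in> K}"
  have img: "\<phi> ` C = halfspace k \<inter> K"
    using K(2) chart_model[OF U] model_M by (auto simp: C_def)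
  have "closed (halfspace k)" unfolding halfspace_def
    by (intro closed_Collect_le continuous_intros)
  then have "compact (halfspace k \<inter> K)" using K(1) by (simp add: closed_Int_compact)
  then have "compactin (top_of_set (\<phi> ` U)) (\<phi> ` C)"
    using K(2) unfolding img by (simp add: compactin_subtopology)
  moreover have "C \<subseteq> topspace (subtopology (mtop M) U)" unfolding chart_topspace[OF U] by (auto simp: C_def)
  ultimately have "compactin (subtopology (mtop M) U) C"
    using homeomorphic_map_compactness[OF chart_homeo[OF U]] by blast
  then have "compactin (mtop M) C" by (simp add: compactin_subtopology)
  moreover have "Hausdorff_space (mtop M)" using M unfolding smooth_manifold_def by blast
  ultimately have "closedin (mtop M) C" by (simp add: compactin_imp_closedin)
  then have oC: "openin (mtop M) (topspace (mtop M) - C)" by blast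
  show ?thesis
  proof (rule smooth_funs_local)
    fix p assume p: "p \<in> topspace (mtop M)"
    show "\<exists>V. p \<in> V \<and> V \<subseteq> topspace (mtop M) \<and> (\<lambda>q. if q \<in> U then f q else 0) \<in> smooth_funs M V"
    proof (cases "p \<in> U")
      case True
      have "(\<lambda>q. if q \<in> U then f q else 0) \<in> smooth_funs M U" by (rule smooth_funs_cong[OF f(1)]) simp
      then show ?thesis using True openin_subset[OF chart_open[OF U]] by blast
    next
      case False
      have "(\<lambda>q. if q \<in> U then f q else 0) \<in> smooth_funs M (topspace (mtop M) - C)"
        by (rule smooth_funs_cong[OF smooth_funs_const[OF oC, of 0]]) (use f(2) in \<open>auto simp: C_def\<close>)
      then show ?thesis using False p by (intro exI[of _ "topspace (mtop M) - C"]) (auto simp: C_def)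
    qed
  qed
qed

text \<open>The properties used in gluing, of a cut-off function \<open>b\<close> with support in a chart and of the product \<open>r\<close>
  of \<open>b\<close> with the normal coordinate of the chart; \<open>v\<close> in the last clause is realized by the inward
  coordinate vector.\<close>

definition bump_pair :: "'m set \<Rightarrow> ('m \<Rightarrow> real) \<Rightarrow> ('m \<Rightarrow> real) \<Rightarrow> bool" where
  "bump_pair V b r \<longleftrightarrow> openin (mtop M) V \<and> b \<in> smooth_funs M (topspace (mtop M)) \<and>
     r \<in> smooth_funs M (topspace (mtop M)) \<and> (\<forall>q\<in>V. b q = 1) \<and>
     (\<forall>q\<in>topspace (mtop M). 0 \<le> b q \<and> b q \<le> 1 \<and> 0 \<le> r q \<and> (q \<in> bdry k M \<longrightarrow> r q = 0) \<and>
        (q \<in> intr k M \<and> 0 < b q \<longrightarrow> 0 < r q) \<and>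
        (q \<in> bdry k M \<and> 0 < b q \<longrightarrow> (\<exists>v\<in>tspace M q. 0 < v r \<and>
            (\<forall>f\<in>smooth_funs M (topspace (mtop M)). f q = 0 \<and> (\<forall>x\<in>topspace (mtop M). 0 \<le> f x) \<longrightarrow> 0 \<le> v f))))"

lemma bump_pair_exists:
  assumes p: "p \<in> topspace (mtop M)"
  shows "\<exists>V b r. p \<in> V \<and> bump_pair V b r"
proof -
  let ?T = "topspace (mtop M)"
  obtain U \<phi> where U: "(U, \<phi>) \<in> charts M" "p \<in> U" using chart_cover[OF p] .
  obtain Q where Q: "open Q" "\<phi> ` (U \<inter> U) = halfspace k \<inter> Q"
    using chart_image_open[OF U(1) chart_open[OF U(1)]] model_M by metis
  have "\<phi> p \<in> Q" using Q(2) U(2) by blast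
  then obtain e where e: "0 < e" "ball (\<phi> p) e \<subseteq> Q" using Q(1) openE by blast
  define d where "d = e / 4"
  have d: "0 < d" using e(1) by (simp add: d_def)
  obtain \<beta> where \<beta>: "Cinf_on UNIV \<beta>" "\<And>x. 0 \<le> \<beta> x \<and> \<beta> x \<le> (1::real)"
    "\<And>x. x \<in> ball (\<phi> p) d \<Longrightarrow> \<beta> x = 1" "\<And>x. x \<notin> ball (\<phi> p) (2 * d) \<Longrightarrow> \<beta> x = 0"
    using smooth_bump_exists[OF d, of "\<phi> p"] by blast
  let ?K = "cball (\<phi> p) (2 * d)"
  have "?K \<subseteq> ball (\<phi> p) e" using e(1) by (auto simp: d_def)
  then have K: "compact ?K" "halfspace k \<inter> ?K \<subseteq> \<phi> ` U" using e(2) Q(2) by auto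
  define b where "b q = (if q \<in> U then \<beta> (\<phi> q) else 0)" for q
  define r where "r q = (if q \<in> U then \<beta> (\<phi> q) * \<phi> q $ k else 0)" for q
  have s\<beta>: "(\<lambda>q. \<beta> (\<phi> q)) \<in> smooth_funs M U"
    using smooth_funs_chart_compose[OF U(1) open_UNIV \<beta>(1)] by simp
  note sc = smooth_funs_coord[OF U(1), of k]
  have zero: "\<beta> (\<phi> q) = 0" if "\<phi> q \<notin> ?K" for q by (rule \<beta>(4)) (use that in auto)
  have b: "b \<in> smooth_funs M ?T"
    unfolding b_def by (rule smooth_funs_extend_zero[OF U(1) K s\<beta>]) (use zero in blast)
  have r: "r \<in> smooth_funs M ?T"
    unfolding r_def by (rule smooth_funs_extend_zero[OF U(1) K smooth_funs_mult[OF s\<beta> sc]]) (use zero in simp)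
  let ?V = "{q \<in> U. \<phi> q \<in> ball (\<phi> p) d}"
  have "bump_pair ?V b r"
    unfolding bump_pair_def
  proof (intro conjI ballI impI)
    show "openin (mtop M) ?V" by (rule chart_preimage_open[OF U(1) open_ball])
    show "b \<in> smooth_funs M ?T" "r \<in> smooth_funs M ?T" by (rule b, rule r)
    show "b q = 1" if "q \<in> ?V" for q using that \<beta>(3) by (simp add: b_def)
    fix q
    show "0 \<le> b q" "b q \<le> 1" using \<beta>(2) by (simp_all add: b_def)
    show "0 \<le> r q" using \<beta>(2) chart_nonneg[OF U(1)] by (simp add: r_def)
    show "r q = 0" if "q \<in> bdry k M" using bdry_iff[OF U(1), of q] that by (auto simp: r_def)
    show "0 < r q" if "q \<in> intr k M \<and> 0 < b q"
      using that intr_iff[OF U(1), of q] by (auto simp: r_def b_def split: if_splits)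
    assume q: "q \<in> bdry k M \<and> 0 < b q"
    then have qU: "q \<in> U" and \<beta>q: "0 < \<beta> (\<phi> q)" by (auto simp: b_def split: if_splits)
    let ?v = "chart_vf U \<phi> k q"
    show "\<exists>v\<in>tspace M q. 0 < v r \<and>
            (\<forall>f\<in>smooth_funs M ?T. f q = 0 \<and> (\<forall>x\<in>?T. 0 \<le> f x) \<longrightarrow> 0 \<le> v f)"
    proof (intro bexI conjI ballI impI)
      show v: "?v \<in> tspace M q" by (rule chart_vf_tspace[OF U(1) qU])
      have "?v r = ?v (\<lambda>q. \<beta> (\<phi> q) * \<phi> q $ k)"
        by (rule tspace_cong[OF v chart_open[OF U(1)] qU]) (simp add: r_def)
      also have "\<dots> = \<beta> (\<phi> q)"
        using tspace_mult[OF v smooth_atI[OF s\<beta> qU] smooth_atI[OF sc qU]] bdry_iff[OF U(1) qU] q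
          chart_vf_coord[OF U(1) qU, of k k] by simp
      finally show "0 < ?v r" using \<beta>q by simp
      fix f assume f: "f \<in> smooth_funs M ?T" "f q = 0 \<and> (\<forall>x\<in>?T. 0 \<le> f x)"
      have "q \<in> ?T" using openin_subset[OF chart_open[OF U(1)]] qU by blast
      then show "0 \<le> ?v f" using chart_vf_inward[OF U(1) qU f(1)] f(2) by blast
    qed
  qed
  moreover have "p \<in> ?V" using U(2) d by simp
  ultimately show ?thesis by (intro exI[of _ ?V] exI[of _ b] exI[of _ r] conjI)
qed

text \<open>Countably many cut-off functions \<open>b\<^sub>i\<close>, with the sets where \<open>b\<^sub>i = 1\<close> covering, give a locally
  finite partition of unity \<open>b\<^sub>i \<Prod>\<^sub>j\<^sub><\<^sub>i (1 - b\<^sub>j)\<close>; with it the normal coordinates of charts are glued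
  to a global defining function.\<close>

lemma global_defining_function:
  obtains \<rho> where "local_defining k M (topspace (mtop M)) \<rho>"
proof (cases "topspace (mtop M) = {}")
  case True
  then have "local_defining k M (topspace (mtop M)) (\<lambda>_. 0)"
    using smooth_funs_const[OF openin_topspace] by (simp add: local_defining_def)
  then show ?thesis by (rule that)
next
  case False
  let ?T = "topspace (mtop M)"
  let ?\<U> = "{V. \<exists>b r. bump_pair V b r}"
  have L: "Lindelof_space (mtop M)"
    by (rule second_countable_imp_Lindelof_space) (use M in \<open>simp add: smooth_manifold_def\<close>)
  have oU: "openin (mtop M) V" if "V \<in> ?\<U>" for V using that by (auto simp: bump_pair_def)
  have cU: "\<Union>?\<U> = ?T"
  proof
    show "\<Union>?\<U> \<subseteq> ?T" using openin_subset[OF oU] by blast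
    show "?T \<subseteq> \<Union>?\<U>" using bump_pair_exists by blast
  qed
  have "\<exists>\<V>. countable \<V> \<and> \<V> \<subseteq> ?\<U> \<and> \<Union>\<V> = ?T"
    by (rule Lindelof_spaceD[OF L oU cU])
  then obtain \<V> where \<V>: "countable \<V>" "\<V> \<subseteq> ?\<U>" "\<Union>\<V> = ?T"
    by (elim exE conjE) rule
  have ne: "\<V> \<noteq> {}" using \<V>(3) False by blast
  define V where "V = from_nat_into \<V>"
  have rV: "range V = \<V>" unfolding V_def by (rule range_from_nat_into[OF ne \<V>(1)])
  then have "\<forall>i. \<exists>b r. bump_pair (V i) b r" using \<V>(2) by blast
  then obtain b r where br: "\<And>i. bump_pair (V i) (b i) (r i)" by metis
  have b: "b i \<in> smooth_funs M ?T" "r i \<in> smooth_funs M ?T" and b1: "q \<in> V i \<Longrightarrow> b i q = 1" for i q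
    using br[of i] unfolding bump_pair_def by blast+
  have bq: "0 \<le> b i q" "b i q \<le> 1" "0 \<le> r i q" "q \<in> bdry k M \<Longrightarrow> r i q = 0"
    "q \<in> intr k M \<Longrightarrow> 0 < b i q \<Longrightarrow> 0 < r i q" if "q \<in> ?T" for i q
    using br[of i] that unfolding bump_pair_def by blast+
  define t where "t i q = r i q * (\<Prod>j<i. 1 + - b j q)" for i q
  \<comment> \<open>On \<open>V n\<close> all \<open>t i\<close> with \<open>n < i\<close> vanish, so the sum may be cut off at any such \<open>n\<close>.\<close>
  define N where "N q = (LEAST n. q \<in> V n)" for q
  define \<rho> where "\<rho> q = (\<Sum>i\<le>N q. t i q)" for q
  have cover: "\<exists>n. q \<in> V n" if "q \<in> ?T" for q using that \<V>(3) rV by blast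
  have VN: "q \<in> V (N q)" if "q \<in> ?T" for q unfolding N_def using cover[OF that] by (rule LeastI_ex)
  have st: "t i \<in> smooth_funs M ?T" for i
    unfolding t_def
    by (intro smooth_funs_mult smooth_funs_prod smooth_funs_add smooth_funs_uminus smooth_funs_const b openin_topspace)
  have t0: "0 \<le> t i q" if "q \<in> ?T" for i q
    unfolding t_def by (intro mult_nonneg_nonneg prod_nonneg) (use bq[OF that] in auto)
  have \<rho>_eq: "\<rho> q = (\<Sum>i\<le>m. t i q)" if q: "q \<in> V m" for q m
  proof -
    have qT: "q \<in> ?T" using q rV \<V>(3) by blast
    have "N q \<le> m" unfolding N_def using q by (rule Least_le)
    have "t i q = 0" if i: "i \<in> {..m} - {..N q}" for i
    proof -
      have "(\<Prod>j<i. 1 + - b j q) = 0"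
        by (rule prod_zero) (use i b1[OF VN[OF qT]] in \<open>auto intro!: bexI[of _ "N q"]\<close>)
      then show ?thesis by (simp add: t_def)
    qed
    then show ?thesis unfolding \<rho>_def by (intro sum.mono_neutral_left) (use \<open>N q \<le> m\<close> in auto)
  qed
  have s\<rho>: "\<rho> \<in> smooth_funs M ?T"
  proof (rule smooth_funs_local)
    fix p assume p: "p \<in> ?T"
    have oV: "openin (mtop M) (V (N p))" using br[of "N p"] unfolding bump_pair_def by blast
    have "(\<lambda>q. \<Sum>i\<le>N p. t i q) \<in> smooth_funs M (V (N p))"
      by (intro smooth_funs_sum oV smooth_funs_subset[OF st oV] openin_subset[OF oV])
    then have "\<rho> \<in> smooth_funs M (V (N p))" by (rule smooth_funs_cong) (simp add: \<rho>_eq)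
    then show "\<exists>V. p \<in> V \<and> V \<subseteq> ?T \<and> \<rho> \<in> smooth_funs M V" using VN[OF p] openin_subset[OF oV] by blast
  qed
  have t_le: "t i q \<le> \<rho> q" if q: "q \<in> ?T" for i q
  proof (cases "i \<le> N q")
    case True
    then show ?thesis unfolding \<rho>_def by (intro member_le_sum) (use t0[OF q] in auto)
  next
    case False
    have "(\<Prod>j<i. 1 + - b j q) = 0"
      by (rule prod_zero) (use False b1[OF VN[OF q]] in \<open>auto intro!: bexI[of _ "N q"]\<close>)
    then have "t i q = 0" by (simp add: t_def)
    then show ?thesis unfolding \<rho>_def by (simp add: sum_nonneg t0[OF q])
  qed
  \<comment> \<open>For the first cut-off function that does not vanish at \<open>q\<close>, all earlier factors are 1.\<close>
  have first: "\<exists>i. 0 < b i q \<and> (\<Prod>j<i. 1 + - b j q) = 1" if q: "q \<in> ?T" for q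
  proof -
    have ex: "\<exists>i. 0 < b i q" using b1[OF VN[OF q]] by (intro exI[of _ "N q"]) simp
    define i where "i = (LEAST i. 0 < b i q)"
    have bi: "0 < b i q" unfolding i_def by (rule LeastI_ex[OF ex])
    have b0: "b j q = 0" if "j < i" for j
      using not_less_Least[OF that[unfolded i_def]] bq(1)[OF q, of j] by linarith
    have "(\<Prod>j<i. 1 + - b j q) = 1" by (rule prod.neutral) (use b0 in simp)
    then show ?thesis using bi by (intro exI[of _ i] conjI)
  qed
  have "local_defining k M ?T \<rho>"
    unfolding local_defining_def
  proof (intro conjI ballI)
    show "\<rho> \<in> smooth_funs M ?T" by (rule s\<rho>)
    fix q assume q: "q \<in> ?T"
    show "\<rho> q = 0 \<longleftrightarrow> q \<in> bdry k M"
    proof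
      assume "q \<in> bdry k M"
      then show "\<rho> q = 0" by (simp add: \<rho>_def t_def bq(4)[OF q])
    next
      assume z: "\<rho> q = 0"
      obtain i where i: "0 < b i q" "(\<Prod>j<i. 1 + - b j q) = 1" using first[OF q] by blast
      show "q \<in> bdry k M"
      proof (rule ccontr)
        assume "q \<notin> bdry k M"
        then have "0 < r i q" using bq(5)[OF q _ i(1)] intr_cases[OF q] by blast
        then have "0 < t i q" unfolding t_def i(2) by simp
        then show False using t_le[OF q, of i] z by simp
      qed
    qed
  next
    fix q assume "q \<in> ?T \<inter> bdry k M"
    then have q: "q \<in> ?T" "q \<in> bdry k M" by auto
    obtain i where i: "0 < b i q" "(\<Prod>j<i. 1 + - b j q) = 1" using first[OF q(1)] by blast
    obtain v where v: "v \<in> tspace M q" "0 < v (r i)"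
      and inward: "\<And>f. f \<in> smooth_funs M ?T \<Longrightarrow> f q = 0 \<Longrightarrow> (\<forall>x\<in>?T. 0 \<le> f x) \<Longrightarrow> 0 \<le> v f"
      using br[of i] q i(1) unfolding bump_pair_def by blast
    have at: "smooth_at M q f" if "f \<in> smooth_funs M ?T" for f by (rule smooth_atI[OF that q(1)])
    have sp: "(\<lambda>q. \<Prod>j<i. 1 + - b j q) \<in> smooth_funs M ?T"
      by (intro smooth_funs_prod smooth_funs_add smooth_funs_uminus smooth_funs_const b openin_topspace)
    have "v (t i) = v (r i)"
      using tspace_mult[OF v(1) at[OF b(2)[of i]] at[OF sp]] i(2) bq(4)[OF q] unfolding t_def[abs_def] by simp
    moreover have "0 \<le> v (\<lambda>x. \<rho> x - t i x)"
      by (rule inward[OF smooth_funs_diff[OF s\<rho> st]])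
        (use t_le bq(4)[OF q] in \<open>auto simp: \<rho>_def t_def\<close>)
    ultimately have "0 < v \<rho>" using tspace_diff[OF v(1) at[OF s\<rho>] at[OF st[of i]]] v(2) by simp
    then show "\<exists>v\<in>tspace M q. v \<rho> \<noteq> 0" using v(1) by (intro bexI[of _ v]) auto
  qed
  then show ?thesis by (rule that)
qed

end

theorem proposition2p6:
  fixes M :: "('m, 'n::finite) mfd" and k :: 'n
    and D :: "'m conn" and \<sigma> :: "'m \<Rightarrow> ('m, 'n) dens"
  assumes "manifold_with_boundary k M"
    and "linear_connection M (intr k M) D"
    and "torsion_free M (intr k M) D"
    and "special_connection M (intr k M) D"
    and "proj_precompact k M D"
    and "parallel_density M (intr k M) D (weight1 TYPE('n)) \<sigma>"
    and "nowhere_vanishing M (intr k M) \<sigma>"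
    and "second_fundamental_form_vanishes k M D \<sigma>"
  shows
    "(\<forall>U \<rho>. local_defining k M U \<rho> \<longrightarrow>
        (\<exists>Db. restricts_to_boundary k M U (nabla_rho D \<rho>) Db \<and>
              torsion_free (bdry_mfd k M) (U \<inter> bdry k M) Db \<and>
              (\<forall>Db'. restricts_to_boundary k M U (nabla_rho D \<rho>) Db' \<longrightarrow>
                 agree_on (bdry_mfd k M) (U \<inter> bdry k M) Db Db')))
     \<and> (\<forall>U U' \<rho> \<rho>' Db Db'.
          local_defining k M U \<rho> \<and> restricts_to_boundary k M U (nabla_rho D \<rho>) Db \<and>
          local_defining k M U' \<rho>' \<and> restricts_to_boundary k M U' (nabla_rho D \<rho>') Db' \<longrightarrow>
          proj_equivalent (bdry_mfd k M) (U \<inter> U' \<inter> bdry k M) Db Db')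
     \<and> (\<exists>!P. projective_structure (bdry_mfd k M) (bdry k M) P \<and>
          (\<forall>U \<rho> Db Db'.
             local_defining k M U \<rho> \<and> restricts_to_boundary k M U (nabla_rho D \<rho>) Db \<and>
             Db' \<in> P \<longrightarrow>
             proj_equivalent (bdry_mfd k M) (U \<inter> bdry k M) Db Db'))"
proof -
  interpret totally_geodesic_precompact_mfd M k D \<sigma>
    using assms by unfold_locales
  let ?N = "bdry_mfd k M" and ?b = "bdry k M"
  obtain \<rho>0 where \<rho>0: "local_defining k M (topspace (mtop M)) \<rho>0" by (rule global_defining_function)
  define D0 where "D0 = bdry_conn \<rho>0 (topspace (mtop M))"
  have Tb: "topspace (mtop M) \<inter> ?b = ?b" using bdry_topspace by blast
  have D0: "restricts_to_boundary k M (topspace (mtop M)) (\<nabla> \<rho>0) D0"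
    "linear_connection ?N ?b D0" "torsion_free ?N ?b D0"
    using bdry_conn_restricts[OF \<rho>0] bdry_conn_connection[OF \<rho>0] by (simp_all add: D0_def Tb)
  define cl where "cl D1 = {D'. linear_connection ?N ?b D' \<and> torsion_free ?N ?b D' \<and> proj_equivalent ?N ?b D1 D'}" for D1
  note ob = bdry.conn_openin[OF D0(2)]
  have cl_eq: "cl D1 = cl D2" if "proj_equivalent ?N ?b D1 D2" for D1 D2
    unfolding cl_def using that bdry.proj_equivalent_sym bdry.proj_equivalent_trans by blast
  have 1: "\<exists>Db. restricts_to_boundary k M U (\<nabla> \<rho>) Db \<and> torsion_free ?N (U \<inter> ?b) Db \<and>
      (\<forall>Db'. restricts_to_boundary k M U (\<nabla> \<rho>) Db' \<longrightarrow> agree_on ?N (U \<inter> ?b) Db Db')"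
    if "local_defining k M U \<rho>" for U \<rho>
    using bdry_conn_restricts[OF that] bdry_conn_connection(2)[OF that] bdry_conn_unique[OF that] by blast
  have 2: "proj_equivalent ?N (U \<inter> ?b) Db Db'"
    if \<rho>: "local_defining k M U \<rho>" "restricts_to_boundary k M U (\<nabla> \<rho>) Db" and Db': "Db' \<in> cl D0" for U \<rho> Db Db'
  proof -
    have U: "U \<inter> topspace (mtop M) \<inter> ?b = U \<inter> ?b" using bdry_topspace by blast
    have "proj_equivalent ?N (U \<inter> ?b) Db D0"
      using restrictions_proj_equivalent[OF \<rho> \<rho>0 D0(1)] unfolding U .
    moreover have "proj_equivalent ?N (U \<inter> ?b) D0 Db'"
      by (rule bdry.proj_equivalent_subset[OF _ openin_bdryI[OF local_defining_openin[OF \<rho>(1)]]])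
        (use Db' in \<open>auto simp: cl_def\<close>)
    ultimately show ?thesis by (rule bdry.proj_equivalent_trans)
  qed
  have 3: "P = cl D0"
    if P: "projective_structure ?N ?b P" and eq: "\<forall>U \<rho> Db Db'. local_defining k M U \<rho> \<and>
       restricts_to_boundary k M U (\<nabla> \<rho>) Db \<and> Db' \<in> P \<longrightarrow> proj_equivalent ?N (U \<inter> ?b) Db Db'" for P
  proof -
    obtain D1 where D1: "linear_connection ?N ?b D1" "torsion_free ?N ?b D1" "P = cl D1"
      using P unfolding projective_structure_def cl_def by blast
    have "D1 \<in> P" using D1 bdry.proj_equivalent_refl[OF ob] by (simp add: cl_def)
    then have "proj_equivalent ?N ?b D0 D1" using eq \<rho>0 D0(1) Tb by metis
    then show ?thesis using cl_eq D1(3) by simp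
  qed
  have "projective_structure ?N ?b (cl D0)"
    unfolding projective_structure_def cl_def using D0(2,3) by blast
  then have "\<exists>!P. projective_structure ?N ?b P \<and> (\<forall>U \<rho> Db Db'. local_defining k M U \<rho> \<and>
       restricts_to_boundary k M U (\<nabla> \<rho>) Db \<and> Db' \<in> P \<longrightarrow> proj_equivalent ?N (U \<inter> ?b) Db Db')"
    using 2 3 by (intro ex1I[of _ "cl D0"]) blast+
  moreover have "\<forall>U \<rho>. local_defining k M U \<rho> \<longrightarrow>
      (\<exists>Db. restricts_to_boundary k M U (\<nabla> \<rho>) Db \<and> torsion_free ?N (U \<inter> ?b) Db \<and>
        (\<forall>Db'. restricts_to_boundary k M U (\<nabla> \<rho>) Db' \<longrightarrow> agree_on ?N (U \<inter> ?b) Db Db'))"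
    by (intro allI impI 1)
  moreover have "\<forall>U U' \<rho> \<rho>' Db Db'.
      local_defining k M U \<rho> \<and> restricts_to_boundary k M U (\<nabla> \<rho>) Db \<and>
      local_defining k M U' \<rho>' \<and> restricts_to_boundary k M U' (\<nabla> \<rho>') Db' \<longrightarrow>
      proj_equivalent ?N (U \<inter> U' \<inter> ?b) Db Db'"
    by (intro allI impI; elim conjE; rule restrictions_proj_equivalent)
  ultimately show ?thesis by (intro conjI)
qed

end
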